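(* Let $\omega>0$, $\mu>0$, $f_0\in(0,1)$ and $\lambda\in(\lambda_1,+\infty)$, and let $\overline{u}_{\lambda,\mu}$ be the monotone solution of $P(\lambda,f)$ with free boundary in $(r^*,1)$. Then $\overline{u}_{\lambda,\mu}$ is stable in $L^\infty(0,1)$: for every $\varepsilon>0$ there is $\delta>0$ such that, if $u_0\in L^\infty(0,1)$ satisfies $u_0\ge0$ a.e. in $(0,1)$ and $\|u_0-\overline{u}_{\lambda,\mu}\|_{L^\infty(0,1)}<\delta$, and if $u(t,x:u_0)$ is the non-degenerate solution of $PP^*(\lambda,\beta,u_0)$, then $$\|u(t,\cdot:u_0)-\overline{u}_{\lambda,\mu}\|_{L^\infty(0,1)}<\varepsilon\quad\text{for every } t\ge0.$$
   Context: Let $f(v)=f_0+(1-f_0)H(v-\mu)$, where $H(s)=0$ for $s<0$ and $H(s)=1$ for $s\ge 0$. Let $\beta$ be the maximal monotone graph with $\beta(r)=\{f(r)\}$ for $r\neq\mu$ and $\beta(\mu)=[f_0,1]$. Problem $P(\lambda,f)$ is $-u''+\omega^2u=\lambda f(u)$ in $(0,1)$, $u'(0)=0$, $u(1)=0$. A solution of $P(\lambda,f)$ with free boundary $x_{\lambda,\mu}\in[0,1)$ is a function $u\in C^2((0,1)\setminus\{x_{\lambda,\mu}\})\cap C^1([0,1))$ (continuous up to $x=1$) with $u(x_{\lambda,\mu})=\mu$, $u\ge0$, $u\ne0$, satisfying the equation for every $x\in(0,1)\setminus\{x_{\lambda,\mu}\}$ and the boundary conditions; it is monotone if $u'\le0$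 on $(0,1)$. Set $$g(r)=\frac{\omega^2\cosh\omega}{\sinh(\omega r)\sinh(\omega-\omega r)-f_0\cosh(\omega r)+f_0\cosh(\omega r)\cosh(\omega-\omega r)},\qquad r\in[0,1).$$ The number $r^*\in(0,1)$ is the unique solution in $(0,1)$ of $r^*=\frac12\Big(1+\frac1\omega\sinh^{-1}\big(\frac{f_0}{f_0-1}\sinh(\omega r^* )\big)\Big)$; it is the minimum point of $g$, and $\lambda_1:=\mu g(r^* )$. For $\lambda>\lambda_1$, $\overline{u}_{\lambda,\mu}$ denotes the monotone solution of $P(\lambda,f)$ whose free boundary $\overline{x}_{\lambda,\mu}\in(r^*,1)$ is the root in $(r^*,1)$ of $g(r)=\lambda/\mu$. Problem $PP^*(\lambda,\beta,u_0)$ is $$u_t-u_{xx}+\omega^2u\in\lambda\beta(u),\ x\in(0,1),\ t>0,\qquad u_x(0,t)=0,\ u(1,t)=0,\ t>0,\qquad u(x,0)=u_0(x),\ x\in(0,1),$$ with (weak) solutions understood in the usual sense: there is a bounded measurable $h$ with $h(x,t)\in\beta(u(x,t))$ a.e. such that $u_t-u_{xx}+\omega^2u=\lambda h$ with these boundary and initial conditions. A solution $u$ is non-degenerate if there are $C>0$, $\theta_0>0$ such that $\mathrm{meas}\{x\in(0,1):|u(t,x:u_0)-\mu|\le\theta\}\le C\theta$ for all $\theta\in(0,\theta_0)$ and all $t>0$; uniqueness holds in the class of non-degenerate solutions. *)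

theory Defs
  imports "HOL-Analysis.Analysis" "HOL-Probability.Essential_Supremum"
begin

definition heaviside :: "real \<Rightarrow> real" where
  "heaviside s = (if s < 0 then 0 else 1)"

definition reaction :: "real \<Rightarrow> real \<Rightarrow> real \<Rightarrow> real" where
  "reaction \<mu> f0 v = f0 + (1 - f0) * heaviside (v - \<mu>)"

definition beta :: "real \<Rightarrow> real \<Rightarrow> real \<Rightarrow> real set" where
  "beta \<mu> f0 r = (if r = \<mu> then {f0..1} else {reaction \<mu> f0 r})"

text \<open>Functions on the interval are total functions on the reals of which only the values on
  \<open>[0,1]\<close> matter; accordingly the derivative at \<open>0\<close> is one-sided.\<close>

definition free_boundary_solution ::
    "real \<Rightarrow> real \<Rightarrow> real \<Rightarrow> real \<Rightarrow> real \<Rightarrow> (real \<Rightarrow> real) \<Rightarrow> bool" where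
  "free_boundary_solution \<omega> \<mu> f0 lam xf u \<longleftrightarrow>
     0 \<le> xf \<and> xf < 1 \<and> continuous_on {0..1} u \<and>
     u xf = \<mu> \<and> (\<forall>x\<in>{0..1}. 0 \<le> u x) \<and> (\<exists>x\<in>{0..1}. u x \<noteq> 0) \<and> u 1 = 0 \<and>
     (\<exists>u' u''.
        (\<forall>x\<in>{0..<1}. (u has_real_derivative u' x) (at x within {0..<1})) \<and>
        continuous_on {0..<1} u' \<and> u' 0 = 0 \<and>
        (\<forall>x\<in>{0<..<1} - {xf}. (u' has_real_derivative u'' x) (at x)) \<and>
        continuous_on ({0<..<1} - {xf}) u'' \<and>
        (\<forall>x\<in>{0<..<1} - {xf}. - u'' x + \<omega>\<^sup>2 * u x = lam * reaction \<mu> f0 (u x)))"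

definition monotone_solution ::
    "real \<Rightarrow> real \<Rightarrow> real \<Rightarrow> real \<Rightarrow> real \<Rightarrow> (real \<Rightarrow> real) \<Rightarrow> bool" where
  "monotone_solution \<omega> \<mu> f0 lam xf u \<longleftrightarrow>
     free_boundary_solution \<omega> \<mu> f0 lam xf u \<and> (\<forall>x\<in>{0<..<1}. deriv u x \<le> 0)"

definition gfun :: "real \<Rightarrow> real \<Rightarrow> real \<Rightarrow> real" where
  "gfun \<omega> f0 r = \<omega>\<^sup>2 * cosh \<omega> /
     (sinh (\<omega> * r) * sinh (\<omega> - \<omega> * r) - f0 * cosh (\<omega> * r)
       + f0 * cosh (\<omega> * r) * cosh (\<omega> - \<omega> * r))"

definition rstar :: "real \<Rightarrow> real \<Rightarrow> real" where
  "rstar \<omega> f0 = (THE r. r \<in> {0<..<1} \<and>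
     r = 1/2 * (1 + 1/\<omega> * arsinh (f0 / (f0 - 1) * sinh (\<omega> * r))))"

lemma rstar_unique_existence:
  fixes \<omega> f0 :: real
  assumes w: "\<omega> > 0" and f0: "0 < f0" "f0 < 1"
  shows "\<exists>!r. r \<in> {0<..<1} \<and>
     r = 1/2 * (1 + 1/\<omega> * arsinh (f0 / (f0 - 1) * sinh (\<omega> * r)))"
proof -
  define F where "F r = (1 - f0) * sinh (\<omega> * (2 * r - 1)) + f0 * sinh (\<omega> * r)" for r :: real
  have eq: "r = 1/2 * (1 + 1/\<omega> * arsinh (f0 / (f0 - 1) * sinh (\<omega> * r))) \<longleftrightarrow> F r = 0" for r
  proof -
    have "r = 1/2 * (1 + 1/\<omega> * arsinh (f0 / (f0 - 1) * sinh (\<omega> * r))) \<longleftrightarrow>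
          \<omega> * (2 * r - 1) = arsinh (f0 / (f0 - 1) * sinh (\<omega> * r))"
      using w by (auto simp: field_simps)
    also have "\<dots> \<longleftrightarrow> sinh (\<omega> * (2 * r - 1)) = f0 / (f0 - 1) * sinh (\<omega> * r)"
      by (metis arsinh_sinh_real sinh_arsinh_real)
    also have "\<dots> \<longleftrightarrow> F r = 0"
      using f0 by (auto simp: F_def field_simps)
    finally show ?thesis .
  qed
  have mono: "F r < F s" if "r < s" for r s
    unfolding F_def using w f0 that by (intro add_strict_mono mult_strict_left_mono) auto
  have "F 0 < 0" "F 1 > 0"
    using w f0 by (auto simp: F_def intro!: add_pos_pos mult_pos_pos)
  moreover have "\<forall>x. 0 \<le> x \<and> x \<le> 1 \<longrightarrow> isCont F x"
    unfolding F_def by (intro allI impI continuous_intros)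
  ultimately obtain r where "0 \<le> r" "r \<le> 1" "F r = 0"
    using IVT[of F 0 0 1] by force
  with \<open>F 0 < 0\<close> \<open>F 1 > 0\<close> have "r \<in> {0<..<1}" "F r = 0"
    by (cases "r = 0"; cases "r = 1"; auto)+
  thus ?thesis
    unfolding eq using mono by (metis less_irrefl linorder_neqE)
qed

definition lambda1 :: "real \<Rightarrow> real \<Rightarrow> real \<Rightarrow> real" where
  "lambda1 \<omega> \<mu> f0 = \<mu> * gfun \<omega> f0 (rstar \<omega> f0)"

definition Linf_norm :: "(real \<Rightarrow> real) \<Rightarrow> ereal" where
  "Linf_norm v = esssup (lebesgue_on {0<..<1}) (\<lambda>x. ereal \<bar>v x\<bar>)"

definition in_Linf :: "(real \<Rightarrow> real) \<Rightarrow> bool" where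
  "in_Linf v \<longleftrightarrow> v \<in> borel_measurable (lebesgue_on {0<..<1}) \<and> Linf_norm v < \<infinity>"

definition in_L2 :: "'a::euclidean_space set \<Rightarrow> ('a \<Rightarrow> real) \<Rightarrow> bool" where
  "in_L2 S v \<longleftrightarrow> v \<in> borel_measurable (lebesgue_on S) \<and> integrable (lebesgue_on S) (\<lambda>x. (v x)\<^sup>2)"

definition L2_norm01 :: "(real \<Rightarrow> real) \<Rightarrow> real" where
  "L2_norm01 v = sqrt (\<integral>x. (v x)\<^sup>2 \<partial>lebesgue_on {0<..<1})"

text \<open>\<open>v\<close> belongs (as a class modulo null sets) to \<open>V = {v \<in> H\<^sup>1(0,1). v(1) = 0}\<close> and \<open>w\<close> is its
  weak derivative: on an interval, \<open>H\<^sup>1\<close> consists of the primitives of \<open>L\<^sup>2\<close> functions.\<close>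

definition in_V_with_deriv :: "(real \<Rightarrow> real) \<Rightarrow> (real \<Rightarrow> real) \<Rightarrow> bool" where
  "in_V_with_deriv v w \<longleftrightarrow> in_L2 {0<..<1} w \<and>
     (AE x in lebesgue_on {0<..<1}. v x = - (\<integral>y. w y \<partial>lebesgue_on {x<..<1}))"

text \<open>\<open>C\<^sup>1\<close> functions on \<open>[0,T] \<times> [0,1]\<close> that vanish at \<open>x = 1\<close>. They are unconstrained at \<open>x = 0\<close>,
  so that the Neumann condition there is the natural one of the weak formulation.\<close>

definition test_function ::
    "real \<Rightarrow> (real \<Rightarrow> real \<Rightarrow> real) \<Rightarrow> (real \<Rightarrow> real \<Rightarrow> real) \<Rightarrow> (real \<Rightarrow> real \<Rightarrow> real) \<Rightarrow> bool" where
  "test_function T \<phi> \<phi>t \<phi>x \<longleftrightarrow>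
     (\<forall>t\<in>{0..T}. \<forall>x\<in>{0..1}.
        ((\<lambda>s. \<phi> s x) has_real_derivative \<phi>t t x) (at t within {0..T}) \<and>
        ((\<lambda>y. \<phi> t y) has_real_derivative \<phi>x t x) (at x within {0..1})) \<and>
     continuous_on ({0..T} \<times> {0..1}) (\<lambda>(t, x). \<phi>t t x) \<and>
     continuous_on ({0..T} \<times> {0..1}) (\<lambda>(t, x). \<phi>x t x) \<and>
     (\<forall>t\<in>{0..T}. \<phi> t 1 = 0)"

text \<open>Weak solutions \<open>u \<in> C([0,\<infinity>); L\<^sup>2(0,1)) \<inter> L\<^sup>2(0,T; V)\<close> (for all \<open>T > 0\<close>), with the time variable
  as first argument of \<open>u\<close>.\<close>

definition weak_solution ::
    "real \<Rightarrow> real \<Rightarrow> real \<Rightarrow> real \<Rightarrow> (real \<Rightarrow> real) \<Rightarrow> (real \<Rightarrow> real \<Rightarrow> real) \<Rightarrow> bool" where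
  "weak_solution \<omega> \<mu> f0 lam u0 u \<longleftrightarrow>
     (\<forall>t\<ge>0. in_L2 {0<..<1} (u t)) \<and>
     (\<forall>s\<ge>0. ((\<lambda>t. L2_norm01 (\<lambda>x. u t x - u s x)) \<longlongrightarrow> 0) (at s within {0..})) \<and>
     (AE x in lebesgue_on {0<..<1}. u 0 x = u0 x) \<and>
     (\<exists>ux h.
        (\<forall>T>0. in_L2 ({0<..<T} \<times> {0<..<1}) (\<lambda>(t, x). u t x) \<and>
                in_L2 ({0<..<T} \<times> {0<..<1}) (\<lambda>(t, x). ux t x)) \<and>
        (AE t in lebesgue_on {0<..}. in_V_with_deriv (u t) (ux t)) \<and>
        (\<lambda>(t, x). h t x) \<in> borel_measurable (lebesgue_on ({0<..} \<times> {0<..<1})) \<and>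
        (\<exists>K. AE (t, x) in lebesgue_on ({0<..} \<times> {0<..<1}). \<bar>h t x\<bar> \<le> K) \<and>
        (AE (t, x) in lebesgue_on ({0<..} \<times> {0<..<1}). h t x \<in> beta \<mu> f0 (u t x)) \<and>
        (\<forall>T>0. \<forall>\<phi> \<phi>t \<phi>x. test_function T \<phi> \<phi>t \<phi>x \<longrightarrow>
           (\<integral>x. u T x * \<phi> T x \<partial>lebesgue_on {0<..<1}) - (\<integral>x. u0 x * \<phi> 0 x \<partial>lebesgue_on {0<..<1})
           + (\<integral>(t, x). - u t x * \<phi>t t x + ux t x * \<phi>x t x + \<omega>\<^sup>2 * u t x * \<phi> t x
                \<partial>lebesgue_on ({0<..<T} \<times> {0<..<1}))
           = lam * (\<integral>(t, x). h t x * \<phi> t x \<partial>lebesgue_on ({0<..<T} \<times> {0<..<1}))))"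

definition non_degenerate :: "real \<Rightarrow> (real \<Rightarrow> real \<Rightarrow> real) \<Rightarrow> bool" where
  "non_degenerate \<mu> u \<longleftrightarrow>
     (\<exists>C>0. \<exists>\<theta>0>0. \<forall>\<theta>. 0 < \<theta> \<and> \<theta> < \<theta>0 \<longrightarrow>
        (\<forall>t>0. measure lebesgue {x\<in>{0<..<1}. \<bar>u t x - \<mu>\<bar> \<le> \<theta>} \<le> C * \<theta>))"

end

theory Submission
  imports Defs
begin

text \<open>Replacing the free boundary \<open>xbar\<close> by a nearby point \<open>\<xi>\<close> in the linear two-phase problem
  \<open>- V'' + \<omega>\<^sup>2 V = lam q\<close>, with \<open>q = 1\<close> to the left and \<open>q = f0\<close> to the right of \<open>\<xi>\<close>, produces an
  explicit \<open>V\<^sub>\<xi>\<close>. Since \<open>V\<^sub>\<xi>(\<xi>) = lam / g(\<xi>)\<close> is strictly decreasing on \<open>(r*, 1)\<close>, \<open>V\<^sub>\<xi> + \<kappa>\<close> is for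
  \<open>\<xi> > xbar\<close> and small \<open>\<kappa> > 0\<close> a supersolution that stays below \<open>\<mu>\<close> by a fixed gap \<open>\<gamma>\<close> on the right
  phase; \<open>V\<^sub>\<xi> - \<kappa>\<close> is a subsolution for \<open>\<xi> < xbar\<close>. The reaction is discontinuous, but because of the
  gap the wrong sign of \<open>h - q\<close> can occur only where the solution already exceeds the barrier by \<open>\<gamma>\<close>,
  so \<open>lam (h - q) \<le> (lam / \<gamma>) (u - V - \<kappa>)\<^sup>+\<close> almost everywhere. Testing the weak formulation with
  nonnegative solutions of the backward heat equation turns this into
  \<open>y(T) \<le> C \<integral> y\<close> over \<open>(0, T)\<close> for the weighted \<open>L\<^sup>1\<close> norm \<open>y\<close> of the positive part, and Gronwall's
  lemma gives \<open>y = 0\<close>: the solution never leaves the strip between the two barriers.\<close>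

section \<open>Iterated integrals for the completed Lebesgue measure\<close>

text \<open>The reaction increases in u and jumps at \<mu>, so an order between two initial data
  need not persist under the nonlinear problem. Comparison with a fixed barrier survives because its
  source q is frozen: only a one-sided bound of h - q is needed. The position of \<open>xbar\<close>
  beyond \<open>rstar\<close> matters here: moving the free boundary to the right pushes the value
  at it below \<mu>, and this is the gap. A weak solution is not assumed to have a time derivative
  in L2, so its positive part is not at hand as a test function; duality replaces it by smooth ones.
  Cosine modes solve the dual equation by an explicit formula. Initial data of the form cos(pi x /
  2) times a Bernstein polynomial in its square are rich enough to reproduce the sign of the
  positive part in the limit, and they stay between 0 and cos(pi x / 2). That weight is the first
  mode, hence itself a decaying dual solution; it bounds the dual functions for all times, so the
  estimate closes in one and the same weighted norm.\<close>

lemma integrable_lebesgue_ex_lborel: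
  fixes F :: "'a::euclidean_space \<Rightarrow> real"
  assumes "integrable lebesgue F"
  obtains G where "integrable lborel G" "AE z in lborel. F z = G z"
    "integral\<^sup>L lebesgue F = integral\<^sup>L lborel G"
proof -
  have F: "F \<in> borel_measurable lebesgue"
    using assms by auto
  obtain G where G: "G \<in> borel_measurable lborel" "AE z in lborel. F z = G z"
    using completion_ex_borel_measurable_real[OF F] by auto
  have Gl: "G \<in> borel_measurable lebesgue"
    using G(1) by (rule measurable_completion)
  have ae: "AE z in lebesgue. F z = G z"
    using G(2) by (rule AE_completion)
  have "integrable lebesgue G"
    using assms ae Gl F by (metis integrable_cong_AE)
  then have "integrable lborel G"
    using G(1) integrable_completion by blast
  moreover have "integral\<^sup>L lebesgue F = integral\<^sup>L lborel G"
    using integral_cong_AE[OF F Gl ae] G(1) by (simp add: integral_completion)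
  ultimately show ?thesis
    using G(2) that by blast
qed

lemma integrable_lebesgue_cong_AE_lborel:
  fixes F G :: "'a::euclidean_space \<Rightarrow> real"
  assumes "integrable lborel G" "AE z in lborel. F z = G z"
  shows "integrable lebesgue F" "integral\<^sup>L lebesgue F = integral\<^sup>L lborel G"
proof -
  have ae: "AE z in lebesgue. G z = F z"
    using assms(2) by (intro AE_completion) (auto simp: eq_commute)
  have G: "G \<in> borel_measurable lborel"
    using assms(1) by auto
  have Gl: "G \<in> borel_measurable lebesgue"
    using G by (rule measurable_completion)
  have F: "F \<in> borel_measurable lebesgue"
    using Gl ae by (rule borel_measurable_AE)
  have "integrable lebesgue G"
    using assms(1) G integrable_completion by blast
  then show "integrable lebesgue F"
    using ae Gl F by (metis integrable_cong_AE)
  show "integral\<^sup>L lebesgue F = integral\<^sup>L lborel G"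
    using integral_cong_AE[OF Gl F ae] G by (simp add: integral_completion)
qed

text \<open>The completed measure on a product is not the product of the completed measures. Fubini
  is therefore applied to a Borel representative, and almost every slice of a null set of the
  product is null.\<close>

lemma lebesgue_Fubini:
  fixes F :: "'a::euclidean_space \<times> 'b::euclidean_space \<Rightarrow> real"
  assumes "integrable lebesgue F"
  shows "AE s in lebesgue. integrable lebesgue (\<lambda>x. F (s, x))"
    and "integrable lebesgue (\<lambda>s. \<integral>x. F (s, x) \<partial>lebesgue)"
    and "(\<integral>s. \<integral>x. F (s, x) \<partial>lebesgue \<partial>lebesgue) = (\<integral>z. F z \<partial>lebesgue)"
proof -
  obtain G where G: "integrable lborel G" "AE z in lborel. F z = G z"
    "integral\<^sup>L lebesgue F = integral\<^sup>L lborel G"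
    using assms by (rule integrable_lebesgue_ex_lborel)
  have Gp: "integrable (lborel \<Otimes>\<^sub>M lborel) G"
    using G(1) by (simp add: lborel_prod)
  have "AE z in lborel \<Otimes>\<^sub>M lborel. F z = G z"
    unfolding lborel_prod by (rule G(2))
  then have ae: "AE s in lborel. AE x in lborel. F (s, x) = G (s, x)"
    by (rule lborel_pair.AE_pair)
  have iG: "AE s in lborel. integrable lborel (\<lambda>x. G (s, x))"
    by (rule lborel_pair.AE_integrable_fst'[OF Gp])
  have *: "AE s in lborel. integrable lebesgue (\<lambda>x. F (s, x)) \<and>
      (\<integral>x. F (s, x) \<partial>lebesgue) = (\<integral>x. G (s, x) \<partial>lborel)"
    using ae iG
  proof eventually_elim
    case (elim s)
    show ?case
      using integrable_lebesgue_cong_AE_lborel[OF elim(2,1)] by simp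
  qed
  show "AE s in lebesgue. integrable lebesgue (\<lambda>x. F (s, x))"
    using * by (intro AE_completion) auto
  have **: "integrable lborel (\<lambda>s. \<integral>x. G (s, x) \<partial>lborel)"
    by (rule lborel_pair.integrable_fst'[OF Gp])
  have ***: "AE s in lborel. (\<integral>x. F (s, x) \<partial>lebesgue) = (\<integral>x. G (s, x) \<partial>lborel)"
    using * by auto
  show "integrable lebesgue (\<lambda>s. \<integral>x. F (s, x) \<partial>lebesgue)"
    by (rule integrable_lebesgue_cong_AE_lborel(1)[OF ** ***])
  have "(\<integral>s. \<integral>x. F (s, x) \<partial>lebesgue \<partial>lebesgue) = (\<integral>s. \<integral>x. G (s, x) \<partial>lborel \<partial>lborel)"
    by (rule integrable_lebesgue_cong_AE_lborel(2)[OF ** ***])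
  also have "\<dots> = integral\<^sup>L (lborel \<Otimes>\<^sub>M lborel) G"
    by (rule lborel_pair.integral_fst'[OF Gp])
  finally show "(\<integral>s. \<integral>x. F (s, x) \<partial>lebesgue \<partial>lebesgue) = (\<integral>z. F z \<partial>lebesgue)"
    by (simp add: lborel_prod G(3))
qed

lemma lebesgue_swap:
  fixes F :: "'a::euclidean_space \<times> 'b::euclidean_space \<Rightarrow> real"
  assumes "integrable lebesgue F"
  shows "integrable lebesgue (\<lambda>(x, s). F (s, x))"
    and "(\<integral>(x, s). F (s, x) \<partial>lebesgue) = (\<integral>z. F z \<partial>lebesgue)"
proof -
  obtain G where G: "integrable lborel G" "AE z in lborel. F z = G z"
    "integral\<^sup>L lebesgue F = integral\<^sup>L lborel G"
    using assms by (rule integrable_lebesgue_ex_lborel)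
  have Gp: "integrable (lborel \<Otimes>\<^sub>M lborel) G"
    using G(1) by (simp add: lborel_prod)
  have 1: "integrable lborel (\<lambda>(x, s). G (s, x))"
    using lborel_pair.integrable_product_swap[OF Gp] by (simp add: lborel_prod)
  have "AE z in lborel \<Otimes>\<^sub>M lborel. F z = G z"
    unfolding lborel_prod by (rule G(2))
  then have "AE z in distr (lborel \<Otimes>\<^sub>M lborel) (lborel \<Otimes>\<^sub>M lborel) (\<lambda>(x::'b, y::'a). (y, x)). F z = G z"
    by (subst (asm) lborel_pair.distr_pair_swap)
  from AE_distrD[OF measurable_pair_swap' this]
  have "AE z in lborel \<Otimes>\<^sub>M lborel. (\<lambda>(x, s). F (s, x)) z = (\<lambda>(x, s). G (s, x)) z"
    by (simp add: case_prod_beta')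
  then have 2: "AE z in lborel. (\<lambda>(x, s). F (s, x)) z = (\<lambda>(x, s). G (s, x)) z"
    unfolding lborel_prod .
  show "integrable lebesgue (\<lambda>(x, s). F (s, x))"
    by (rule integrable_lebesgue_cong_AE_lborel(1)[OF 1 2])
  have "(\<integral>(x, s). F (s, x) \<partial>lebesgue) = (\<integral>(x, s). G (s, x) \<partial>lborel)"
    by (rule integrable_lebesgue_cong_AE_lborel(2)[OF 1 2])
  also have "\<dots> = (\<integral>z. F z \<partial>lebesgue)"
    using lborel_pair.integral_product_swap[of G] G Gp by (simp add: lborel_prod)
  finally show "(\<integral>(x, s). F (s, x) \<partial>lebesgue) = (\<integral>z. F z \<partial>lebesgue)" .
qed

text \<open>Extension by zero reduces this to the whole space, since the indicator of a product set
  factorises.\<close>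

lemma Fubini_lebesgue_on:
  fixes F :: "'a::euclidean_space \<times> 'b::euclidean_space \<Rightarrow> real"
  assumes A: "A \<in> sets lebesgue" and B: "B \<in> sets lebesgue" and AB: "A \<times> B \<in> sets lebesgue"
    and F: "integrable (lebesgue_on (A \<times> B)) F"
  shows "AE s in lebesgue_on A. integrable (lebesgue_on B) (\<lambda>x. F (s, x))"
    and "integrable (lebesgue_on A) (\<lambda>s. \<integral>x. F (s, x) \<partial>lebesgue_on B)"
    and "(\<integral>s. \<integral>x. F (s, x) \<partial>lebesgue_on B \<partial>lebesgue_on A) = (\<integral>z. F z \<partial>lebesgue_on (A \<times> B))"
proof -
  define H where "H z = indicat_real (A \<times> B) z *\<^sub>R F z" for z
  have H: "integrable lebesgue H"
    using F AB unfolding H_def by (simp add: integrable_restrict_space)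
  have Hs: "H (s, x) = indicat_real A s *\<^sub>R (indicat_real B x *\<^sub>R F (s, x))" for s x
    by (simp add: H_def indicator_def)
  have *: "(\<integral>x. H (s, x) \<partial>lebesgue) = indicat_real A s *\<^sub>R (\<integral>x. F (s, x) \<partial>lebesgue_on B)" for s
    using B by (simp add: Hs integral_restrict_space)
  have "AE s in lebesgue. s \<in> A \<longrightarrow> integrable (lebesgue_on B) (\<lambda>x. F (s, x))"
    using lebesgue_Fubini(1)[OF H]
  proof eventually_elim
    case (elim s)
    then show ?case
      using B by (auto simp: Hs integrable_restrict_space)
  qed
  then show "AE s in lebesgue_on A. integrable (lebesgue_on B) (\<lambda>x. F (s, x))"
    using A by (subst AE_restrict_space_iff) auto
  show "integrable (lebesgue_on A) (\<lambda>s. \<integral>x. F (s, x) \<partial>lebesgue_on B)"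
    using lebesgue_Fubini(2)[OF H] A by (simp add: * integrable_restrict_space)
  show "(\<integral>s. \<integral>x. F (s, x) \<partial>lebesgue_on B \<partial>lebesgue_on A) = (\<integral>z. F z \<partial>lebesgue_on (A \<times> B))"
    using lebesgue_Fubini(3)[OF H] A AB
    by (simp add: * integral_restrict_space) (simp add: H_def)
qed

lemma swap_lebesgue_on:
  fixes F :: "'a::euclidean_space \<times> 'b::euclidean_space \<Rightarrow> real"
  assumes AB: "A \<times> B \<in> sets lebesgue" and BA: "B \<times> A \<in> sets lebesgue"
    and F: "integrable (lebesgue_on (A \<times> B)) F"
  shows "integrable (lebesgue_on (B \<times> A)) (\<lambda>(x, s). F (s, x))"
    and "(\<integral>(x, s). F (s, x) \<partial>lebesgue_on (B \<times> A)) = (\<integral>z. F z \<partial>lebesgue_on (A \<times> B))"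
proof -
  define H where "H z = indicat_real (A \<times> B) z *\<^sub>R F z" for z
  have H: "integrable lebesgue H"
    using F AB unfolding H_def by (simp add: integrable_restrict_space)
  have *: "(\<lambda>(x, s). H (s, x)) = (\<lambda>z. indicat_real (B \<times> A) z *\<^sub>R (case z of (x, s) \<Rightarrow> F (s, x)))"
    by (auto simp: H_def indicator_def fun_eq_iff)
  show "integrable (lebesgue_on (B \<times> A)) (\<lambda>(x, s). F (s, x))"
    using lebesgue_swap(1)[OF H] BA by (simp add: * integrable_restrict_space)
  show "(\<integral>(x, s). F (s, x) \<partial>lebesgue_on (B \<times> A)) = (\<integral>z. F z \<partial>lebesgue_on (A \<times> B))"
    using lebesgue_swap(2)[OF H] BA AB by (simp add: * integral_restrict_space) (simp add: H_def)
qed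

lemma iterated_integral_swap:
  fixes F :: "'a::euclidean_space \<times> 'b::euclidean_space \<Rightarrow> real"
  assumes "A \<in> sets lebesgue" "B \<in> sets lebesgue"
    and "A \<times> B \<in> sets lebesgue" "B \<times> A \<in> sets lebesgue"
    and "integrable (lebesgue_on (A \<times> B)) F"
  shows "(\<integral>s. \<integral>x. F (s, x) \<partial>lebesgue_on B \<partial>lebesgue_on A) =
    (\<integral>x. \<integral>s. F (s, x) \<partial>lebesgue_on A \<partial>lebesgue_on B)"
proof -
  note swap = swap_lebesgue_on[OF assms(3,4,5)]
  have "(\<integral>s. \<integral>x. F (s, x) \<partial>lebesgue_on B \<partial>lebesgue_on A) = (\<integral>z. F z \<partial>lebesgue_on (A \<times> B))"
    by (rule Fubini_lebesgue_on(3)[OF assms(1,2,3,5)])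
  also have "\<dots> = (\<integral>(x, s). F (s, x) \<partial>lebesgue_on (B \<times> A))"
    by (rule swap(2)[symmetric])
  also have "\<dots> = (\<integral>x. \<integral>s. F (s, x) \<partial>lebesgue_on A \<partial>lebesgue_on B)"
    using Fubini_lebesgue_on(3)[OF assms(2,1,4) swap(1)] by simp
  finally show ?thesis .
qed

section \<open>Stationary barriers\<close>

definition two_phase :: "real \<Rightarrow> real \<Rightarrow> real \<Rightarrow> real" where
  "two_phase f0 \<xi> x = (if x \<le> \<xi> then 1 else f0)"

text \<open>The solution \<open>Z\<close> of \<open>- Z'' + \<omega>\<^sup>2 Z = \<omega>\<^sup>2 1\<^bsub>x \<le> \<xi>\<^esub>\<close> with \<open>Z'(0) = 0\<close> and \<open>Z(1) = 0\<close>.\<close>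

definition step_response :: "real \<Rightarrow> real \<Rightarrow> real \<Rightarrow> real" where
  "step_response \<omega> \<xi> x = (if x \<le> \<xi> then 1 - cosh (\<omega> * (1 - \<xi>)) * cosh (\<omega> * x) / cosh \<omega>
     else sinh (\<omega> * \<xi>) * sinh (\<omega> * (1 - x)) / cosh \<omega>)"

text \<open>Superposition: the source is lam times f0 plus (1 - f0) times the indicator of x \<le>
  \<xi>. The constant part contributes the cosh term, the indicator contributes
  \<open>step_response\<close>.\<close>

definition barrier :: "real \<Rightarrow> real \<Rightarrow> real \<Rightarrow> real \<Rightarrow> real \<Rightarrow> real" where
  "barrier \<omega> f0 lam \<xi> x =
     lam / \<omega>\<^sup>2 * (f0 * (1 - cosh (\<omega> * x) / cosh \<omega>) + (1 - f0) * step_response \<omega> \<xi> x)"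

text \<open>The two branches agree at \<xi>, so the barrier is C1 there and only its second
  derivative jumps.\<close>

definition step_response' :: "real \<Rightarrow> real \<Rightarrow> real \<Rightarrow> real" where
  "step_response' \<omega> \<xi> x = (if x \<le> \<xi> then - (\<omega> * (cosh (\<omega> * (1 - \<xi>)) * sinh (\<omega> * x) / cosh \<omega>))
     else - (\<omega> * (sinh (\<omega> * \<xi>) * cosh (\<omega> * (1 - x)) / cosh \<omega>)))"

definition barrier' :: "real \<Rightarrow> real \<Rightarrow> real \<Rightarrow> real \<Rightarrow> real \<Rightarrow> real" where
  "barrier' \<omega> f0 lam \<xi> x =
     lam / \<omega>\<^sup>2 * (f0 * (- (\<omega> * (sinh (\<omega> * x) / cosh \<omega>))) + (1 - f0) * step_response' \<omega> \<xi> x)"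

section \<open>Regularity of the barriers and their weak equation\<close>

lemma cosh_split:
  fixes \<omega> r :: real
  shows "cosh \<omega> = cosh (\<omega> * (1 - r)) * cosh (\<omega> * r) + sinh (\<omega> * r) * sinh (\<omega> * (1 - r))"
proof -
  have "\<omega> = \<omega> * (1 - r) + \<omega> * r"
    by (simp add: algebra_simps)
  then have "cosh \<omega> = cosh (\<omega> * (1 - r) + \<omega> * r)"
    by simp
  then show ?thesis
    unfolding cosh_add by (simp add: mult.commute)
qed

text \<open>With r = \<xi> this is the matching of the two branches of \<open>step_response\<close>
  at the free boundary.\<close>

lemma cosh_split':
  fixes \<omega> r :: real
  shows "1 - cosh (\<omega> * (1 - r)) * cosh (\<omega> * r) / cosh \<omega> = sinh (\<omega> * r) * sinh (\<omega> * (1 - r)) / cosh \<omega>"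
proof -
  have "1 - cosh (\<omega> * (1 - r)) * cosh (\<omega> * r) / cosh \<omega> =
      (cosh \<omega> - cosh (\<omega> * (1 - r)) * cosh (\<omega> * r)) / cosh \<omega>"
    by (simp add: diff_divide_distrib)
  then show ?thesis
    using cosh_split[of \<omega> r] by simp
qed

lemma continuous_step_response [continuous_intros]: "continuous_on S (step_response \<omega> \<xi>)"
proof -
  have "continuous_on UNIV (\<lambda>x. if x \<le> \<xi> then 1 - cosh (\<omega> * (1 - \<xi>)) * cosh (\<omega> * x) / cosh \<omega>
     else sinh (\<omega> * \<xi>) * sinh (\<omega> * (1 - x)) / cosh \<omega>)"
    by (intro continuous_on_cases_le continuous_intros) (auto simp: cosh_split')
  then show ?thesis
    unfolding step_response_def[abs_def] by (rule continuous_on_subset) simp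
qed

lemma continuous_step_response' [continuous_intros]: "continuous_on S (step_response' \<omega> \<xi>)"
proof -
  have "continuous_on UNIV (\<lambda>x. if x \<le> \<xi> then - (\<omega> * (cosh (\<omega> * (1 - \<xi>)) * sinh (\<omega> * x) / cosh \<omega>))
     else - (\<omega> * (sinh (\<omega> * \<xi>) * cosh (\<omega> * (1 - x)) / cosh \<omega>)))"
    by (intro continuous_on_cases_le continuous_intros) (auto simp: field_simps)
  then show ?thesis
    unfolding step_response'_def[abs_def] by (rule continuous_on_subset) simp
qed

lemma continuous_barrier [continuous_intros]: "continuous_on S (barrier \<omega> f0 lam \<xi>)"
  unfolding barrier_def[abs_def] by (intro continuous_intros) auto

lemma continuous_barrier' [continuous_intros]: "continuous_on S (barrier' \<omega> f0 lam \<xi>)"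
  unfolding barrier'_def[abs_def] by (intro continuous_intros) auto

lemma deriv_step_response:
  assumes "x \<noteq> \<xi>"
  shows "(step_response \<omega> \<xi> has_real_derivative step_response' \<omega> \<xi> x) (at x)"
proof (cases "x < \<xi>")
  case True
  have "((\<lambda>x. 1 - cosh (\<omega> * (1 - \<xi>)) * cosh (\<omega> * x) / cosh \<omega>) has_real_derivative
      step_response' \<omega> \<xi> x) (at x)"
    using True by (auto intro!: derivative_eq_intros simp: step_response'_def)
  then show ?thesis
    by (rule has_field_derivative_transform_within_open[of _ _ _ "{..<\<xi>}"])
       (use True in \<open>auto simp: step_response_def\<close>)
next
  case False
  have "((\<lambda>x. sinh (\<omega> * \<xi>) * sinh (\<omega> * (1 - x)) / cosh \<omega>) has_real_derivative
      step_response' \<omega> \<xi> x) (at x)"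
    using False assms by (auto intro!: derivative_eq_intros simp: step_response'_def)
  then show ?thesis
    by (rule has_field_derivative_transform_within_open[of _ _ _ "{\<xi><..}"])
       (use False assms in \<open>auto simp: step_response_def\<close>)
qed

lemma deriv_step_response':
  assumes "x \<noteq> \<xi>"
  shows "(step_response' \<omega> \<xi> has_real_derivative
    \<omega>\<^sup>2 * (step_response \<omega> \<xi> x - (if x \<le> \<xi> then 1 else 0))) (at x)"
proof (cases "x < \<xi>")
  case True
  have "((\<lambda>x. - (\<omega> * (cosh (\<omega> * (1 - \<xi>)) * sinh (\<omega> * x) / cosh \<omega>))) has_real_derivative
      \<omega>\<^sup>2 * (step_response \<omega> \<xi> x - (if x \<le> \<xi> then 1 else 0))) (at x)"
    using True by (auto intro!: derivative_eq_intros simp: step_response_def power2_eq_square)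
  then show ?thesis
    by (rule has_field_derivative_transform_within_open[of _ _ _ "{..<\<xi>}"])
       (use True in \<open>auto simp: step_response'_def\<close>)
next
  case False
  have "((\<lambda>x. - (\<omega> * (sinh (\<omega> * \<xi>) * cosh (\<omega> * (1 - x)) / cosh \<omega>))) has_real_derivative
      \<omega>\<^sup>2 * (step_response \<omega> \<xi> x - (if x \<le> \<xi> then 1 else 0))) (at x)"
    using False assms by (auto intro!: derivative_eq_intros simp: step_response_def power2_eq_square)
  then show ?thesis
    by (rule has_field_derivative_transform_within_open[of _ _ _ "{\<xi><..}"])
       (use False assms in \<open>auto simp: step_response'_def\<close>)
qed

lemma deriv_barrier:
  assumes "x \<noteq> \<xi>"
  shows "(barrier \<omega> f0 lam \<xi> has_real_derivative barrier' \<omega> f0 lam \<xi> x) (at x)"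
  unfolding barrier_def[abs_def] barrier'_def
  by (intro DERIV_cmult DERIV_add deriv_step_response[OF assms]) (auto intro!: derivative_eq_intros)

lemma deriv_barrier':
  assumes "x \<noteq> \<xi>" "\<omega> \<noteq> 0"
  shows "(barrier' \<omega> f0 lam \<xi> has_real_derivative
    \<omega>\<^sup>2 * barrier \<omega> f0 lam \<xi> x - lam * two_phase f0 \<xi> x) (at x)"
proof -
  have "(barrier' \<omega> f0 lam \<xi> has_real_derivative
    lam / \<omega>\<^sup>2 * (f0 * (- (\<omega> * (\<omega> * cosh (\<omega> * x) / cosh \<omega>)))
      + (1 - f0) * (\<omega>\<^sup>2 * (step_response \<omega> \<xi> x - (if x \<le> \<xi> then 1 else 0))))) (at x)"
    unfolding barrier'_def[abs_def]
    by (intro DERIV_cmult DERIV_add deriv_step_response'[OF assms(1)]) (auto intro!: derivative_eq_intros)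
  also have "lam / \<omega>\<^sup>2 * (f0 * (- (\<omega> * (\<omega> * cosh (\<omega> * x) / cosh \<omega>)))
      + (1 - f0) * (\<omega>\<^sup>2 * (step_response \<omega> \<xi> x - (if x \<le> \<xi> then 1 else 0)))) =
      \<omega>\<^sup>2 * barrier \<omega> f0 lam \<xi> x - lam * two_phase f0 \<xi> x"
    using assms(2) by (auto simp: barrier_def two_phase_def field_simps power2_eq_square)
  finally show ?thesis .
qed

lemma barrier_1: "\<xi> < 1 \<Longrightarrow> barrier \<omega> f0 lam \<xi> 1 = 0"
  by (simp add: barrier_def step_response_def)

lemma barrier'_0: "0 \<le> \<xi> \<Longrightarrow> barrier' \<omega> f0 lam \<xi> 0 = 0"
  by (simp add: barrier'_def step_response'_def)

text \<open>Both integrations by parts are done at once: the integrand is the derivative of V'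
  \<phi> - V \<phi>' away from \<xi>. That function is continuous at \<xi>, so one exceptional point
  is harmless, and it vanishes at 1 by the Dirichlet conditions and at 0 by the Neumann conditions
  of V and \<phi>.\<close>

lemma barrier_weak:
  fixes \<phi> \<phi>' \<phi>'' :: "real \<Rightarrow> real"
  assumes \<xi>: "0 \<le> \<xi>" "\<xi> < 1" and "\<omega> \<noteq> 0"
    and \<phi>: "\<And>x. (\<phi> has_real_derivative \<phi>' x) (at x)" "\<And>x. (\<phi>' has_real_derivative \<phi>'' x) (at x)"
    and "\<phi> 1 = 0" "\<phi>' 0 = 0"
  shows "((\<lambda>x. barrier \<omega> f0 lam \<xi> x * (\<omega>\<^sup>2 * \<phi> x - \<phi>'' x) - lam * two_phase f0 \<xi> x * \<phi> x)
    has_integral 0) {0..1}"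
proof -
  define H where "H x = barrier' \<omega> f0 lam \<xi> x * \<phi> x - barrier \<omega> f0 lam \<xi> x * \<phi>' x" for x
  have c: "continuous_on {0..1} \<phi>" "continuous_on {0..1} \<phi>'"
    using \<phi> by (meson DERIV_isCont continuous_at_imp_continuous_on)+
  have "((\<lambda>x. barrier \<omega> f0 lam \<xi> x * (\<omega>\<^sup>2 * \<phi> x - \<phi>'' x) - lam * two_phase f0 \<xi> x * \<phi> x)
    has_integral (H 1 - H 0)) {0..1}"
  proof (rule fundamental_theorem_of_calculus_interior_strong[of "{\<xi>}"])
    show "continuous_on {0..1} H"
      unfolding H_def[abs_def] by (intro continuous_intros c)
    fix x assume x: "x \<in> {0<..<1} - {\<xi>}"
    then have "x \<noteq> \<xi>" by simp
    have "(H has_real_derivative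
        barrier \<omega> f0 lam \<xi> x * (\<omega>\<^sup>2 * \<phi> x - \<phi>'' x) - lam * two_phase f0 \<xi> x * \<phi> x) (at x)"
      unfolding H_def[abs_def]
      by (rule DERIV_cong[OF DERIV_diff[OF
            DERIV_mult[OF deriv_barrier'[OF \<open>x \<noteq> \<xi>\<close> \<open>\<omega> \<noteq> 0\<close>] \<phi>(1)]
            DERIV_mult[OF deriv_barrier[OF \<open>x \<noteq> \<xi>\<close>] \<phi>(2)]]])
         (simp add: algebra_simps)
    then show "(H has_vector_derivative
        barrier \<omega> f0 lam \<xi> x * (\<omega>\<^sup>2 * \<phi> x - \<phi>'' x) - lam * two_phase f0 \<xi> x * \<phi> x) (at x)"
      by (simp add: has_real_derivative_iff_has_vector_derivative)
  qed auto
  then show ?thesis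
    using assms by (simp add: H_def barrier_1 barrier'_0)
qed

section \<open>Dependence of the barriers on the free boundary and on x\<close>

text \<open>On the left branch an increase of \<xi> changes the value by a difference of cosh terms,
  on the right branch by a difference of sinh terms, each times a factor in [0, 1]. The increment of
  sinh(\<omega> r) - cosh(\<omega> (1 - r)) is the sum of both nonnegative differences and dominates
  either, which gives a modulus of continuity in \<xi> that does not depend on x.\<close>

lemma step_response_mono:
  assumes "0 < \<omega>" "0 \<le> \<xi>1" "\<xi>1 \<le> \<xi>2" "\<xi>2 \<le> 1" "0 \<le> x" "x \<le> 1"
  shows "step_response \<omega> \<xi>1 x \<le> step_response \<omega> \<xi>2 x"
    and "step_response \<omega> \<xi>2 x - step_response \<omega> \<xi>1 x \<le>
      (sinh (\<omega> * \<xi>2) - cosh (\<omega> * (1 - \<xi>2))) - (sinh (\<omega> * \<xi>1) - cosh (\<omega> * (1 - \<xi>1)))"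
proof -
  define P :: "real \<Rightarrow> real" where "P r = sinh (\<omega> * r) - cosh (\<omega> * (1 - r))" for r
  have left: "0 \<le> step_response \<omega> s x - step_response \<omega> r x \<and>
      step_response \<omega> s x - step_response \<omega> r x \<le> P s - P r"
    if "x \<le> r" "r \<le> s" "s \<le> 1" for r s
  proof -
    have step: "step_response \<omega> s x - step_response \<omega> r x =
        (cosh (\<omega> * (1 - r)) - cosh (\<omega> * (1 - s))) * (cosh (\<omega> * x) / cosh \<omega>)"
      using that by (simp add: step_response_def field_simps)
    have c: "cosh (\<omega> * (1 - s)) \<le> cosh (\<omega> * (1 - r))"
      using assms that by (subst cosh_real_nonneg_le_iff) auto
    have "cosh (\<omega> * x) \<le> cosh \<omega>"
      using assms by (subst cosh_real_nonneg_le_iff) (auto simp: mult_left_le)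
    then have F: "0 \<le> cosh (\<omega> * x) / cosh \<omega>" "cosh (\<omega> * x) / cosh \<omega> \<le> 1"
      by auto
    define D where "D = cosh (\<omega> * (1 - r)) - cosh (\<omega> * (1 - s))"
    have m: "sinh (\<omega> * r) \<le> sinh (\<omega> * s)"
      using assms that by simp
    have "0 \<le> D"
      using c m by (simp add: D_def)
    from mult_left_le[OF F(2) this] mult_nonneg_nonneg[OF this F(1)] show ?thesis
      unfolding step P_def D_def using c m by linarith
  qed
  have right: "0 \<le> step_response \<omega> s x - step_response \<omega> r x \<and>
      step_response \<omega> s x - step_response \<omega> r x \<le> P s - P r"
    if "s \<le> x" "r \<le> s" "0 \<le> r" for r s
  proof -
    have form: "step_response \<omega> t x = sinh (\<omega> * t) * (sinh (\<omega> * (1 - x)) / cosh \<omega>)" if "t \<le> x" for t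
      using that by (auto simp: step_response_def cosh_split')
    have step: "step_response \<omega> s x - step_response \<omega> r x =
        (sinh (\<omega> * s) - sinh (\<omega> * r)) * (sinh (\<omega> * (1 - x)) / cosh \<omega>)"
      using that by (subst (1 2) form) (auto simp: left_diff_distrib diff_divide_distrib)
    have c: "cosh (\<omega> * (1 - s)) \<le> cosh (\<omega> * (1 - r))"
      using assms that by (subst cosh_real_nonneg_le_iff) auto
    have "sinh (\<omega> * (1 - x)) \<le> sinh \<omega>"
      using assms by (simp add: mult_left_le)
    then have "sinh (\<omega> * (1 - x)) \<le> cosh \<omega>"
      using sinh_less_cosh_real[of \<omega>] by linarith
    then have F: "0 \<le> sinh (\<omega> * (1 - x)) / cosh \<omega>" "sinh (\<omega> * (1 - x)) / cosh \<omega> \<le> 1"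
      using assms by auto
    define D where "D = sinh (\<omega> * s) - sinh (\<omega> * r)"
    have m: "sinh (\<omega> * r) \<le> sinh (\<omega> * s)"
      using assms that by simp
    have "0 \<le> D"
      using c m by (simp add: D_def)
    from mult_left_le[OF F(2) this] mult_nonneg_nonneg[OF this F(1)] show ?thesis
      unfolding step P_def D_def using c m by linarith
  qed
  \<comment> \<open>If x lies strictly between the two parameters, the change is split at the
    parameter value x: up to there the right branch applies, beyond it the left branch, and the
    bounds telescope.\<close>
  have "0 \<le> step_response \<omega> \<xi>2 x - step_response \<omega> \<xi>1 x \<and>
      step_response \<omega> \<xi>2 x - step_response \<omega> \<xi>1 x \<le> P \<xi>2 - P \<xi>1"
  proof (cases "x \<le> \<xi>1 \<or> \<xi>2 \<le> x")
    case True
    then show ?thesis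
      using left[of \<xi>1 \<xi>2] right[of \<xi>2 \<xi>1] assms by blast
  next
    case False
    then show ?thesis
      using left[of x \<xi>2] right[of x \<xi>1] assms by auto
  qed
  then show "step_response \<omega> \<xi>1 x \<le> step_response \<omega> \<xi>2 x"
    and "step_response \<omega> \<xi>2 x - step_response \<omega> \<xi>1 x \<le>
      (sinh (\<omega> * \<xi>2) - cosh (\<omega> * (1 - \<xi>2))) - (sinh (\<omega> * \<xi>1) - cosh (\<omega> * (1 - \<xi>1)))"
    by (auto simp: P_def)
qed

lemma barrier_diff:
  assumes "\<omega> \<noteq> 0"
  shows "barrier \<omega> f0 lam \<xi>2 x - barrier \<omega> f0 lam \<xi>1 x =
    lam / \<omega>\<^sup>2 * (1 - f0) * (step_response \<omega> \<xi>2 x - step_response \<omega> \<xi>1 x)"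
  using assms by (simp add: barrier_def field_simps)

text \<open>This spreads a gap between \<mu> and the value at \<xi> over a whole phase: the right
  phase lies below that value, the left phase above it.\<close>

lemma barrier_antimono:
  assumes "0 < \<omega>" "0 \<le> lam" "0 \<le> f0" "f0 \<le> 1" "0 \<le> \<xi>" "\<xi> \<le> 1" "0 \<le> x" "x \<le> y" "y \<le> 1"
  shows "barrier \<omega> f0 lam \<xi> y \<le> barrier \<omega> f0 lam \<xi> x"
proof -
  have left: "step_response \<omega> \<xi> t \<le> step_response \<omega> \<xi> s" if "0 \<le> s" "s \<le> t" "t \<le> \<xi>" for s t
  proof -
    have "cosh (\<omega> * s) \<le> cosh (\<omega> * t)"
      using assms that by (subst cosh_real_nonneg_le_iff) auto
    then show ?thesis
      using that by (simp add: step_response_def divide_right_mono)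
  qed
  have right: "step_response \<omega> \<xi> t \<le> step_response \<omega> \<xi> s" if "\<xi> \<le> s" "s \<le> t" for s t
  proof -
    have form: "step_response \<omega> \<xi> r = sinh (\<omega> * \<xi>) * sinh (\<omega> * (1 - r)) / cosh \<omega>" if "\<xi> \<le> r" for r
      using that by (auto simp: step_response_def cosh_split')
    show ?thesis
      using that assms by (auto simp: form intro!: divide_right_mono mult_left_mono)
  qed
  have 1: "step_response \<omega> \<xi> y \<le> step_response \<omega> \<xi> x"
    using left[of x y] right[of x y] left[of x \<xi>] right[of \<xi> y] assms
    by (meson dual_order.trans le_cases)
  have "cosh (\<omega> * x) \<le> cosh (\<omega> * y)"
    using assms by (subst cosh_real_nonneg_le_iff) auto
  then have "1 - cosh (\<omega> * y) / cosh \<omega> \<le> 1 - cosh (\<omega> * x) / cosh \<omega>"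
    by (simp add: divide_right_mono)
  with 1 show ?thesis
    unfolding barrier_def using assms by (intro mult_left_mono add_mono) auto
qed

text \<open>The denominator of \<^const>\<open>gfun\<close>, up to the addition theorem for cosh.\<close>

definition level :: "real \<Rightarrow> real \<Rightarrow> real \<Rightarrow> real" where
  "level \<omega> f0 r = f0 * (cosh \<omega> - cosh (\<omega> * r)) + (1 - f0) * (sinh (\<omega> * r) * sinh (\<omega> * (1 - r)))"

text \<open>Together with \<open>gfun_level\<close> this gives the value lam / g(\<xi>) at the free
  boundary. The barrier crosses \<mu> exactly at \<xi>, and is then consistent with the nonlinear
  reaction, when g(\<xi>) = lam / \<mu>.\<close>

lemma barrier_level:
  assumes "\<omega> \<noteq> 0"
  shows "barrier \<omega> f0 lam \<xi> \<xi> = lam * level \<omega> f0 \<xi> / (\<omega>\<^sup>2 * cosh \<omega>)"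
proof -
  have "step_response \<omega> \<xi> \<xi> = sinh (\<omega> * \<xi>) * sinh (\<omega> * (1 - \<xi>)) / cosh \<omega>"
    by (simp add: step_response_def cosh_split')
  then show ?thesis
    using assms by (simp add: barrier_def level_def field_simps)
qed

lemma gfun_level: "gfun \<omega> f0 r = \<omega>\<^sup>2 * cosh \<omega> / level \<omega> f0 r"
proof -
  have *: "\<omega> - \<omega> * r = \<omega> * (1 - r)"
    by (simp add: algebra_simps)
  show ?thesis
    unfolding gfun_def level_def * using cosh_split[of \<omega> r] by (simp add: algebra_simps)
qed

section \<open>The minimum point of g and the position of the free boundary\<close>

text \<open>The last fact is the critical point equation of \<open>level\<close>, whose derivative
  is -\<omega> times the expression on the left.\<close>

lemma rstar_props:
  assumes "\<omega> > 0" "0 < f0" "f0 < 1"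
  shows "0 < rstar \<omega> f0" "rstar \<omega> f0 < 1"
    and "(1 - f0) * sinh (\<omega> * (2 * rstar \<omega> f0 - 1)) + f0 * sinh (\<omega> * rstar \<omega> f0) = 0"
proof -
  define r where "r = rstar \<omega> f0"
  have r: "r \<in> {0<..<1} \<and> r = 1/2 * (1 + 1/\<omega> * arsinh (f0 / (f0 - 1) * sinh (\<omega> * r)))"
    unfolding r_def rstar_def by (rule theI'[OF rstar_unique_existence[OF assms]])
  then show "0 < rstar \<omega> f0" "rstar \<omega> f0 < 1"
    by (auto simp: r_def)
  define A where "A = arsinh (f0 / (f0 - 1) * sinh (\<omega> * r))"
  have "r = 1/2 * (1 + 1/\<omega> * A)"
    using r by (simp add: A_def)
  then have "\<omega> * (2 * r - 1) = A"
    using assms by (simp add: field_simps)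
  then have "\<omega> * (2 * r - 1) = arsinh (f0 / (f0 - 1) * sinh (\<omega> * r))"
    by (simp add: A_def)
  then have "sinh (\<omega> * (2 * r - 1)) = f0 / (f0 - 1) * sinh (\<omega> * r)"
    by (metis sinh_arsinh_real)
  then show "(1 - f0) * sinh (\<omega> * (2 * rstar \<omega> f0 - 1)) + f0 * sinh (\<omega> * rstar \<omega> f0) = 0"
    using assms by (simp add: r_def field_simps)
qed

text \<open>Up to the factor -\<omega> the derivative of \<open>level\<close> is a strictly
  increasing function that vanishes at \<open>rstar\<close>, so the derivative is negative beyond
  that point.\<close>

lemma level_strict_antimono:
  assumes w: "\<omega> > 0" and f0: "0 < f0" "f0 < 1" and r: "rstar \<omega> f0 \<le> r" "r < s"
  shows "level \<omega> f0 s < level \<omega> f0 r"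
proof (rule DERIV_neg_imp_decreasing_open[OF \<open>r < s\<close>])
  define F where "F t = (1 - f0) * sinh (\<omega> * (2 * t - 1)) + f0 * sinh (\<omega> * t)" for t :: real
  fix t assume t: "r < t" "t < s"
  have "F (rstar \<omega> f0) < F t"
    unfolding F_def using w f0 r t by (intro add_strict_mono mult_strict_left_mono) auto
  then have "0 < F t"
    using rstar_props(3)[OF w f0] by (simp add: F_def)
  have "(level \<omega> f0 has_real_derivative (- (\<omega> * F t))) (at t)"
  proof -
    have *: "\<omega> * (2 * t - 1) = \<omega> * t - \<omega> * (1 - t)"
      by (simp add: algebra_simps)
    have **: "f0 * (- (\<omega> * sinh p)) + (1 - f0) * (\<omega> * cosh p * sinh q + - \<omega> * cosh q * sinh p) =
        - (\<omega> * ((1 - f0) * sinh (p - q) + f0 * sinh p))" for p q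
      by (simp add: sinh_diff algebra_simps)
    show ?thesis
      unfolding level_def[abs_def] F_def * **[symmetric]
      by (intro DERIV_cmult DERIV_add DERIV_mult) (auto intro!: derivative_eq_intros)
  qed
  then show "\<exists>y. (level \<omega> f0 has_real_derivative y) (at t) \<and> y < 0"
    using \<open>0 < F t\<close> w by (intro exI[of _ "- (\<omega> * F t)"]) auto
next
  show "continuous_on {r..s} (level \<omega> f0)"
    unfolding level_def[abs_def] by (intro continuous_intros)
qed

lemma level_1: "level \<omega> f0 1 = 0"
  by (simp add: level_def)

text \<open>Strict decrease to the value 0 at 1 makes \<open>level\<close> positive at
  \<open>xbar\<close>, so the free boundary equation can be solved for lam; the sign of the gap on
  either side of \<open>xbar\<close> is then the strict decrease again.\<close>

lemma level_near:
  assumes w: "\<omega> > 0" and f0: "0 < f0" "f0 < 1" and "\<mu> > 0"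
    and x: "rstar \<omega> f0 < xbar" "xbar < 1" and g: "gfun \<omega> f0 xbar = lam / \<mu>"
  shows "0 < lam" "barrier \<omega> f0 lam xbar xbar = \<mu>" "lam \<noteq> \<omega>\<^sup>2 * \<mu>"
    and "\<And>r. xbar < r \<Longrightarrow> barrier \<omega> f0 lam r r < \<mu>"
    and "\<And>r. rstar \<omega> f0 \<le> r \<Longrightarrow> r < xbar \<Longrightarrow> \<mu> < barrier \<omega> f0 lam r r"
proof -
  have pos: "0 < level \<omega> f0 xbar"
    using level_strict_antimono[OF w f0, of xbar 1] x by (simp add: level_1)
  have lam: "lam = \<mu> * (\<omega>\<^sup>2 * cosh \<omega>) / level \<omega> f0 xbar"
    using g \<open>\<mu> > 0\<close> by (simp add: gfun_level field_simps)
  show "0 < lam"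
    unfolding lam using pos w \<open>\<mu> > 0\<close> by simp
  show mu: "barrier \<omega> f0 lam xbar xbar = \<mu>"
    using w pos by (simp add: barrier_level) (simp add: lam)
  have lt: "barrier \<omega> f0 lam s s < barrier \<omega> f0 lam r r" if "rstar \<omega> f0 \<le> r" "r < s" for r s
    using level_strict_antimono[OF w f0 that] \<open>0 < lam\<close> w
    by (simp add: barrier_level divide_strict_right_mono)
  show "barrier \<omega> f0 lam r r < \<mu>" if "xbar < r" for r
    using lt[of xbar r] that x mu by simp
  show "\<mu> < barrier \<omega> f0 lam r r" if "rstar \<omega> f0 \<le> r" "r < xbar" for r
    using lt[of r xbar] that mu by simp
  have "0 < xbar"
    using rstar_props(1)[OF w f0] x by simp
  \<comment> \<open>Equality of lam and \<open>\<omega>\<^sup>2 * \<mu>\<close> would force equality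
    here, but by the addition theorem the difference is a positive combination of cosh
    terms.\<close>
  have "level \<omega> f0 xbar < cosh \<omega>"
  proof -
    have "cosh \<omega> - level \<omega> f0 xbar = f0 * cosh (\<omega> * xbar)
        + (1 - f0) * (cosh (\<omega> * (1 - xbar)) * cosh (\<omega> * xbar))"
    proof -
      have "cosh \<omega> - level \<omega> f0 xbar = f0 * cosh (\<omega> * xbar)
        + (1 - f0) * (cosh \<omega> - sinh (\<omega> * xbar) * sinh (\<omega> * (1 - xbar)))"
        by (simp add: level_def algebra_simps)
      then show ?thesis
        using cosh_split[of \<omega> xbar] by simp
    qed
    also have "\<dots> > 0"
      using f0 by (intro add_pos_pos mult_pos_pos) auto
    finally show ?thesis by simp
  qed
  \<comment> \<open>excludes solutions that stay at the level \<open>\<mu>\<close> on an interval\<close>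
  show "lam \<noteq> \<omega>\<^sup>2 * \<mu>"
  proof
    assume "lam = \<omega>\<^sup>2 * \<mu>"
    then have "level \<omega> f0 xbar = cosh \<omega>"
      using lam pos w \<open>\<mu> > 0\<close> by (simp add: field_simps)
    with \<open>level \<omega> f0 xbar < cosh \<omega>\<close> show False by simp
  qed
qed

lemma barrier_close:
  assumes w: "\<omega> > 0" and "0 \<le> lam" "0 \<le> f0" "f0 \<le> 1" "0 < xbar" "xbar < 1" "\<epsilon> > 0"
  shows "\<exists>d>0. \<forall>\<xi>\<in>{0..1}. \<bar>\<xi> - xbar\<bar> < d \<longrightarrow> (\<forall>x\<in>{0..1}.
      \<bar>barrier \<omega> f0 lam \<xi> x - barrier \<omega> f0 lam xbar x\<bar> < \<epsilon>)"
proof -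
  define P :: "real \<Rightarrow> real" where "P r = sinh (\<omega> * r) - cosh (\<omega> * (1 - r))" for r
  define K where "K = lam / \<omega>\<^sup>2 * (1 - f0)"
  have "K \<ge> 0"
    using assms by (simp add: K_def)
  have "isCont P xbar"
    unfolding P_def[abs_def] by (intro continuous_intros)
  \<comment> \<open>Dividing by K + 1 also covers K = 0.\<close>
  then obtain d where d: "d > 0" "\<And>r. \<bar>r - xbar\<bar> < d \<Longrightarrow> \<bar>P r - P xbar\<bar> < \<epsilon> / (K + 1)"
    using \<open>K \<ge> 0\<close> \<open>\<epsilon> > 0\<close> unfolding continuous_at_eps_delta dist_real_def
    by (metis add_nonneg_pos divide_pos_pos zero_less_one)
  have "\<bar>barrier \<omega> f0 lam \<xi> x - barrier \<omega> f0 lam xbar x\<bar> < \<epsilon>"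
    if \<xi>: "\<xi> \<in> {0..1}" "\<bar>\<xi> - xbar\<bar> < d" and x: "x \<in> {0..1}" for \<xi> x
  proof -
    have "\<bar>step_response \<omega> \<xi> x - step_response \<omega> xbar x\<bar> \<le> \<bar>P \<xi> - P xbar\<bar>"
      using step_response_mono[OF w, of \<xi> xbar x] step_response_mono[OF w, of xbar \<xi> x] \<xi> x assms
      by (cases "\<xi> \<le> xbar") (auto simp: P_def)
    also have "\<dots> < \<epsilon> / (K + 1)"
      using d \<xi> by blast
    finally have *: "\<bar>step_response \<omega> \<xi> x - step_response \<omega> xbar x\<bar> < \<epsilon> / (K + 1)" .
    have "\<bar>barrier \<omega> f0 lam \<xi> x - barrier \<omega> f0 lam xbar x\<bar> =
        \<bar>K\<bar> * \<bar>step_response \<omega> \<xi> x - step_response \<omega> xbar x\<bar>"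
      using w by (simp add: barrier_diff K_def flip: abs_mult)
    also have "\<dots> = K * \<bar>step_response \<omega> \<xi> x - step_response \<omega> xbar x\<bar>"
      using \<open>K \<ge> 0\<close> by simp
    also have "\<dots> \<le> K * (\<epsilon> / (K + 1))"
      using * \<open>K \<ge> 0\<close> by (intro mult_left_mono) auto
    also have "\<dots> < \<epsilon>"
      using \<open>K \<ge> 0\<close> \<open>\<epsilon> > 0\<close> by (simp add: field_simps)
    finally show ?thesis .
  qed
  then show ?thesis
    using d(1) by blast
qed

section \<open>Identification of the monotone solution with a barrier\<close>

text \<open>Reduction of order with the positive solution cosh(\<omega> x) settles uniqueness by
  hand. Continuity of \<open>d'\<close> is asked for only on [0, 1), as the notion of solution says
  nothing about the derivative at 1; the endpoint 1 enters through the continuity of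
  \<open>d\<close> alone.\<close>

lemma C1_ODE_unique:
  fixes d d' :: "real \<Rightarrow> real"
  assumes "continuous_on {0..1} d" "continuous_on {0..<1} d'" "d' 0 = 0" "d 1 = 0"
    and d: "\<And>x. x \<in> {0<..<1} - {xf} \<Longrightarrow> (d has_real_derivative d' x) (at x)"
    and d': "\<And>x. x \<in> {0<..<1} - {xf} \<Longrightarrow> (d' has_real_derivative \<omega>\<^sup>2 * d x) (at x)"
    and x: "x \<in> {0..1}"
  shows "d x = 0"
proof -
  \<comment> \<open>the Wronskian of \<open>d\<close> and \<open>cosh (\<omega> x)\<close>\<close>
  define E where "E x = d' x * cosh (\<omega> * x) - \<omega> * d x * sinh (\<omega> * x)" for x
  have E0: "E y = 0" if y: "y \<in> {0..<1}" for y
  proof (rule has_derivative_zero_unique_strong_interval[of "{0, xf, y}" 0 y E])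
    show "continuous_on {0..y} E"
      unfolding E_def[abs_def] using assms(1,2) y
      by (intro continuous_intros; auto intro: continuous_on_subset)
    show "E 0 = 0"
      using assms by (simp add: E_def)
    fix z assume z: "z \<in> {0..y} - {0, xf, y}"
    then have z': "z \<in> {0<..<1} - {xf}"
      using y by auto
    have "(E has_real_derivative 0) (at z)"
      unfolding E_def[abs_def] using d[OF z'] d'[OF z']
      by (auto intro!: derivative_eq_intros simp: power2_eq_square algebra_simps)
    then show "(E has_derivative (\<lambda>h. 0)) (at z within {0..y})"
      unfolding has_field_derivative_def by (simp add: has_derivative_at_withinI mult_zero_left[abs_def])
  qed (use y in auto)
  \<comment> \<open>The derivative of this quotient is the vanishing Wronskian over cosh squared, so
    the quotient is constant and its value at 1 is 0.\<close>
  define G where "G x = d x / cosh (\<omega> * x)" for x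
  have G: "G y = G 0" if y: "y \<in> {0..1}" for y
  proof (rule has_derivative_zero_unique_strong_interval[of "{0, xf, 1}" 0 1 G])
    show "continuous_on {0..1} G"
      unfolding G_def[abs_def] by (intro continuous_intros assms) auto
    fix z assume z: "z \<in> {0..1} - {0, xf, 1}"
    then have z': "z \<in> {0<..<1} - {xf}"
      by auto
    have "(G has_real_derivative E z / (cosh (\<omega> * z))\<^sup>2) (at z)"
      unfolding G_def[abs_def] using d[OF z']
      by (auto intro!: derivative_eq_intros simp: E_def power2_eq_square algebra_simps)
    then have "(G has_real_derivative 0) (at z)"
      using E0[of z] z' by simp
    then show "(G has_derivative (\<lambda>h. 0)) (at z within {0..1})"
      unfolding has_field_derivative_def by (simp add: has_derivative_at_withinI mult_zero_left[abs_def])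
  qed (use y in auto)
  have "G x = G 1"
    using G[OF x] G[of 1] by simp
  then show ?thesis
    using assms by (simp add: G_def)
qed

text \<open>Monotonicity decides the phases: u \<ge> \<mu> to the left of \<open>xf\<close> and, as
  shown below, u < \<mu> to the right. Hence u solves the linear two-phase problem with its own free
  boundary, which has one solution.\<close>

lemma monotone_solution_eq_barrier:
  assumes w: "\<omega> > 0" and f0: "0 < f0" "f0 < 1" and xf: "0 < xf"
    and lam: "0 < lam" "lam \<noteq> \<omega>\<^sup>2 * \<mu>"
    and u: "monotone_solution \<omega> \<mu> f0 lam xf u"
    and x: "x \<in> {0..1}"
  shows "u x = barrier \<omega> f0 lam xf x"
proof -
  have xf1: "xf < 1" and cu: "continuous_on {0..1} u" and "u xf = \<mu>" "u 1 = 0"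
    and mono: "\<And>x. x \<in> {0<..<1} \<Longrightarrow> deriv u x \<le> 0"
    using u unfolding monotone_solution_def free_boundary_solution_def by auto
  from u have "\<exists>u' u''.
        (\<forall>x\<in>{0..<1}. (u has_real_derivative u' x) (at x within {0..<1})) \<and>
        continuous_on {0..<1} u' \<and> u' 0 = 0 \<and>
        (\<forall>x\<in>{0<..<1} - {xf}. (u' has_real_derivative u'' x) (at x)) \<and>
        continuous_on ({0<..<1} - {xf}) u'' \<and>
        (\<forall>x\<in>{0<..<1} - {xf}. - u'' x + \<omega>\<^sup>2 * u x = lam * reaction \<mu> f0 (u x))"
    unfolding monotone_solution_def free_boundary_solution_def by (elim conjE)
  then obtain u' u'' where du: "\<And>x. x \<in> {0..<1} \<Longrightarrow> (u has_real_derivative u' x) (at x within {0..<1})"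
    and cu': "continuous_on {0..<1} u'" and u'0: "u' 0 = 0"
    and du': "\<And>x. x \<in> {0<..<1} - {xf} \<Longrightarrow> (u' has_real_derivative u'' x) (at x)"
    and eq: "\<And>x. x \<in> {0<..<1} - {xf} \<Longrightarrow> - u'' x + \<omega>\<^sup>2 * u x = lam * reaction \<mu> f0 (u x)"
    by metis
  have du1: "(u has_real_derivative u' x) (at x)" if "x \<in> {0<..<1}" for x
  proof -
    have "(u has_real_derivative u' x) (at x within {0<..<1})"
      using du[of x] that by (auto intro: has_field_derivative_subset)
    then show ?thesis
      using that by (simp add: at_within_open[of x "{0<..<1}"])
  qed
  have u'neg: "u' x \<le> 0" if "x \<in> {0<..<1}" for x
    using mono[OF that] DERIV_imp_deriv[OF du1[OF that]] by simp
  have anti: "u z \<le> u y" if "0 \<le> y" "y \<le> z" "z \<le> 1" for y z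
  proof (cases "y = z")
    case False
    show ?thesis
    proof (rule DERIV_nonpos_imp_decreasing_open[where f = u and a = y and b = z])
      show "y \<le> z" by fact
      show "continuous_on {y..z} u"
        using cu that by (auto intro: continuous_on_subset)
      fix t assume "y < t" "t < z"
      then show "\<exists>s. (u has_real_derivative s) (at t) \<and> s \<le> 0"
        using du1[of t] u'neg[of t] that by auto
    qed
  qed simp
  \<comment> \<open>Otherwise monotonicity makes u equal to \<mu> on all of [xf, y]. Then u'' = 0
    inside, and since the reaction at the level \<mu> is 1, the equation gives lam =
    \<open>\<omega>\<^sup>2 * \<mu>\<close>.\<close>
  have right: "u y < \<mu>" if y: "xf < y" "y < 1" for y
  proof (rule ccontr)
    assume "\<not> u y < \<mu>"
    then have const: "u z = \<mu>" if "z \<in> {xf..y}" for z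
      using anti[of xf z] anti[of z y] that y xf \<open>u xf = \<mu>\<close> by auto
    define z where "z = (xf + y) / 2"
    have z: "xf < z" "z < y"
      using y by (auto simp: z_def)
    have u'z: "u' t = 0" if "t \<in> {xf<..<y}" for t
    proof -
      have "((\<lambda>_. \<mu>) has_real_derivative 0) (at t)"
        by simp
      then have "(u has_real_derivative 0) (at t)"
        by (rule has_field_derivative_transform_within_open[of _ _ _ "{xf<..<y}"]) (use that const in auto)
      then show ?thesis
        using du1[of t] that y xf by (intro DERIV_unique[of u]) auto
    qed
    have "((\<lambda>_. 0) has_real_derivative 0) (at z)"
      by simp
    then have "(u' has_real_derivative 0) (at z)"
      by (rule has_field_derivative_transform_within_open[of _ _ _ "{xf<..<y}"]) (use z u'z in auto)
    then have "u'' z = 0"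
      using du'[of z] z y xf by (intro DERIV_unique[of u']) auto
    then show False
      using eq[of z] z y xf const[of z] lam by (simp add: reaction_def heaviside_def)
  qed
  have ode: "u'' y = \<omega>\<^sup>2 * u y - lam * two_phase f0 xf y" if "y \<in> {0<..<1} - {xf}" for y
  proof -
    have "reaction \<mu> f0 (u y) = two_phase f0 xf y"
    proof (cases "y < xf")
      case True
      then show ?thesis
        using anti[of y xf] that xf1 \<open>u xf = \<mu>\<close> by (simp add: reaction_def heaviside_def two_phase_def)
    next
      case False
      then show ?thesis
        using right[of y] that by (simp add: reaction_def heaviside_def two_phase_def)
    qed
    then show ?thesis
      using eq[OF that] by simp
  qed
  have "u x - barrier \<omega> f0 lam xf x = 0"
  proof (rule C1_ODE_unique[where d = "\<lambda>x. u x - barrier \<omega> f0 lam xf x"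
        and d' = "\<lambda>x. u' x - barrier' \<omega> f0 lam xf x" and xf = xf and \<omega> = \<omega>, OF _ _ _ _ _ _ x])
    show "continuous_on {0..1} (\<lambda>x. u x - barrier \<omega> f0 lam xf x)"
      by (intro continuous_intros cu)
    show "continuous_on {0..<1} (\<lambda>x. u' x - barrier' \<omega> f0 lam xf x)"
      by (intro continuous_intros cu')
    show "u' 0 - barrier' \<omega> f0 lam xf 0 = 0"
      using u'0 xf by (simp add: barrier'_0)
    show "u 1 - barrier \<omega> f0 lam xf 1 = 0"
      using \<open>u 1 = 0\<close> xf1 by (simp add: barrier_1)
    fix y assume y: "y \<in> {0<..<1} - {xf}"
    show "((\<lambda>x. u x - barrier \<omega> f0 lam xf x) has_real_derivative u' y - barrier' \<omega> f0 lam xf y) (at y)"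
      using y by (intro DERIV_diff du1 deriv_barrier) auto
    show "((\<lambda>x. u' x - barrier' \<omega> f0 lam xf x) has_real_derivative \<omega>\<^sup>2 * (u y - barrier \<omega> f0 lam xf y)) (at y)"
      using y w by (intro DERIV_cong[OF DERIV_diff[OF du'[OF y] deriv_barrier']])
        (auto simp: ode[OF y] algebra_simps)
  qed
  then show ?thesis by simp
qed

section \<open>Backward heat equation with trigonometric data\<close>

text \<open>Time runs forward here; the dual problem is reached by the reversal T - t. Everything is
  demanded on the whole plane, which finite sums of modes satisfy, so later arguments need no domain
  conditions.\<close>

definition caloric :: "real \<Rightarrow> (real \<Rightarrow> real \<Rightarrow> real) \<Rightarrow> (real \<Rightarrow> real \<Rightarrow> real) \<Rightarrow>
    (real \<Rightarrow> real \<Rightarrow> real) \<Rightarrow> (real \<Rightarrow> real \<Rightarrow> real) \<Rightarrow> bool" where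
  "caloric \<omega> \<Phi> \<Phi>t \<Phi>x \<Phi>xx \<longleftrightarrow>
     (\<forall>t x. ((\<lambda>s. \<Phi> s x) has_real_derivative \<Phi>t t x) (at t)) \<and>
     (\<forall>t x. (\<Phi> t has_real_derivative \<Phi>x t x) (at x)) \<and>
     (\<forall>t x. (\<Phi>x t has_real_derivative \<Phi>xx t x) (at x)) \<and>
     continuous_on UNIV (\<lambda>(t, x). \<Phi> t x) \<and> continuous_on UNIV (\<lambda>(t, x). \<Phi>t t x) \<and>
     continuous_on UNIV (\<lambda>(t, x). \<Phi>x t x) \<and> continuous_on UNIV (\<lambda>(t, x). \<Phi>xx t x) \<and>
     (\<forall>t x. \<Phi>t t x = \<Phi>xx t x - \<omega>\<^sup>2 * \<Phi> t x) \<and> (\<forall>t. \<Phi> t 1 = 0) \<and> (\<forall>t. \<Phi>x t 0 = 0)"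

lemma caloric_add:
  assumes "caloric \<omega> \<Phi> \<Phi>t \<Phi>x \<Phi>xx" "caloric \<omega> \<Psi> \<Psi>t \<Psi>x \<Psi>xx"
  shows "caloric \<omega> (\<lambda>t x. \<Phi> t x + \<Psi> t x) (\<lambda>t x. \<Phi>t t x + \<Psi>t t x)
    (\<lambda>t x. \<Phi>x t x + \<Psi>x t x) (\<lambda>t x. \<Phi>xx t x + \<Psi>xx t x)"
  using assms unfolding caloric_def case_prod_beta
  by (auto intro!: DERIV_add continuous_on_add simp: distrib_left)

lemma caloric_scale:
  assumes "caloric \<omega> \<Phi> \<Phi>t \<Phi>x \<Phi>xx"
  shows "caloric \<omega> (\<lambda>t x. c * \<Phi> t x) (\<lambda>t x. c * \<Phi>t t x) (\<lambda>t x. c * \<Phi>x t x) (\<lambda>t x. c * \<Phi>xx t x)"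
  using assms unfolding caloric_def case_prod_beta
  by (auto intro!: DERIV_cmult continuous_on_mult_left) (simp add: right_diff_distrib)

lemma caloric_mode:
  fixes k :: nat and \<omega> :: real
  defines "m \<equiv> (2 * real k + 1) * (pi / 2)"
  defines "e \<equiv> \<lambda>t. exp (- (m\<^sup>2 + \<omega>\<^sup>2) * t)"
  shows "caloric \<omega> (\<lambda>t x. e t * cos (m * x)) (\<lambda>t x. - (m\<^sup>2 + \<omega>\<^sup>2) * e t * cos (m * x))
    (\<lambda>t x. e t * - (m * sin (m * x))) (\<lambda>t x. e t * - (m\<^sup>2 * cos (m * x)))"
proof -
  have "cos m = 0"
    unfolding m_def cos_zero_iff by (auto intro!: disjI1 exI[of _ "2 * k + 1"])
  then show ?thesis
    unfolding caloric_def e_def case_prod_beta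
    by (auto intro!: derivative_eq_intros continuous_intros simp: power2_eq_square algebra_simps)
qed

text \<open>The modes are the eigenfunctions for a Neumann condition at \<open>0\<close> and a Dirichlet condition at \<open>1\<close>.\<close>

inductive_set cosine_span :: "(real \<Rightarrow> real) set" where
  mode: "(\<lambda>x. cos ((2 * real k + 1) * (pi / 2) * x)) \<in> cosine_span"
| add: "f \<in> cosine_span \<Longrightarrow> g \<in> cosine_span \<Longrightarrow> (\<lambda>x. f x + g x) \<in> cosine_span"
| scale: "f \<in> cosine_span \<Longrightarrow> (\<lambda>x. c * f x) \<in> cosine_span"

text \<open>Each mode evolves by its own exponential factor, so for data in the span the dual
  problem is solved explicitly.\<close>

lemma caloric_extension:
  assumes "f \<in> cosine_span"
  shows "\<exists>\<Phi> \<Phi>t \<Phi>x \<Phi>xx. caloric \<omega> \<Phi> \<Phi>t \<Phi>x \<Phi>xx \<and> \<Phi> 0 = f"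
  using assms
proof induction
  case (mode k)
  show ?case
    by (intro exI conjI, rule caloric_mode[where k = k]) simp
next
  case (add f g)
  then obtain \<Phi> \<Phi>t \<Phi>x \<Phi>xx \<Psi> \<Psi>t \<Psi>x \<Psi>xx
    where *: "caloric \<omega> \<Phi> \<Phi>t \<Phi>x \<Phi>xx" "\<Phi> 0 = f" "caloric \<omega> \<Psi> \<Psi>t \<Psi>x \<Psi>xx" "\<Psi> 0 = g"
    by blast
  show ?case
    by (rule exI, rule exI, rule exI, rule exI, rule conjI, rule caloric_add[OF *(1,3)]) (use * in auto)
next
  case (scale f c)
  then obtain \<Phi> \<Phi>t \<Phi>x \<Phi>xx where *: "caloric \<omega> \<Phi> \<Phi>t \<Phi>x \<Phi>xx" "\<Phi> 0 = f"
    by blast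
  show ?case
    by (rule exI, rule exI, rule exI, rule exI, rule conjI, rule caloric_scale[OF *(1)]) (use * in auto)
qed

text \<open>With a = pi x / 2 and b the phase of the mode, cos(a)^2 cos(b) equals cos(b) / 2 + cos(b
  + 2 a) / 4 + cos(b - 2 a) / 4, so the index k moves by at most one.\<close>

lemma cosine_span_mult_cos2:
  assumes "f \<in> cosine_span"
  shows "(\<lambda>x. (cos (pi / 2 * x))\<^sup>2 * f x) \<in> cosine_span"
  using assms
proof induction
  case (mode k)
  let ?e = "\<lambda>k x. cos ((2 * real k + 1) * (pi / 2) * x)"
  \<comment> \<open>Lowering the index 0 gives the phase -pi x / 2, which by evenness of cos is mode
    0 again.\<close>
  define j where "j = (if k = 0 then 0 else k - 1)"
  have eq: "(cos (pi / 2 * x))\<^sup>2 * ?e k x = 1/2 * ?e k x + (1/4 * ?e (Suc k) x + 1/4 * ?e j x)" for x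
  proof -
    define a where "a = pi / 2 * x"
    define b where "b = (2 * real k + 1) * (pi / 2) * x"
    have 1: "?e (Suc k) x = cos (b + 2 * a)"
      by (simp add: a_def b_def algebra_simps)
    have 2: "?e j x = cos (b - 2 * a)"
    proof (cases k)
      case 0
      then have "b - 2 * a = - a"
        by (simp add: a_def b_def)
      then show ?thesis
        using 0 by (simp add: j_def a_def)
    next
      case (Suc i)
      then show ?thesis
        by (simp add: a_def b_def j_def algebra_simps)
    qed
    have 3: "(cos a)\<^sup>2 = (1 + cos (2 * a)) / 2"
      by (simp add: cos_double_cos)
    have 4: "?e k x = cos b"
      by (simp add: b_def)
    show ?thesis
      unfolding 1 2 4 a_def[symmetric] 3 cos_add cos_diff by (simp add: field_simps)
  qed
  show ?case
    unfolding eq by (intro cosine_span.intros)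
next
  case (add f g)
  then show ?case
    using cosine_span.add[OF add.IH] by (simp add: algebra_simps)
next
  case (scale f c)
  then show ?case
    using cosine_span.scale[OF scale.IH, of c] by (simp add: algebra_simps)
qed

lemma cosine_span_sum:
  assumes "finite A" "A \<noteq> {}" "\<And>k. k \<in> A \<Longrightarrow> f k \<in> cosine_span"
  shows "(\<lambda>x. \<Sum>k\<in>A. f k x) \<in> cosine_span"
  using assms by (induction rule: finite_ne_induct) (auto intro: cosine_span.add)

text \<open>Starting from mode 0, multiplication by cos^2 and by 1 - cos^2 stays in the span, and
  Bernstein polynomials are combinations of such products. The leading cosine supplies the zero at x
  = 1.\<close>

lemma cosine_span_Bernstein:
  "(\<lambda>x. cos (pi / 2 * x) * (\<Sum>k\<le>n. g k * Bernstein n k ((cos (pi / 2 * x))\<^sup>2))) \<in> cosine_span"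
proof -
  let ?c = "\<lambda>x. cos (pi / 2 * x)"
  have 1: "(\<lambda>x. ((?c x)\<^sup>2) ^ i * ?c x) \<in> cosine_span" for i
  proof (induction i)
    case 0
    show ?case
      using cosine_span.mode[of 0] by simp
  next
    case (Suc i)
    show ?case
      using cosine_span_mult_cos2[OF Suc] by (simp add: mult.assoc)
  qed
  have 2: "(\<lambda>x. (1 - (?c x)\<^sup>2) ^ j * (((?c x)\<^sup>2) ^ i * ?c x)) \<in> cosine_span" for i j
  proof (induction j)
    case 0
    show ?case
      using 1 by simp
  next
    case (Suc j)
    show ?case
      using cosine_span.add[OF Suc cosine_span.scale[OF cosine_span_mult_cos2[OF Suc], of "-1"]]
      by (simp add: algebra_simps)
  qed
  have "(\<lambda>x. \<Sum>k\<le>n. (g k * real (n choose k)) * ((1 - (?c x)\<^sup>2) ^ (n - k) * (((?c x)\<^sup>2) ^ k * ?c x)))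
      \<in> cosine_span"
    by (intro cosine_span_sum cosine_span.scale 2) auto
  also have "(\<lambda>x. \<Sum>k\<le>n. (g k * real (n choose k)) * ((1 - (?c x)\<^sup>2) ^ (n - k) * (((?c x)\<^sup>2) ^ k * ?c x))) =
      (\<lambda>x. ?c x * (\<Sum>k\<le>n. g k * Bernstein n k ((?c x)\<^sup>2)))"
    by (simp add: Bernstein_def sum_distrib_left mult_ac)
  finally show ?thesis .
qed

section \<open>Maximum principle for the dual functions\<close>

lemma caloric_nonneg:
  assumes "\<omega> > 0" and c: "caloric \<omega> \<Phi> \<Phi>t \<Phi>x \<Phi>xx"
    and init: "\<And>x. x \<in> {0..1} \<Longrightarrow> 0 \<le> \<Phi> 0 x"
    and t: "0 \<le> t" and x: "x \<in> {0..1}"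
  shows "0 \<le> \<Phi> t x"
proof (rule ccontr)
  \<comment> \<open>at a negative minimum the zeroth order term makes the equation fail strictly\<close>
  assume neg: "\<not> 0 \<le> \<Phi> t x"
  have dt: "((\<lambda>s. \<Phi> s y) has_real_derivative \<Phi>t s y) (at s)"
    and dx: "(\<Phi> s has_real_derivative \<Phi>x s y) (at y)"
    and dxx: "(\<Phi>x s has_real_derivative \<Phi>xx s y) (at y)"
    and heat: "\<Phi>t s y = \<Phi>xx s y - \<omega>\<^sup>2 * \<Phi> s y"
    and bc: "\<Phi> s 1 = 0" "\<Phi>x s 0 = 0" for s y
    using c by (auto simp: caloric_def)
  have "continuous_on ({0..t} \<times> {0..1}) (\<lambda>(t, x). \<Phi> t x)"
    using c by (auto simp: caloric_def intro: continuous_on_subset)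
  moreover have "compact ({0..t} \<times> {0..1::real})" "{0..t} \<times> {0..1::real} \<noteq> {}"
    using t by (auto intro: compact_Times)
  ultimately obtain z where z: "z \<in> {0..t} \<times> {0..1}"
    "\<And>w. w \<in> {0..t} \<times> {0..1} \<Longrightarrow> (case z of (t, x) \<Rightarrow> \<Phi> t x) \<le> (case w of (t, x) \<Rightarrow> \<Phi> t x)"
    using continuous_attains_inf by metis
  obtain s y where "z = (s, y)" by force
  with z have sy: "s \<in> {0..t}" "y \<in> {0..1}"
    and min: "\<And>s' y'. s' \<in> {0..t} \<Longrightarrow> y' \<in> {0..1} \<Longrightarrow> \<Phi> s y \<le> \<Phi> s' y'"
    by auto
  have "\<Phi> s y < 0"
    using min[of t x] neg t x by auto
  have "s > 0"
    using \<open>\<Phi> s y < 0\<close> init[of y] sy by (cases "s = 0") auto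
  have "y < 1"
    using \<open>\<Phi> s y < 0\<close> bc(1)[of s] sy by (cases "y = 1") auto
  \<comment> \<open>Comparison with earlier times only, so that a minimum at the final time s = t is
    included.\<close>
  have "\<Phi>t s y \<le> 0"
  proof (rule ccontr)
    assume "\<not> \<Phi>t s y \<le> 0"
    then have "\<exists>d>0. \<forall>h>0. h < d \<longrightarrow> \<Phi> (s - h) y < \<Phi> s y"
      by (intro DERIV_pos_inc_left[OF dt[of y s]]) simp
    then obtain d where d: "d > 0" "\<And>h. h > 0 \<Longrightarrow> h < d \<Longrightarrow> \<Phi> (s - h) y < \<Phi> s y"
      by blast
    define h where "h = min (d / 2) s"
    have "h > 0" "h < d" "h \<le> s"
      using \<open>d > 0\<close> \<open>s > 0\<close> by (auto simp: h_def)
    then show False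
      using d(2)[of h] min[of "s - h" y] sy by auto
  qed
  moreover have "\<Phi>x s y = 0"
  proof (cases "y = 0")
    case False
    show ?thesis
    proof (rule DERIV_local_min[OF dx])
      show "0 < min y (1 - y)"
        using False sy \<open>y < 1\<close> by auto
      show "\<forall>y'. \<bar>y - y'\<bar> < min y (1 - y) \<longrightarrow> \<Phi> s y \<le> \<Phi> s y'"
        using min[OF sy(1)] by (auto simp: abs_if split: if_splits)
    qed
  qed (simp add: bc)
  \<comment> \<open>Comparison with points to the right only: this treats y = 0, where the Neumann
    condition yields the stationarity, together with interior points.\<close>
  have "\<Phi>xx s y \<ge> 0"
  proof (rule ccontr)
    assume "\<not> \<Phi>xx s y \<ge> 0"
    then have "\<exists>d>0. \<forall>h>0. h < d \<longrightarrow> \<Phi>x s (y + h) < \<Phi>x s y"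
      by (intro DERIV_neg_dec_right[OF dxx[of s y]]) simp
    then obtain d where d: "d > 0" "\<And>h. h > 0 \<Longrightarrow> h < d \<Longrightarrow> \<Phi>x s (y + h) < \<Phi>x s y"
      by blast
    define h where "h = min (d / 2) (1 - y)"
    have h: "h > 0" "h < d" "y + h \<le> 1"
      using \<open>d > 0\<close> \<open>y < 1\<close> by (auto simp: h_def)
    have "\<Phi> s (y + h) < \<Phi> s y"
    proof (rule DERIV_neg_imp_decreasing_open[where f = "\<Phi> s" and a = y and b = "y + h"])
      show "y < y + h" using h by simp
      show "continuous_on {y..y + h} (\<Phi> s)"
        using dx by (meson DERIV_isCont continuous_at_imp_continuous_on)
      fix r assume "y < r" "r < y + h"
      then show "\<exists>q. (\<Phi> s has_real_derivative q) (at r) \<and> q < 0"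
        using dx[of s r] d(2)[of "r - y"] h \<open>\<Phi>x s y = 0\<close> by auto
    qed
    then show False
      using min[OF sy(1), of "y + h"] h sy by auto
  qed
  moreover have "\<omega>\<^sup>2 * \<Phi> s y < 0"
    using \<open>\<Phi> s y < 0\<close> \<open>\<omega> > 0\<close> by (simp add: mult_pos_neg)
  ultimately show False
    using heat[of s y] by linarith
qed

lemma cos_quarter_nonneg: "x \<in> {0..1} \<Longrightarrow> 0 \<le> cos (pi / 2 * x)"
proof (rule cos_ge_zero)
  assume x: "x \<in> {0..1}"
  show "- (pi / 2) \<le> pi / 2 * x"
    by (rule order_trans[of _ 0]) (use x in auto)
  show "pi / 2 * x \<le> pi / 2"
    using x by (simp add: mult_left_le)
qed

text \<open>The upper bound compares with the exact solution starting from cos(pi x / 2), namely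
  mode 0, whose exponential factor is at most 1.\<close>

lemma caloric_between:
  assumes "\<omega> > 0" and c: "caloric \<omega> \<Phi> \<Phi>t \<Phi>x \<Phi>xx"
    and init: "\<And>x. x \<in> {0..1} \<Longrightarrow> 0 \<le> \<Phi> 0 x \<and> \<Phi> 0 x \<le> cos (pi / 2 * x)"
    and t: "0 \<le> t" and x: "x \<in> {0..1}"
  shows "0 \<le> \<Phi> t x" and "\<Phi> t x \<le> cos (pi / 2 * x)"
proof -
  show "0 \<le> \<Phi> t x"
    using caloric_nonneg[OF assms(1) c _ t x] init by blast
  have "0 \<le> exp (- ((pi/2)\<^sup>2 + \<omega>\<^sup>2) * t) * cos (pi/2 * x) + (- 1) * \<Phi> t x"
    using caloric_nonneg[OF assms(1)
        caloric_add[OF caloric_mode[where k = 0] caloric_scale[OF c, of "-1"]], of t x] t x init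
    by simp
  moreover have "0 \<le> cos (pi/2 * x)"
    using x by (rule cos_quarter_nonneg)
  then have "exp (- ((pi/2)\<^sup>2 + \<omega>\<^sup>2) * t) * cos (pi/2 * x) \<le> cos (pi/2 * x)"
    using mult_nonpos_nonneg[of "- ((pi / 2)\<^sup>2 + \<omega>\<^sup>2)" t] t by (intro mult_left_le_one_le) auto
  ultimately show "\<Phi> t x \<le> cos (pi / 2 * x)"
    by linarith
qed

text \<open>A nonnegative function that vanishes at 1 cannot increase there. The sign is wanted
  because the shift \<kappa> of a barrier does not vanish at 1 and leaves a boundary term with this
  slope.\<close>

lemma caloric_boundary_slope:
  assumes "\<omega> > 0" and c: "caloric \<omega> \<Phi> \<Phi>t \<Phi>x \<Phi>xx"
    and "\<And>x. x \<in> {0..1} \<Longrightarrow> 0 \<le> \<Phi> t x"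
  shows "\<Phi>x t 1 \<le> 0"
proof (rule ccontr)
  assume neg: "\<not> \<Phi>x t 1 \<le> 0"
  have "(\<Phi> t has_real_derivative \<Phi>x t 1) (at 1)" and "\<Phi> t 1 = 0"
    using c by (auto simp: caloric_def)
  then have "\<exists>d>0. \<forall>h>0. h < d \<longrightarrow> \<Phi> t (1 - h) < 0"
    using DERIV_pos_inc_left[of "\<Phi> t" "\<Phi>x t 1" 1] neg by simp
  then obtain d where d: "d > 0" "\<And>h. h > 0 \<Longrightarrow> h < d \<Longrightarrow> \<Phi> t (1 - h) < 0"
    by blast
  define h where "h = min (d / 2) 1"
  have "h > 0" "h < d" "h \<le> 1"
    using \<open>d > 0\<close> by (auto simp: h_def)
  then show False
    using d(2)[of h] assms(3)[of "1 - h"] by auto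
qed

section \<open>Integration by parts and a Gronwall lemma\<close>

lemma AE_lborel_prod_component:
  assumes "AE x in (lborel :: 'a::euclidean_space measure). P x"
  shows "AE z in (lborel :: ('a \<times> 'b::euclidean_space) measure). P (fst z)"
    and "AE z in (lborel :: ('b::euclidean_space \<times> 'a) measure). P (snd z)"
proof -
  obtain N where N: "N \<in> null_sets lborel" "{x. \<not> P x} \<subseteq> N"
    using assms unfolding eventually_ae_filter by auto
  have "N \<times> UNIV \<in> null_sets (lborel \<Otimes>\<^sub>M (lborel :: 'b measure))"
    using N by (intro lborel.times_in_null_sets1) auto
  then have "N \<times> UNIV \<in> null_sets (lborel :: ('a \<times> 'b) measure)"
    by (simp only: lborel_prod)
  then show "AE z in (lborel :: ('a \<times> 'b) measure). P (fst z)"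
    using N by (intro AE_I'[of "N \<times> UNIV"]) auto
  have "UNIV \<times> N \<in> null_sets ((lborel :: 'b measure) \<Otimes>\<^sub>M lborel)"
    using N by (intro lborel.times_in_null_sets2) auto
  then have "UNIV \<times> N \<in> null_sets (lborel :: ('b \<times> 'a) measure)"
    by (simp only: lborel_prod)
  then show "AE z in (lborel :: ('b \<times> 'a) measure). P (snd z)"
    using N by (intro AE_I'[of "UNIV \<times> N"]) auto
qed

lemma integrable_lebesgue_tensor:
  fixes f :: "'a::euclidean_space \<Rightarrow> real" and g :: "'b::euclidean_space \<Rightarrow> real"
  assumes "integrable lebesgue f" "integrable lebesgue g"
  shows "integrable lebesgue (\<lambda>z. f (fst z) * g (snd z))"
proof -
  obtain F where F: "integrable lborel F" "AE x in lborel. f x = F x"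
    using assms(1) by (rule integrable_lebesgue_ex_lborel)
  obtain G where G: "integrable lborel G" "AE x in lborel. g x = G x"
    using assms(2) by (rule integrable_lebesgue_ex_lborel)
  have [measurable]: "F \<in> borel_measurable borel" "G \<in> borel_measurable borel"
    using F G by auto
  have "integrable (lborel \<Otimes>\<^sub>M lborel) (\<lambda>z. F (fst z) * G (snd z))"
  proof (rule lborel_pair.Fubini_integrable)
    show "(\<lambda>z. F (fst z) * G (snd z)) \<in> borel_measurable (lborel \<Otimes>\<^sub>M lborel)"
      by measurable
    show "integrable lborel (\<lambda>x. LINT y|lborel. norm (F (fst (x, y)) * G (snd (x, y))))"
      using F(1) by (simp add: abs_mult)
  qed (use G in auto)
  then have "integrable lborel (\<lambda>z. F (fst z) * G (snd z))"
    by (simp only: lborel_prod)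
  moreover have "AE z in lborel. f (fst z) * g (snd z) = F (fst z) * G (snd z)"
    using AE_lborel_prod_component(1)[OF F(2)] AE_lborel_prod_component(2)[OF G(2)]
    by eventually_elim simp
  ultimately show ?thesis
    by (rule integrable_lebesgue_cong_AE_lborel)
qed

lemma integrable_mult_continuous:
  fixes v g :: "'a::euclidean_space \<Rightarrow> real"
  assumes "bounded S" "S \<in> sets lebesgue" "integrable (lebesgue_on S) v" "continuous_on UNIV g"
  shows "integrable (lebesgue_on S) (\<lambda>x. v x * g x)"
proof -
  have "compact (closure S)"
    using assms by auto
  then have "compact (g ` closure S)"
    using assms(4) by (intro compact_continuous_image) (auto intro: continuous_on_subset)
  then obtain B where B: "\<And>y. y \<in> g ` closure S \<Longrightarrow> norm y \<le> B"
    using compact_imp_bounded bounded_iff by metis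
  have g: "g \<in> borel_measurable (lebesgue_on S)"
    using assms by (intro continuous_imp_measurable_on_sets_lebesgue) (auto intro: continuous_on_subset)
  have v: "v \<in> borel_measurable (lebesgue_on S)"
    using assms(3) by auto
  show ?thesis
  proof (rule Bochner_Integration.integrable_bound)
    show "integrable (lebesgue_on S) (\<lambda>x. B * \<bar>v x\<bar>)"
      using assms(3) by simp
    show "(\<lambda>x. v x * g x) \<in> borel_measurable (lebesgue_on S)"
      using g v by (rule borel_measurable_times[rotated])
    show "AE x in lebesgue_on S. norm (v x * g x) \<le> norm (B * \<bar>v x\<bar>)"
    proof (rule AE_I2)
      fix x assume "x \<in> space (lebesgue_on S)"
      then have "x \<in> closure S"
        using closure_subset by auto
      then have "\<bar>g x\<bar> \<le> B"
        using B by auto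
      then have "\<bar>v x\<bar> * \<bar>g x\<bar> \<le> \<bar>v x\<bar> * \<bar>B\<bar>"
        by (intro mult_left_mono) auto
      then show "norm (v x * g x) \<le> norm (B * \<bar>v x\<bar>)"
        by (simp add: abs_mult mult.commute)
    qed
  qed
qed

lemma integrable_const_lebesgue_on [simp]:
  fixes c :: real
  assumes "S \<in> lmeasurable"
  shows "integrable (lebesgue_on S) (\<lambda>_. c)"
  by (rule finite_measure.integrable_const[OF finite_measure_lebesgue_on[OF assms]])

lemma integrable_continuous_lebesgue_on:
  fixes g :: "'a::euclidean_space \<Rightarrow> real"
  assumes "bounded S" "S \<in> sets lebesgue" "continuous_on UNIV g"
  shows "integrable (lebesgue_on S) g"
  using integrable_mult_continuous[OF assms(1,2) integrable_const_lebesgue_on[of S 1] assms(3)] assms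
  by (simp add: bounded_set_imp_lmeasurable)

lemma integrable_in_L2:
  assumes "in_L2 S v" "S \<in> lmeasurable"
  shows "integrable (lebesgue_on S) v"
proof (rule Bochner_Integration.integrable_bound)
  show "integrable (lebesgue_on S) (\<lambda>x. 1 + (v x)\<^sup>2)"
    using assms unfolding in_L2_def by (intro Bochner_Integration.integrable_add) auto
  show "AE x in lebesgue_on S. norm (v x) \<le> norm (1 + (v x)\<^sup>2)"
  proof (rule AE_I2)
    fix x
    have "0 \<le> (\<bar>v x\<bar> - 1)\<^sup>2" by simp
    then have "2 * \<bar>v x\<bar> \<le> 1 + (v x)\<^sup>2"
      by (simp add: power2_diff)
    then show "norm (v x) \<le> norm (1 + (v x)\<^sup>2)"
      by simp
  qed
  show "v \<in> borel_measurable (lebesgue_on S)"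
    using assms by (simp add: in_L2_def)
qed

lemma integral_FTC_lebesgue_on:
  fixes F f :: "real \<Rightarrow> real"
  assumes "a \<le> b" "\<And>x. (F has_real_derivative f x) (at x)" "continuous_on UNIV f"
  shows "(\<integral>x. f x \<partial>lebesgue_on {a<..<b}) = F b - F a"
proof -
  have "(f has_integral (F b - F a)) {a..b}"
    using assms by (intro fundamental_theorem_of_calculus)
      (auto simp: has_real_derivative_iff_has_vector_derivative has_vector_derivative_at_within)
  then have "(f has_integral (F b - F a)) {a<..<b}"
    by (simp add: has_integral_Icc_iff_Ioo)
  moreover have "(f has_integral (\<integral>x. f x \<partial>lebesgue_on {a<..<b})) {a<..<b}"
    using assms by (intro has_integral_integral_lebesgue_on integrable_continuous_lebesgue_on) auto
  ultimately show ?thesis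
    by (rule has_integral_unique[symmetric])
qed

lemma lebesgue_on_indicator_integral:
  fixes f :: "real \<Rightarrow> real"
  assumes "S \<subseteq> T" "S \<in> sets lebesgue" "T \<in> sets lebesgue"
  shows "(\<integral>x. f x * indicat_real S x \<partial>lebesgue_on T) = (\<integral>x. f x \<partial>lebesgue_on S)"
proof -
  have "indicat_real T x *\<^sub>R (f x * indicat_real S x) = indicat_real S x *\<^sub>R f x" for x
    using assms(1) by (auto simp: indicator_def)
  note * = this
  have "(\<integral>x. f x * indicat_real S x \<partial>lebesgue_on T) =
      (\<integral>x. indicat_real T x *\<^sub>R (f x * indicat_real S x) \<partial>lebesgue)"
    using assms(3) by (intro integral_restrict_space) auto
  also have "\<dots> = (\<integral>x. indicat_real S x *\<^sub>R f x \<partial>lebesgue)"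
    by (simp only: *)
  also have "\<dots> = (\<integral>x. f x \<partial>lebesgue_on S)"
    using assms(2) by (intro integral_restrict_space[symmetric]) auto
  finally show ?thesis .
qed

lemma integrable_lebesgue_on_subset:
  fixes f :: "'a::euclidean_space \<Rightarrow> real"
  assumes "integrable (lebesgue_on T) f" "S \<subseteq> T" "S \<in> sets lebesgue" "T \<in> sets lebesgue"
  shows "integrable (lebesgue_on S) f"
proof -
  have "integrable lebesgue (\<lambda>x. indicat_real T x *\<^sub>R f x)"
    using assms by (simp add: integrable_restrict_space)
  then have "integrable lebesgue (\<lambda>x. indicat_real S x *\<^sub>R (indicat_real T x *\<^sub>R f x))"
    using assms(3) by (rule integrable_mult_indicator[rotated])
  also have "(\<lambda>x. indicat_real S x *\<^sub>R (indicat_real T x *\<^sub>R f x)) = (\<lambda>x. indicat_real S x *\<^sub>R f x)"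
    using assms(2) by (auto simp: indicator_def fun_eq_iff)
  finally show ?thesis
    using assms(3) by (simp add: integrable_restrict_space)
qed

text \<open>Fubini on the triangle x < y: integrating \<open>\<phi>''\<close> over (0, y) gives
  \<open>\<phi>'\<close> because of the Neumann condition at 0, while integrating w over (x, 1)
  gives -v. The boundary condition v(1) = 0 is contained in the primitive taken from 1, so no
  boundary term appears.\<close>

lemma in_V_integral_by_parts:
  assumes V: "in_V_with_deriv v w" and vm: "v \<in> borel_measurable (lebesgue_on {0<..<1})"
    and \<phi>: "\<And>x. (\<phi>' has_real_derivative \<phi>'' x) (at x)" "continuous_on UNIV \<phi>''" "\<phi>' 0 = 0"
  shows "(\<integral>x. w x * \<phi>' x \<partial>lebesgue_on {0<..<1}) = - (\<integral>x. v x * \<phi>'' x \<partial>lebesgue_on {0<..<1})"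
proof -
  let ?I = "{0<..<1::real}"
  let ?M = "lebesgue_on ?I"
  have w: "integrable ?M w"
    using V unfolding in_V_with_deriv_def by (intro integrable_in_L2) auto
  define F where "F z = w (fst z) * \<phi>'' (snd z) * indicat_real {z. snd z < fst z} z" for z
  have II: "?I \<times> ?I \<in> sets lebesgue"
    by (intro sets_completionI_sets) (simp add: borel_open open_Times)
  have F: "integrable (lebesgue_on (?I \<times> ?I)) F"
  proof -
    have "integrable lebesgue (\<lambda>x. indicat_real ?I x *\<^sub>R w x)"
      using w by (simp add: integrable_restrict_space)
    moreover have "integrable lebesgue (\<lambda>x. indicat_real ?I x *\<^sub>R \<phi>'' x)"
      using integrable_continuous_lebesgue_on[of ?I \<phi>''] \<phi> by (simp add: integrable_restrict_space)
    ultimately have "integrable lebesgue (\<lambda>z. (indicat_real ?I (fst z) *\<^sub>R w (fst z)) *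
        (indicat_real ?I (snd z) *\<^sub>R \<phi>'' (snd z)))"
      by (rule integrable_lebesgue_tensor)
    moreover have "{z::real \<times> real. snd z < fst z} \<in> sets lebesgue"
      by (intro sets_completionI_sets) (simp add: borel_open open_Collect_less continuous_on_fst continuous_on_snd)
    ultimately have "integrable lebesgue (\<lambda>z. indicat_real {z. snd z < fst z} z *\<^sub>R
        ((indicat_real ?I (fst z) *\<^sub>R w (fst z)) * (indicat_real ?I (snd z) *\<^sub>R \<phi>'' (snd z))))"
      by (rule integrable_mult_indicator[rotated])
    also have "(\<lambda>z. indicat_real {z. snd z < fst z} z *\<^sub>R
        ((indicat_real ?I (fst z) *\<^sub>R w (fst z)) * (indicat_real ?I (snd z) *\<^sub>R \<phi>'' (snd z)))) =
        (\<lambda>z. indicat_real (?I \<times> ?I) z *\<^sub>R F z)"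
      by (auto simp: F_def indicator_def fun_eq_iff)
    finally show ?thesis
      using II by (simp add: integrable_restrict_space)
  qed
  have inner1: "(\<integral>x. F (y, x) \<partial>?M) = w y * \<phi>' y" if y: "y \<in> ?I" for y
  proof -
    have "(\<integral>x. F (y, x) \<partial>?M) = (\<integral>x. w y * (\<phi>'' x * indicat_real {0<..<y} x) \<partial>?M)"
      by (rule Bochner_Integration.integral_cong) (auto simp: F_def indicator_def)
    also have "\<dots> = w y * (\<integral>x. \<phi>'' x * indicat_real {0<..<y} x \<partial>?M)"
      by simp
    also have "(\<integral>x. \<phi>'' x * indicat_real {0<..<y} x \<partial>?M) = (\<integral>x. \<phi>'' x \<partial>lebesgue_on {0<..<y})"
      using y by (intro lebesgue_on_indicator_integral) auto
    also have "\<dots> = \<phi>' y"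
      using integral_FTC_lebesgue_on[of 0 y \<phi>' \<phi>''] \<phi> y by simp
    finally show ?thesis .
  qed
  have inner2: "(\<integral>y. F (y, x) \<partial>?M) = \<phi>'' x * (\<integral>y. w y \<partial>lebesgue_on {x<..<1})" if x: "x \<in> ?I" for x
  proof -
    have "(\<integral>y. F (y, x) \<partial>?M) = (\<integral>y. \<phi>'' x * (w y * indicat_real {x<..<1} y) \<partial>?M)"
      by (rule Bochner_Integration.integral_cong) (auto simp: F_def indicator_def)
    also have "\<dots> = \<phi>'' x * (\<integral>y. w y * indicat_real {x<..<1} y \<partial>?M)"
      by simp
    also have "(\<integral>y. w y * indicat_real {x<..<1} y \<partial>?M) = (\<integral>y. w y \<partial>lebesgue_on {x<..<1})"
      using x by (intro lebesgue_on_indicator_integral) auto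
    finally show ?thesis .
  qed
  have v: "AE x in ?M. v x = - (\<integral>y. w y \<partial>lebesgue_on {x<..<1})"
    using V by (simp add: in_V_with_deriv_def)
  have swap: "(\<integral>y. \<integral>x. F (y, x) \<partial>?M \<partial>?M) = (\<integral>x. \<integral>y. F (y, x) \<partial>?M \<partial>?M)"
    by (rule iterated_integral_swap) (use II F in auto)
  have "(\<integral>x. w x * \<phi>' x \<partial>?M) = (\<integral>y. \<integral>x. F (y, x) \<partial>?M \<partial>?M)"
    by (rule Bochner_Integration.integral_cong) (auto simp: inner1)
  also have "\<dots> = (\<integral>x. \<phi>'' x * (\<integral>y. w y \<partial>lebesgue_on {x<..<1}) \<partial>?M)"
    unfolding swap by (rule Bochner_Integration.integral_cong) (auto simp: inner2)
  also have "\<dots> = - (\<integral>x. - (\<integral>y. w y \<partial>lebesgue_on {x<..<1}) * \<phi>'' x \<partial>?M)"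
    by (simp add: mult.commute)
  also have "(\<integral>x. - (\<integral>y. w y \<partial>lebesgue_on {x<..<1}) * \<phi>'' x \<partial>?M) = (\<integral>x. v x * \<phi>'' x \<partial>?M)"
  proof (rule Bochner_Integration.integral_cong_AE)
    have \<phi>m: "\<phi>'' \<in> borel_measurable ?M"
      using \<phi> by (intro continuous_imp_measurable_on_sets_lebesgue) (auto intro: continuous_on_subset)
    \<comment> \<open>Nothing is known a priori about measurability of the primitive of w; its
      product with \<open>\<phi>''\<close> is an inner integral of F and inherits measurability from
      Fubini.\<close>
    have *: "integrable ?M (\<lambda>x. \<integral>y. F (y, x) \<partial>?M)"
      using Fubini_lebesgue_on(2)[OF _ _ II swap_lebesgue_on(1)[OF II II F]] by simp
    show "(\<lambda>x. - (\<integral>y. w y \<partial>lebesgue_on {x<..<1}) * \<phi>'' x) \<in> borel_measurable ?M"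
    proof -
      have "(\<lambda>x. \<integral>y. F (y, x) \<partial>?M) \<in> borel_measurable ?M"
        using * by auto
      then have "(\<lambda>x. \<phi>'' x * (\<integral>y. w y \<partial>lebesgue_on {x<..<1})) \<in> borel_measurable ?M"
        by (rule measurable_cong[THEN iffD1, rotated]) (auto simp: inner2)
      then have "(\<lambda>x. - (\<phi>'' x * (\<integral>y. w y \<partial>lebesgue_on {x<..<1}))) \<in> borel_measurable ?M"
        by (rule borel_measurable_uminus)
      then show ?thesis
        by (simp add: mult.commute)
    qed
    show "(\<lambda>x. v x * \<phi>'' x) \<in> borel_measurable ?M"
      using vm \<phi>m by (rule borel_measurable_times)
    show "AE x in ?M. - (\<integral>y. w y \<partial>lebesgue_on {x<..<1}) * \<phi>'' x = v x * \<phi>'' x"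
      using v by eventually_elim simp
  qed
  finally show ?thesis .
qed

text \<open>For the primitive Y of y, exp(-C t) Y(t) does not increase and starts at 0. Hence Y
  \<le> 0, and y \<le> C Y together with y \<ge> 0 leaves only 0.\<close>

lemma Gronwall_zero:
  fixes y :: "real \<Rightarrow> real"
  assumes y: "continuous_on {0..} y" "\<And>t. 0 \<le> y t" and C: "0 \<le> C"
    and le: "\<And>t. 0 < t \<Longrightarrow> y t \<le> C * (\<integral>s. y s \<partial>lebesgue_on {0<..<t})"
    and t: "0 < t"
  shows "y t = 0"
proof -
  define Y where "Y s = integral {0..s} y" for s
  have cy: "continuous_on {0..t} y"
    using y(1) by (rule continuous_on_subset) auto
  have leb: "(\<integral>r. y r \<partial>lebesgue_on {0<..<s}) = Y s" if "0 < s" for s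
  proof -
    have c: "continuous_on {0..s} y"
      using y(1) by (rule continuous_on_subset) auto
    then have "integrable (lebesgue_on {0..s}) y"
      by (rule continuous_imp_integrable_real)
    then have "integrable (lebesgue_on {0<..<s}) y"
      by (rule integrable_lebesgue_on_subset) auto
    then have "(y has_integral (\<integral>r. y r \<partial>lebesgue_on {0<..<s})) {0<..<s}"
      by (rule has_integral_integral_lebesgue_on) simp
    then have "(y has_integral (\<integral>r. y r \<partial>lebesgue_on {0<..<s})) {0..s}"
      by (simp add: has_integral_Icc_iff_Ioo)
    then show ?thesis
      by (simp add: Y_def integral_unique)
  qed
  have dY: "(Y has_real_derivative y s) (at s)" if s: "0 < s" "s < t" for s
  proof -
    have "(Y has_vector_derivative y s) (at s within {0..t})"
      unfolding Y_def using s by (intro integral_has_vector_derivative cy) auto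
    then have "(Y has_vector_derivative y s) (at s)"
      using s by (simp add: at_within_Icc_at)
    then show ?thesis
      by (simp add: has_real_derivative_iff_has_vector_derivative)
  qed
  have "exp (- C * t) * Y t \<le> exp (- C * 0) * Y 0"
  proof (rule DERIV_nonpos_imp_decreasing_open[where f = "\<lambda>s. exp (- C * s) * Y s" and a = 0 and b = t])
    show "continuous_on {0..t} (\<lambda>s. exp (- C * s) * Y s)"
      unfolding Y_def using cy
      by (intro continuous_intros indefinite_integral_continuous_1 integrable_continuous_real)
    fix s assume s: "0 < s" "s < t"
    have "((\<lambda>s. exp (- C * s) * Y s) has_real_derivative exp (- C * s) * (y s - C * Y s)) (at s)"
      using dY[OF s] by (auto intro!: derivative_eq_intros simp: algebra_simps)
    moreover have "exp (- C * s) * (y s - C * Y s) \<le> 0"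
      using le[OF s(1)] leb[OF s(1)] by (intro mult_nonneg_nonpos) auto
    ultimately show "\<exists>d. ((\<lambda>s. exp (- C * s) * Y s) has_real_derivative d) (at s) \<and> d \<le> 0"
      by blast
  qed (use t in auto)
  then have "Y t \<le> 0"
    by (simp add: Y_def mult_le_0_iff)
  then have "C * Y t \<le> 0"
    using C by (simp add: mult_nonneg_nonpos)
  then show ?thesis
    using le[OF t] leb[OF t] y(2)[of t] by simp
qed

section \<open>Comparison principle by duality\<close>

lemma continuous_on_reverse:
  fixes g :: "real \<Rightarrow> real \<Rightarrow> real"
  assumes "continuous_on UNIV (\<lambda>(t, x). g t x)"
  shows "continuous_on UNIV (\<lambda>z. g (T - fst z) (snd z))"
proof -
  have "continuous_on UNIV (\<lambda>z :: real \<times> real. (T - fst z, snd z))"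
    by (intro continuous_intros)
  then have "continuous_on UNIV ((\<lambda>(t, x). g t x) \<circ> (\<lambda>z. (T - fst z, snd z)))"
    using assms by (intro continuous_on_compose) (auto intro: continuous_on_subset)
  then show ?thesis
    by (simp add: o_def)
qed

lemma continuous_on_slice:
  fixes g :: "real \<Rightarrow> real \<Rightarrow> real"
  assumes "continuous_on UNIV (\<lambda>(t, x). g t x)"
  shows "continuous_on UNIV (g t)" and "continuous_on UNIV (\<lambda>t. g t x)"
proof -
  have "continuous_on UNIV ((\<lambda>(t, x). g t x) \<circ> (\<lambda>x. (t, x)))"
    using assms by (intro continuous_on_compose continuous_intros) (auto intro: continuous_on_subset)
  then show "continuous_on UNIV (g t)"
    by (simp add: o_def)
  have "continuous_on UNIV ((\<lambda>(t, x). g t x) \<circ> (\<lambda>t. (t, x)))"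
    using assms by (intro continuous_on_compose continuous_intros) (auto intro: continuous_on_subset)
  then show "continuous_on UNIV (\<lambda>t. g t x)"
    by (simp add: o_def)
qed

lemma deriv_reverse: "((\<lambda>t. T - t) has_real_derivative - 1) (at t within S)"
  by (auto intro!: derivative_eq_intros)

lemma AE_lebesgue_on_subset:
  assumes "AE x in lebesgue_on T. P x" "S \<subseteq> T" "S \<in> sets lebesgue" "T \<in> sets lebesgue"
  shows "AE x in lebesgue_on S. P x"
  using assms by (auto simp: AE_restrict_space_iff)

lemma cylinder_lebesgue [simp]:
  "{0<..<T::real} \<times> {0<..<1::real} \<in> sets lebesgue"
  "{0<..<1::real} \<times> {0<..<T::real} \<in> sets lebesgue"
  "{0<..} \<times> {0<..<1::real} \<in> sets (lebesgue :: (real \<times> real) measure)"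
  by (intro sets_completionI_sets; simp add: borel_open open_Times)+

lemma bounded_cylinder [simp]: "bounded ({0<..<T::real} \<times> {0<..<1::real})"
  by (simp add: bounded_Times)

lemma cylinder_lmeasurable [simp]: "{0<..<T::real} \<times> {0<..<1::real} \<in> lmeasurable"
  by (simp add: bounded_set_imp_lmeasurable)

text \<open>The time derivative of \<Phi>(T - t) is integrated over (0, T) and rewritten by the heat
  equation. All spatial derivatives stay on \<Phi>, so continuity of W suffices; this is the
  counterpart of \<open>weak_dual\<close> for a function constant in time.\<close>

lemma stationary_dual:
  assumes c: "caloric \<omega> \<Phi> \<Phi>t \<Phi>x \<Phi>xx" and W: "continuous_on UNIV W" and T: "0 < T"
  shows "(\<integral>x. W x * \<Phi> 0 x \<partial>lebesgue_on {0<..<1}) - (\<integral>x. W x * \<Phi> T x \<partial>lebesgue_on {0<..<1}) =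
    (\<integral>t. \<integral>x. W x * (\<omega>\<^sup>2 * \<Phi> (T - t) x - \<Phi>xx (T - t) x) \<partial>lebesgue_on {0<..<1} \<partial>lebesgue_on {0<..<T})"
proof -
  let ?M = "lebesgue_on {0<..<1::real}"
  have c\<Phi>: "continuous_on UNIV (\<lambda>(t, x). \<Phi> t x)" and c\<Phi>t: "continuous_on UNIV (\<lambda>(t, x). \<Phi>t t x)"
    and dt: "\<And>t x. ((\<lambda>s. \<Phi> s x) has_real_derivative \<Phi>t t x) (at t)"
    and heat: "\<And>t x. \<Phi>t t x = \<Phi>xx t x - \<omega>\<^sup>2 * \<Phi> t x"
    using c by (auto simp: caloric_def)
  have iW: "integrable ?M (\<lambda>x. W x * \<Phi> t x)" for t
    by (intro integrable_continuous_lebesgue_on continuous_on_mult W continuous_on_slice c\<Phi>) auto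
  define F where "F z = W (snd z) * - \<Phi>t (T - fst z) (snd z)" for z
  have "continuous_on UNIV F"
    unfolding F_def[abs_def]
    by (intro continuous_on_mult continuous_on_minus continuous_on_reverse c\<Phi>t
        continuous_on_compose2[OF W] continuous_on_snd continuous_on_id) auto
  then have F: "integrable (lebesgue_on ({0<..<T} \<times> {0<..<1})) F"
    by (intro integrable_continuous_lebesgue_on) auto
  have inner: "(\<integral>t. F (t, x) \<partial>lebesgue_on {0<..<T}) = W x * \<Phi> 0 x - W x * \<Phi> T x" for x
  proof -
    have "(\<integral>t. - \<Phi>t (T - t) x \<partial>lebesgue_on {0<..<T}) = \<Phi> (T - T) x - \<Phi> (T - 0) x"
    proof (rule integral_FTC_lebesgue_on)
      show "((\<lambda>t. \<Phi> (T - t) x) has_real_derivative - \<Phi>t (T - t) x) (at t)" for t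
        using DERIV_chain2[OF dt deriv_reverse] by simp
      show "continuous_on UNIV (\<lambda>t. - \<Phi>t (T - t) x)"
        by (intro continuous_on_minus continuous_on_compose2[OF continuous_on_slice(2)[OF c\<Phi>t]]
            continuous_intros) auto
    qed (use T in auto)
    then show ?thesis
      by (simp add: F_def algebra_simps)
  qed
  have "(\<integral>x. W x * \<Phi> 0 x \<partial>?M) - (\<integral>x. W x * \<Phi> T x \<partial>?M) = (\<integral>x. \<integral>t. F (t, x) \<partial>lebesgue_on {0<..<T} \<partial>?M)"
    unfolding inner using iW by simp
  also have "\<dots> = (\<integral>t. \<integral>x. F (t, x) \<partial>?M \<partial>lebesgue_on {0<..<T})"
    by (rule iterated_integral_swap[symmetric]) (use F in auto)
  finally show ?thesis
    by (simp add: F_def heat)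
qed

text \<open>The sign \<open>\<sigma>\<close> treats the bound by a supersolution \<open>W\<close> and by a subsolution \<open>W\<close> at once.\<close>

locale comparison_setting =
  fixes \<omega> lam \<sigma> C K B :: real and u0 W q :: "real \<Rightarrow> real" and u ux h :: "real \<Rightarrow> real \<Rightarrow> real"
  assumes \<omega>: "0 < \<omega>" and C: "0 \<le> C"
    and u0: "integrable (lebesgue_on {0<..<1}) u0"
    and u_slice: "\<And>t. 0 \<le> t \<Longrightarrow> in_L2 {0<..<1} (u t)"
    and u_init: "AE x in lebesgue_on {0<..<1}. u 0 x = u0 x"
    and u_cont: "\<And>s. 0 \<le> s \<Longrightarrow> ((\<lambda>t. L2_norm01 (\<lambda>x. u t x - u s x)) \<longlongrightarrow> 0) (at s within {0..})"
    and u_L2: "\<And>T. 0 < T \<Longrightarrow> in_L2 ({0<..<T} \<times> {0<..<1}) (\<lambda>(t, x). u t x)"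
    and ux_L2: "\<And>T. 0 < T \<Longrightarrow> in_L2 ({0<..<T} \<times> {0<..<1}) (\<lambda>(t, x). ux t x)"
    and u_V: "AE t in lebesgue_on {0<..}. in_V_with_deriv (u t) (ux t)"
    and h: "(\<lambda>(t, x). h t x) \<in> borel_measurable (lebesgue_on ({0<..} \<times> {0<..<1}))"
      "AE (t, x) in lebesgue_on ({0<..} \<times> {0<..<1}). \<bar>h t x\<bar> \<le> K"
    and weak: "\<And>T \<phi> \<phi>t \<phi>x. 0 < T \<Longrightarrow> test_function T \<phi> \<phi>t \<phi>x \<Longrightarrow>
           (\<integral>x. u T x * \<phi> T x \<partial>lebesgue_on {0<..<1}) - (\<integral>x. u0 x * \<phi> 0 x \<partial>lebesgue_on {0<..<1})
           + (\<integral>(t, x). - u t x * \<phi>t t x + ux t x * \<phi>x t x + \<omega>\<^sup>2 * u t x * \<phi> t x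
                \<partial>lebesgue_on ({0<..<T} \<times> {0<..<1}))
           = lam * (\<integral>(t, x). h t x * \<phi> t x \<partial>lebesgue_on ({0<..<T} \<times> {0<..<1}))"
    and W: "continuous_on UNIV W"
    and q: "q \<in> borel_measurable borel" "\<And>x. \<bar>q x\<bar> \<le> B"
    and init: "AE x in lebesgue_on {0<..<1}. \<sigma> * (u0 x - W x) \<le> 0"
    and super: "\<And>\<phi> \<phi>' \<phi>''. (\<And>x. (\<phi> has_real_derivative \<phi>' x) (at x)) \<Longrightarrow>
        (\<And>x. (\<phi>' has_real_derivative \<phi>'' x) (at x)) \<Longrightarrow> continuous_on UNIV \<phi>'' \<Longrightarrow>
        (\<And>x. x \<in> {0..1} \<Longrightarrow> 0 \<le> \<phi> x) \<Longrightarrow> \<phi> 1 = 0 \<Longrightarrow> \<phi>' 0 = 0 \<Longrightarrow> \<phi>' 1 \<le> 0 \<Longrightarrow>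
        (\<integral>x. \<sigma> * lam * q x * \<phi> x \<partial>lebesgue_on {0<..<1}) \<le>
        (\<integral>x. \<sigma> * (W x * (\<omega>\<^sup>2 * \<phi> x - \<phi>'' x)) \<partial>lebesgue_on {0<..<1})"
    and react: "AE (t, x) in lebesgue_on ({0<..} \<times> {0<..<1}).
        \<sigma> * lam * (h t x - q x) \<le> C * max 0 (\<sigma> * (u t x - W x))"
begin

text \<open>The weight is the first mode. It dominates every dual function that starts below it, and
  it is positive on (0, 1), so a vanishing excess means a vanishing positive part almost
  everywhere.\<close>

definition excess :: "real \<Rightarrow> real" where
  "excess t = (\<integral>x. max 0 (\<sigma> * (u t x - W x)) * cos (pi / 2 * x) \<partial>lebesgue_on {0<..<1})"

lemma u_slice_integrable: "0 \<le> t \<Longrightarrow> integrable (lebesgue_on {0<..<1}) (u t)"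
  by (intro integrable_in_L2 u_slice) auto

text \<open>For the test function \<Phi>(T - t) the heat equation turns the integrand into
  \<open>ux\<close> \<Phi>x + u \<Phi>xx, whose space integral is 0 at almost every time by the
  integration by parts for V. Only initial, final and source terms remain.\<close>

lemma weak_dual:
  assumes c: "caloric \<omega> \<Phi> \<Phi>t \<Phi>x \<Phi>xx" and T: "0 < T"
  shows "(\<integral>x. u T x * \<Phi> 0 x \<partial>lebesgue_on {0<..<1}) - (\<integral>x. u0 x * \<Phi> T x \<partial>lebesgue_on {0<..<1}) =
    lam * (\<integral>z. h (fst z) (snd z) * \<Phi> (T - fst z) (snd z) \<partial>lebesgue_on ({0<..<T} \<times> {0<..<1}))"
proof -
  let ?Q = "{0<..<T} \<times> {0<..<1::real}"
  let ?M = "lebesgue_on {0<..<1::real}"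
  have dt: "\<And>t x. ((\<lambda>s. \<Phi> s x) has_real_derivative \<Phi>t t x) (at t)"
    and dx: "\<And>t x. (\<Phi> t has_real_derivative \<Phi>x t x) (at x)"
    and dxx: "\<And>t x. (\<Phi>x t has_real_derivative \<Phi>xx t x) (at x)"
    and cts: "continuous_on UNIV (\<lambda>(t, x). \<Phi> t x)" "continuous_on UNIV (\<lambda>(t, x). \<Phi>t t x)"
      "continuous_on UNIV (\<lambda>(t, x). \<Phi>x t x)" "continuous_on UNIV (\<lambda>(t, x). \<Phi>xx t x)"
    and heat: "\<And>t x. \<Phi>t t x = \<Phi>xx t x - \<omega>\<^sup>2 * \<Phi> t x"
    and bc: "\<And>t. \<Phi> t 1 = 0" "\<And>t. \<Phi>x t 0 = 0"
    using c by (auto simp: caloric_def)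
  have test: "test_function T (\<lambda>t. \<Phi> (T - t)) (\<lambda>t x. - \<Phi>t (T - t) x) (\<lambda>t. \<Phi>x (T - t))"
    unfolding test_function_def
  proof (intro conjI ballI)
    fix t x
    show "((\<lambda>s. \<Phi> (T - s) x) has_real_derivative - \<Phi>t (T - t) x) (at t within {0..T})"
      using DERIV_chain2[OF dt deriv_reverse] by simp
    show "((\<lambda>y. \<Phi> (T - t) y) has_real_derivative \<Phi>x (T - t) x) (at x within {0..1})"
      using dx by (rule has_field_derivative_at_within)
    show "\<Phi> (T - t) 1 = 0"
      by (rule bc)
  next
    show "continuous_on ({0..T} \<times> {0..1}) (\<lambda>(t, x). - \<Phi>t (T - t) x)"
      using continuous_on_minus[OF continuous_on_reverse[OF cts(2), of T]]
      by (auto simp: case_prod_beta intro: continuous_on_subset)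
    show "continuous_on ({0..T} \<times> {0..1}) (\<lambda>(t, x). \<Phi>x (T - t) x)"
      using continuous_on_reverse[OF cts(3), of T]
      by (auto simp: case_prod_beta intro: continuous_on_subset)
  qed
  define F where "F z = ux (fst z) (snd z) * \<Phi>x (T - fst z) (snd z) +
      u (fst z) (snd z) * \<Phi>xx (T - fst z) (snd z)" for z
  have iu: "integrable (lebesgue_on ?Q) (\<lambda>z. u (fst z) (snd z))"
    using integrable_in_L2[OF u_L2[OF T]] by (simp add: case_prod_unfold)
  have iux: "integrable (lebesgue_on ?Q) (\<lambda>z. ux (fst z) (snd z))"
    using integrable_in_L2[OF ux_L2[OF T]] by (simp add: case_prod_unfold)
  have F: "integrable (lebesgue_on ?Q) F"
    unfolding F_def
    by (intro Bochner_Integration.integrable_add integrable_mult_continuous iu iux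
        continuous_on_reverse cts) auto
  have "(\<integral>(t, x). - u t x * - \<Phi>t (T - t) x + ux t x * \<Phi>x (T - t) x + \<omega>\<^sup>2 * u t x * \<Phi> (T - t) x
      \<partial>lebesgue_on ?Q) = (\<integral>z. F z \<partial>lebesgue_on ?Q)"
    by (rule Bochner_Integration.integral_cong) (auto simp: F_def heat algebra_simps)
  also have "\<dots> = (\<integral>t. \<integral>x. F (t, x) \<partial>?M \<partial>lebesgue_on {0<..<T})"
    by (rule Fubini_lebesgue_on(3)[symmetric]) (use F in auto)
  also have "\<dots> = 0"
  proof (rule integral_eq_zero_AE)
    have "AE t in lebesgue_on {0<..<T}. in_V_with_deriv (u t) (ux t)"
      using u_V by (rule AE_lebesgue_on_subset) auto
    moreover have "AE t in lebesgue_on {0<..<T}. 0 < t"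
      by (rule AE_I2) auto
    ultimately show "AE t in lebesgue_on {0<..<T}. (\<integral>x. F (t, x) \<partial>?M) = 0"
    proof eventually_elim
      case (elim t)
      have "integrable ?M (ux t)"
        using elim unfolding in_V_with_deriv_def by (intro integrable_in_L2) auto
      then have "integrable ?M (\<lambda>x. ux t x * \<Phi>x (T - t) x)"
        by (intro integrable_mult_continuous continuous_on_slice cts) auto
      moreover have "integrable ?M (\<lambda>x. u t x * \<Phi>xx (T - t) x)"
        using elim by (intro integrable_mult_continuous u_slice_integrable continuous_on_slice cts) auto
      ultimately have "(\<integral>x. F (t, x) \<partial>?M) =
          (\<integral>x. ux t x * \<Phi>x (T - t) x \<partial>?M) + (\<integral>x. u t x * \<Phi>xx (T - t) x \<partial>?M)"
        by (simp add: F_def)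
      moreover have "u t \<in> borel_measurable ?M"
        using u_slice_integrable[of t] elim by auto
      then have "(\<integral>x. ux t x * \<Phi>x (T - t) x \<partial>?M) = - (\<integral>x. u t x * \<Phi>xx (T - t) x \<partial>?M)"
        by (intro in_V_integral_by_parts elim dxx bc continuous_on_slice cts)
      ultimately show ?case
        by simp
    qed
  qed
  finally show ?thesis
    using weak[OF T test] by (simp add: case_prod_unfold)
qed

text \<open>Subtract the stationary identity for W from \<open>weak_dual\<close>. The initial term
  is at most 0 by \<open>init\<close>, the inequality \<open>super\<close> replaces W by its source
  q, and \<open>react\<close> bounds what is left of the sources by the positive part.\<close>

lemma duality_estimate:
  assumes c: "caloric \<omega> \<Phi> \<Phi>t \<Phi>x \<Phi>xx" and T: "0 < T"
    and \<Phi>: "\<And>t x. 0 \<le> t \<Longrightarrow> x \<in> {0..1} \<Longrightarrow> 0 \<le> \<Phi> t x \<and> \<Phi> t x \<le> cos (pi / 2 * x)"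
  shows "(\<integral>x. \<sigma> * (u T x - W x) * \<Phi> 0 x \<partial>lebesgue_on {0<..<1}) \<le>
    C * (\<integral>t. excess t \<partial>lebesgue_on {0<..<T})"
proof -
  let ?Q = "{0<..<T} \<times> {0<..<1::real}"
  let ?M = "lebesgue_on {0<..<1::real}"
  let ?L = "lebesgue_on ?Q"
  let ?N = "lebesgue_on {0<..<T}"
  define P where "P z = \<Phi> (T - fst z) (snd z)" for z
  define c1 where "c1 x = cos (pi / 2 * x)" for x :: real
  have dx: "\<And>t x. (\<Phi> t has_real_derivative \<Phi>x t x) (at x)"
    and dxx: "\<And>t x. (\<Phi>x t has_real_derivative \<Phi>xx t x) (at x)"
    and cts: "continuous_on UNIV (\<lambda>(t, x). \<Phi> t x)" "continuous_on UNIV (\<lambda>(t, x). \<Phi>xx t x)"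
    and bc: "\<And>t. \<Phi> t 1 = 0" "\<And>t. \<Phi>x t 0 = 0"
    using c by (auto simp: caloric_def)
  have P: "continuous_on UNIV P"
    unfolding P_def[abs_def] by (intro continuous_on_reverse cts)
  have Pb: "0 \<le> P z" "P z \<le> c1 (snd z)" if "z \<in> ?Q" for z
    using \<Phi>[of "T - fst z" "snd z"] that by (auto simp: P_def c1_def)
  have sub: "?Q \<subseteq> {0<..} \<times> {0<..<1}"
    by auto
  have hb: "AE z in ?L. \<bar>h (fst z) (snd z)\<bar> \<le> K"
    using AE_lebesgue_on_subset[OF h(2) sub] by (simp add: case_prod_beta)
  have "(\<lambda>(t, x). h t x) \<in> borel_measurable ?L"
    using h(1) sub by (rule measurable_restrict_mono)
  then have hm: "(\<lambda>z. h (fst z) (snd z)) \<in> borel_measurable ?L"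
    by (simp add: case_prod_unfold)
  have fin: "finite_measure ?L"
    by (rule finite_measure_lebesgue_on[OF cylinder_lmeasurable])
  have ih: "integrable ?L (\<lambda>z. h (fst z) (snd z))"
    by (rule finite_measure.integrable_const_bound[OF fin _ hm, of K]) (use hb in simp)
  have "snd \<in> borel \<rightarrow>\<^sub>M (borel :: real measure)"
    by (intro borel_measurable_continuous_onI continuous_on_snd continuous_on_id)
  then have "(\<lambda>z. q (snd z)) \<in> borel_measurable (lborel :: (real \<times> real) measure)"
    using measurable_compose[of snd borel borel q borel] q(1) by simp
  then have "(\<lambda>z. q (snd z)) \<in> borel_measurable (lebesgue :: (real \<times> real) measure)"
    by (rule measurable_completion)
  then have qm: "(\<lambda>z. q (snd z)) \<in> borel_measurable ?L"
    by (rule measurable_restrict_space1)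
  have iq: "integrable ?L (\<lambda>z. q (snd z))"
    by (rule finite_measure.integrable_const_bound[OF fin _ qm, of B]) (use q(2) in simp)
  have iu: "integrable ?L (\<lambda>z. u (fst z) (snd z))"
    using integrable_in_L2[OF u_L2[OF T]] by (simp add: case_prod_unfold)
  have Ws: "continuous_on UNIV (\<lambda>z :: real \<times> real. W (snd z))"
    by (rule continuous_on_compose2[OF W]) (auto intro: continuous_intros)
  have iWs: "integrable ?L (\<lambda>z. W (snd z))"
    by (rule integrable_continuous_lebesgue_on[OF bounded_cylinder cylinder_lebesgue(1) Ws])
  have iw: "integrable ?L (\<lambda>z. max 0 (\<sigma> * (u (fst z) (snd z) - W (snd z))))"
    by (intro integrable_max integrable_mult_right Bochner_Integration.integrable_diff iu
        iWs Bochner_Integration.integrable_zero)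
  have c1: "continuous_on UNIV (\<lambda>z :: real \<times> real. c1 (snd z))"
    unfolding c1_def by (intro continuous_intros)
  have hP: "integrable ?L (\<lambda>z. h (fst z) (snd z) * P z)"
    and qP: "integrable ?L (\<lambda>z. q (snd z) * P z)"
    and wc: "integrable ?L (\<lambda>z. max 0 (\<sigma> * (u (fst z) (snd z) - W (snd z))) * c1 (snd z))"
    by (rule integrable_mult_continuous[OF bounded_cylinder cylinder_lebesgue(1)], fact+)+
  have slice: "integrable ?M (\<lambda>x. v x * \<Phi> t x)" if "integrable ?M v" for v t
    using that by (intro integrable_mult_continuous continuous_on_slice cts) auto
  have W1: "integrable ?M W"
    by (intro integrable_continuous_lebesgue_on W) auto
  have uT: "integrable ?M (u T)"
    using T by (intro u_slice_integrable) simp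
  have init0: "0 \<le> (\<integral>x. \<sigma> * (W x * \<Phi> T x) - \<sigma> * (u0 x * \<Phi> T x) \<partial>?M)"
  proof (rule integral_nonneg_AE)
    have "AE x in ?M. x \<in> {0<..<1}"
      by (rule AE_I2) auto
    with init show "AE x in ?M. 0 \<le> \<sigma> * (W x * \<Phi> T x) - \<sigma> * (u0 x * \<Phi> T x)"
    proof eventually_elim
      case (elim x)
      have "\<sigma> * (u0 x - W x) * \<Phi> T x \<le> 0"
        using \<Phi>[of T x] T elim(2) by (intro mult_nonpos_nonneg elim(1)) auto
      then show ?case
        by (simp add: algebra_simps)
    qed
  qed
  \<comment> \<open>Every slice \<Phi>(T - t) is admissible in \<open>super\<close>; integrating
    over t and applying \<open>stationary_dual\<close> turns the right side into the difference of
    the two endpoint terms.\<close>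
  have stat: "(\<integral>z. \<sigma> * lam * (q (snd z) * P z) \<partial>?L) \<le>
      \<sigma> * ((\<integral>x. W x * \<Phi> 0 x \<partial>?M) - (\<integral>x. W x * \<Phi> T x \<partial>?M))"
  proof -
    define G where "G z = W (snd z) * (\<omega>\<^sup>2 * \<Phi> (T - fst z) (snd z) - \<Phi>xx (T - fst z) (snd z))" for z
    have "continuous_on UNIV G"
      unfolding G_def[abs_def]
      by (intro continuous_on_mult Ws continuous_on_diff continuous_on_const continuous_on_reverse cts)
    then have G: "integrable ?L (\<lambda>z. \<sigma> * G z)"
      by (intro integrable_continuous_lebesgue_on integrable_mult_right) auto
    have qP': "integrable ?L (\<lambda>z. \<sigma> * lam * (q (snd z) * P z))"
      using qP by (rule integrable_mult_right)
    have "(\<integral>z. \<sigma> * lam * (q (snd z) * P z) \<partial>?L) =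
        (\<integral>t. \<integral>x. \<sigma> * lam * (q (snd (t, x)) * P (t, x)) \<partial>?M \<partial>?N)"
      by (rule Fubini_lebesgue_on(3)[symmetric]) (use qP' in auto)
    also have "\<dots> \<le> (\<integral>t. \<integral>x. \<sigma> * G (t, x) \<partial>?M \<partial>?N)"
    proof (rule integral_mono)
      show "integrable ?N (\<lambda>t. \<integral>x. \<sigma> * lam * (q (snd (t, x)) * P (t, x)) \<partial>?M)"
        by (rule Fubini_lebesgue_on(2)) (use qP' in auto)
      show "integrable ?N (\<lambda>t. \<integral>x. \<sigma> * G (t, x) \<partial>?M)"
        by (rule Fubini_lebesgue_on(2)) (use G in auto)
      fix t assume "t \<in> space ?N"
      then have t: "0 < t" "t < T" by auto
      have "(\<integral>x. \<sigma> * lam * q x * \<Phi> (T - t) x \<partial>?M) \<le>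
          (\<integral>x. \<sigma> * (W x * (\<omega>\<^sup>2 * \<Phi> (T - t) x - \<Phi>xx (T - t) x)) \<partial>?M)"
      proof (rule super[where \<phi> = "\<Phi> (T - t)" and \<phi>' = "\<Phi>x (T - t)" and \<phi>'' = "\<Phi>xx (T - t)"])
        show "\<Phi>x (T - t) 1 \<le> 0"
          using t \<Phi>[of "T - t"] by (intro caloric_boundary_slope[OF \<omega> c]) auto
        show "continuous_on UNIV (\<Phi>xx (T - t))"
          by (rule continuous_on_slice(1)[OF cts(2)])
      qed (use t \<Phi>[of "T - t"] dx dxx bc in auto)
      then show "(\<integral>x. \<sigma> * lam * (q (snd (t, x)) * P (t, x)) \<partial>?M) \<le> (\<integral>x. \<sigma> * G (t, x) \<partial>?M)"
        by (simp add: P_def G_def mult.assoc)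
    qed
    also have "\<dots> = \<sigma> * (\<integral>t. \<integral>x. G (t, x) \<partial>?M \<partial>?N)"
      by simp
    also have "\<dots> = \<sigma> * ((\<integral>x. W x * \<Phi> 0 x \<partial>?M) - (\<integral>x. W x * \<Phi> T x \<partial>?M))"
      by (simp add: stationary_dual[OF c W T] G_def)
    finally show ?thesis .
  qed
  have "(\<integral>x. \<sigma> * (u T x - W x) * \<Phi> 0 x \<partial>?M) =
      (\<integral>x. \<sigma> * (u T x * \<Phi> 0 x) - \<sigma> * (W x * \<Phi> 0 x) \<partial>?M)"
    by (rule Bochner_Integration.integral_cong) (auto simp: algebra_simps)
  also have "\<dots> = \<sigma> * (\<integral>x. u T x * \<Phi> 0 x \<partial>?M) - \<sigma> * (\<integral>x. W x * \<Phi> 0 x \<partial>?M)"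
    using slice[OF uT] slice[OF W1] by simp
  also have "\<dots> \<le> \<sigma> * (lam * (\<integral>z. h (fst z) (snd z) * P z \<partial>?L)) - (\<integral>z. \<sigma> * lam * (q (snd z) * P z) \<partial>?L)"
  proof -
    have "\<sigma> * (\<integral>x. u0 x * \<Phi> T x \<partial>?M) - \<sigma> * (\<integral>x. W x * \<Phi> T x \<partial>?M) \<le> 0"
      using init0 slice[OF u0] slice[OF W1] by simp
    moreover have "(\<integral>x. u T x * \<Phi> 0 x \<partial>?M) = (\<integral>x. u0 x * \<Phi> T x \<partial>?M)
        + lam * (\<integral>z. h (fst z) (snd z) * P z \<partial>?L)"
      using weak_dual[OF c T] by (simp add: P_def)
    then have "\<sigma> * (\<integral>x. u T x * \<Phi> 0 x \<partial>?M) = \<sigma> * (\<integral>x. u0 x * \<Phi> T x \<partial>?M)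
        + \<sigma> * (lam * (\<integral>z. h (fst z) (snd z) * P z \<partial>?L))"
      by (simp only: distrib_left)
    ultimately show ?thesis
      using stat unfolding right_diff_distrib[of \<sigma> "\<integral>x. W x * \<Phi> 0 x \<partial>?M"] by linarith
  qed
  also have "\<dots> = (\<integral>z. \<sigma> * lam * (h (fst z) (snd z) * P z) - \<sigma> * lam * (q (snd z) * P z) \<partial>?L)"
    using hP qP by simp
  also have "\<dots> \<le> (\<integral>z. C * (max 0 (\<sigma> * (u (fst z) (snd z) - W (snd z))) * c1 (snd z)) \<partial>?L)"
  proof (rule integral_mono_AE)
    show "integrable ?L (\<lambda>z. \<sigma> * lam * (h (fst z) (snd z) * P z) - \<sigma> * lam * (q (snd z) * P z))"
      using hP qP by (intro Bochner_Integration.integrable_diff integrable_mult_right)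
    show "integrable ?L (\<lambda>z. C * (max 0 (\<sigma> * (u (fst z) (snd z) - W (snd z))) * c1 (snd z)))"
      using wc by (rule integrable_mult_right)
    have "AE z in ?L. \<sigma> * lam * (h (fst z) (snd z) - q (snd z)) \<le> C * max 0 (\<sigma> * (u (fst z) (snd z) - W (snd z)))"
      using AE_lebesgue_on_subset[OF react sub] by (simp add: case_prod_beta)
    moreover have "AE z in ?L. z \<in> ?Q"
      by (rule AE_I2) auto
    ultimately show "AE z in ?L. \<sigma> * lam * (h (fst z) (snd z) * P z) - \<sigma> * lam * (q (snd z) * P z)
        \<le> C * (max 0 (\<sigma> * (u (fst z) (snd z) - W (snd z))) * c1 (snd z))"
    proof eventually_elim
      case (elim z)
      define m where "m = C * max 0 (\<sigma> * (u (fst z) (snd z) - W (snd z)))"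
      have "m \<ge> 0"
        using C by (simp add: m_def)
      \<comment> \<open>The bound on h - q is one-sided, so it is first multiplied by P \<ge> 0; P
        may be enlarged to the cosine only once the nonnegative majorant m stands in front of
        it.\<close>
      have "\<sigma> * lam * (h (fst z) (snd z) - q (snd z)) * P z \<le> m * P z"
        using elim Pb[of z] by (intro mult_right_mono) (auto simp: m_def)
      also have "\<dots> \<le> m * c1 (snd z)"
        using elim Pb[of z] \<open>m \<ge> 0\<close> by (intro mult_left_mono) auto
      finally show ?case
        by (simp add: m_def algebra_simps)
    qed
  qed
  also have "\<dots> = C * (\<integral>t. excess t \<partial>?N)"
    using Fubini_lebesgue_on(3)[OF _ _ _ wc] by (simp add: excess_def c1_def)
  finally show ?thesis .
qed

end

section \<open>Approximation of indicators by the cosine span\<close>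

lemma arccos_sqrt_cos2:
  assumes "x \<in> {0..1}"
  shows "2 / pi * arccos (sqrt ((cos (pi / 2 * x))\<^sup>2)) = x"
proof -
  have "pi / 2 * x \<le> pi"
    using assms mult_mono[of "pi / 2" pi x 1] by auto
  then have "arccos (cos (pi / 2 * x)) = pi / 2 * x"
    using assms by (intro arccos_cos) auto
  with cos_quarter_nonneg[OF assms] show ?thesis
    by (simp only: real_sqrt_abs abs_of_nonneg) simp
qed

text \<open>A measurable indicator is an almost everywhere limit of continuous functions, and each
  of these is approximated uniformly after the substitution. Bernstein polynomials keep the bounds 0
  and 1 exactly, because they are averages of sampled values; a mere uniform approximation could
  violate the ordering between 0 and the cosine that the maximum principle needs.\<close>

lemma cosine_span_approx_indicator:
  assumes "A \<in> sets lebesgue"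
  obtains q :: "nat \<Rightarrow> real \<Rightarrow> real" where
    "\<And>n. (\<lambda>x. cos (pi / 2 * x) * q n x) \<in> cosine_span"
    "\<And>n x. x \<in> {0..1} \<Longrightarrow> 0 \<le> q n x \<and> q n x \<le> 1"
    "AE x in lebesgue_on {0<..<1}. (\<lambda>n. q n x) \<longlonglongrightarrow> indicat_real A x"
proof -
  have "indicat_real A \<in> borel_measurable lebesgue"
    using assms by (rule borel_measurable_indicator)
  then have "indicat_real A measurable_on UNIV"
    by (rule lebesgue_measurable_imp_measurable_on) simp
  then obtain N g where N: "negligible N" and g: "\<And>n. continuous_on UNIV (g n)"
    and lim: "\<And>x. x \<notin> N \<Longrightarrow> (\<lambda>n. g n x) \<longlonglongrightarrow> indicat_real A x"
    unfolding measurable_on_def by auto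
  \<comment> \<open>Truncation puts the continuous approximants into [0, 1] and leaves their limit,
    an indicator, unchanged.\<close>
  define G where "G n x = max 0 (min 1 (g n x))" for n :: nat and x :: real
  define f where "f n s = G n (2 / pi * arccos (sqrt s))" for n s
  have G: "continuous_on UNIV (G n)" for n
    unfolding G_def[abs_def] by (intro continuous_intros g)
  have f: "continuous_on {0..1} (f n)" for n
    unfolding f_def[abs_def]
  proof (rule continuous_on_compose2[OF G])
    show "continuous_on {0..1} (\<lambda>s. 2 / pi * arccos (sqrt s))"
      by (intro continuous_intros) (auto intro: order_trans[of _ 0])
  qed auto
  have "\<exists>m. \<forall>s\<in>{0..1}. \<bar>f n s - (\<Sum>k\<le>m. f n (real k / real m) * Bernstein m k s)\<bar> < 1 / real (Suc n)" for n
  proof -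
    have "0 < 1 / real (Suc n)"
      by simp
    from Bernstein_Weierstrass[OF f this] obtain m where "\<forall>k s. m \<le> k \<and> s \<in> {0..1} \<longrightarrow>
        \<bar>f n s - (\<Sum>j\<le>k. f n (real j / real k) * Bernstein k j s)\<bar> < 1 / real (Suc n)"
      by blast
    then show ?thesis
      by (intro exI[of _ m]) blast
  qed
  \<comment> \<open>The degree is chosen separately for each n with error below 1 / (n + 1), so the
    limit in n absorbs the polynomial error.\<close>
  then have "\<exists>m. \<forall>n. \<forall>s\<in>{0..1}.
      \<bar>f n s - (\<Sum>k\<le>m n. f n (real k / real (m n)) * Bernstein (m n) k s)\<bar> < 1 / real (Suc n)"
    by (intro choice allI)
  then obtain m where m: "\<And>n s. s \<in> {0..1} \<Longrightarrow>
      \<bar>f n s - (\<Sum>k\<le>m n. f n (real k / real (m n)) * Bernstein (m n) k s)\<bar> < 1 / real (Suc n)"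
    by blast
  define q where "q n x = (\<Sum>k\<le>m n. f n (real k / real (m n)) * Bernstein (m n) k ((cos (pi / 2 * x))\<^sup>2))" for n x
  have f01: "0 \<le> f n s" "f n s \<le> 1" for n s
    by (auto simp: f_def G_def)
  have c01: "0 \<le> (cos y)\<^sup>2" "(cos y)\<^sup>2 \<le> 1" for y :: real
    by (auto simp: abs_square_le_1)
  show ?thesis
  proof (rule that)
    show "(\<lambda>x. cos (pi / 2 * x) * q n x) \<in> cosine_span" for n
      unfolding q_def by (rule cosine_span_Bernstein)
    show "0 \<le> q n x \<and> q n x \<le> 1" for n x
    proof
      show "0 \<le> q n x"
        unfolding q_def by (intro sum_nonneg mult_nonneg_nonneg f01 Bernstein_nonneg c01)
      have "q n x \<le> (\<Sum>k\<le>m n. Bernstein (m n) k ((cos (pi / 2 * x))\<^sup>2))"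
        unfolding q_def by (intro sum_mono mult_left_le_one_le f01 Bernstein_nonneg c01)
      then show "q n x \<le> 1"
        by simp
    qed
    have conv: "(\<lambda>n. q n x) \<longlonglongrightarrow> indicat_real A x" if x: "x \<in> {0<..<1}" "x \<notin> N" for x
    proof -
      have "(\<lambda>n. G n x) \<longlonglongrightarrow> max 0 (min 1 (indicat_real A x))"
        unfolding G_def by (intro tendsto_intros lim x)
      moreover have "max 0 (min 1 (indicat_real A x)) = indicat_real A x"
        by (simp add: indicator_def)
      moreover have "(\<lambda>n. q n x - G n x) \<longlonglongrightarrow> 0"
      proof (rule Lim_null_comparison)
        show "\<forall>\<^sub>F n in sequentially. norm (q n x - G n x) \<le> 1 / real (Suc n)"
        proof (rule always_eventually, rule allI)
          fix n
          have "f n ((cos (pi / 2 * x))\<^sup>2) = G n x"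
            unfolding f_def using x by (subst arccos_sqrt_cos2) auto
          then show "norm (q n x - G n x) \<le> 1 / real (Suc n)"
            using m[of "(cos (pi / 2 * x))\<^sup>2" n] c01[of "pi / 2 * x"] unfolding q_def by auto
        qed
        show "(\<lambda>n. 1 / real (Suc n)) \<longlonglongrightarrow> 0"
          using LIMSEQ_inverse_real_of_nat by (simp add: inverse_eq_divide)
      qed
      ultimately show ?thesis
        using tendsto_add[of "\<lambda>n. q n x - G n x" 0 sequentially "\<lambda>n. G n x"] by simp
    qed
    have "AE x in lebesgue. x \<notin> N"
      using N by (simp add: AE_not_in negligible_iff_null_sets)
    then show "AE x in lebesgue_on {0<..<1}. (\<lambda>n. q n x) \<longlonglongrightarrow> indicat_real A x"
      using conv by (auto simp: AE_restrict_space_iff)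
  qed
qed

section \<open>From the dual estimate to the vanishing of the excess\<close>

lemma in_L2_diff:
  assumes "in_L2 S f" "in_L2 S g"
  shows "in_L2 S (\<lambda>x. f x - g x)"
  unfolding in_L2_def
proof
  have m: "f \<in> borel_measurable (lebesgue_on S)" "g \<in> borel_measurable (lebesgue_on S)"
    using assms by (auto simp: in_L2_def)
  then show d: "(\<lambda>x. f x - g x) \<in> borel_measurable (lebesgue_on S)"
    by (rule borel_measurable_diff)
  show "integrable (lebesgue_on S) (\<lambda>x. (f x - g x)\<^sup>2)"
  proof (rule Bochner_Integration.integrable_bound)
    show "integrable (lebesgue_on S) (\<lambda>x. 2 * (f x)\<^sup>2 + 2 * (g x)\<^sup>2)"
      using assms by (simp add: in_L2_def)
    show "(\<lambda>x. (f x - g x)\<^sup>2) \<in> borel_measurable (lebesgue_on S)"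
      using d by (rule borel_measurable_power)
    have "(a - b)\<^sup>2 \<le> 2 * a\<^sup>2 + 2 * b\<^sup>2" for a b :: real
      using zero_le_power2[of "a + b"] by (simp add: power2_sum power2_diff)
    then show "AE x in lebesgue_on S. norm ((f x - g x)\<^sup>2) \<le> norm (2 * (f x)\<^sup>2 + 2 * (g x)\<^sup>2)"
      by simp
  qed
qed

text \<open>The interval has measure 1, so this is the nonnegativity of the variance of |v|.\<close>

lemma L1_le_L2_norm01:
  assumes "in_L2 {0<..<1} v"
  shows "(\<integral>x. \<bar>v x\<bar> \<partial>lebesgue_on {0<..<1}) \<le> L2_norm01 v"
proof -
  let ?M = "lebesgue_on {0<..<1::real}"
  define m where "m = (\<integral>x. \<bar>v x\<bar> \<partial>?M)"
  have i: "integrable ?M (\<lambda>x. \<bar>v x\<bar>)"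
    using integrable_in_L2[OF assms] by auto
  have i2: "integrable ?M (\<lambda>x. (v x)\<^sup>2)"
    using assms by (simp add: in_L2_def)
  have "measure ?M (space ?M) = 1"
    by (simp add: measure_restrict_space)
  have "0 \<le> (\<integral>x. (\<bar>v x\<bar> - m)\<^sup>2 \<partial>?M)"
    by (rule integral_nonneg_AE) simp
  also have "\<dots> = (\<integral>x. (v x)\<^sup>2 - 2 * m * \<bar>v x\<bar> + m\<^sup>2 \<partial>?M)"
    by (simp add: power2_diff algebra_simps)
  also have "\<dots> = (\<integral>x. (v x)\<^sup>2 \<partial>?M) - 2 * m * m + m\<^sup>2"
    using i i2 \<open>measure ?M (space ?M) = 1\<close> by (simp add: m_def)
  finally have "m\<^sup>2 \<le> (\<integral>x. (v x)\<^sup>2 \<partial>?M)"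
    by (simp add: power2_eq_square)
  then show ?thesis
    unfolding m_def[symmetric] L2_norm01_def by (rule real_le_rsqrt)
qed

context comparison_setting
begin

lemma diff_integrable: "0 \<le> t \<Longrightarrow> integrable (lebesgue_on {0<..<1}) (\<lambda>x. \<sigma> * (u t x - W x))"
  by (intro integrable_mult_right Bochner_Integration.integrable_diff u_slice_integrable
      integrable_continuous_lebesgue_on W) auto

lemma excess_integrable:
  assumes "0 \<le> t"
  shows "integrable (lebesgue_on {0<..<1}) (\<lambda>x. max 0 (\<sigma> * (u t x - W x)) * cos (pi / 2 * x))"
  by (intro integrable_mult_continuous integrable_max diff_integrable assms
      Bochner_Integration.integrable_zero continuous_intros) auto

lemma excess_nonneg: "0 \<le> excess t"
  unfolding excess_def
  by (rule integral_nonneg_AE, rule AE_I2, intro mult_nonneg_nonneg cos_quarter_nonneg) auto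

text \<open>The ideal initial datum is the cosine times the indicator of the set where \<sigma> (u -
  W) is positive at time T. It need not lie in the span, but \<open>duality_estimate\<close> holds
  for its approximants with a right side that does not depend on n, and dominated convergence passes
  to the limit.\<close>

lemma excess_le:
  assumes T: "0 < T"
  shows "excess T \<le> C * (\<integral>t. excess t \<partial>lebesgue_on {0<..<T})"
proof -
  let ?M = "lebesgue_on {0<..<1::real}"
  define w where "w x = \<sigma> * (u T x - W x)" for x
  define A where "A = {x \<in> {0<..<1}. 0 < w x}"
  have w: "integrable ?M w"
    unfolding w_def using T by (intro diff_integrable) simp
  then have wm: "w \<in> borel_measurable ?M"
    by auto
  then have "{x \<in> space ?M. 0 < w x} \<in> sets ?M"
    by measurable
  then have A: "A \<in> sets lebesgue"
    by (simp add: A_def sets_restrict_space_iff)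
  obtain q where q: "\<And>n. (\<lambda>x. cos (pi / 2 * x) * q n x) \<in> cosine_span"
    "\<And>n x. x \<in> {0..1} \<Longrightarrow> 0 \<le> q n x \<and> q n x \<le> 1"
    "AE x in ?M. (\<lambda>n. q n x) \<longlonglongrightarrow> indicat_real A x"
    using cosine_span_approx_indicator[OF A] by blast
  have bound: "(\<integral>x. w x * (cos (pi / 2 * x) * q n x) \<partial>?M) \<le> C * (\<integral>t. excess t \<partial>lebesgue_on {0<..<T})"
    and cont: "continuous_on UNIV (\<lambda>x. cos (pi / 2 * x) * q n x)" for n
  proof -
    obtain \<Phi> \<Phi>t \<Phi>x \<Phi>xx where c: "caloric \<omega> \<Phi> \<Phi>t \<Phi>x \<Phi>xx"
      and \<Phi>0: "\<Phi> 0 = (\<lambda>x. cos (pi / 2 * x) * q n x)"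
      using caloric_extension[OF q(1)] by blast
    have init: "0 \<le> \<Phi> 0 x \<and> \<Phi> 0 x \<le> cos (pi / 2 * x)" if "x \<in> {0..1}" for x
      using q(2)[OF that, of n] cos_quarter_nonneg[OF that] by (simp add: \<Phi>0 mult_left_le)
    have "(\<integral>x. \<sigma> * (u T x - W x) * \<Phi> 0 x \<partial>?M) \<le> C * (\<integral>t. excess t \<partial>lebesgue_on {0<..<T})"
      using caloric_between[OF \<omega> c init] by (intro duality_estimate[OF c T]) auto
    then show "(\<integral>x. w x * (cos (pi / 2 * x) * q n x) \<partial>?M) \<le> C * (\<integral>t. excess t \<partial>lebesgue_on {0<..<T})"
      by (simp add: w_def \<Phi>0)
    show "continuous_on UNIV (\<lambda>x. cos (pi / 2 * x) * q n x)"
      using continuous_on_slice(1)[of \<Phi> 0] c unfolding \<Phi>0[symmetric] by (simp add: caloric_def)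
  qed
  have "(\<lambda>n. \<integral>x. w x * (cos (pi / 2 * x) * q n x) \<partial>?M) \<longlonglongrightarrow>
      (\<integral>x. max 0 (w x) * cos (pi / 2 * x) \<partial>?M)"
  proof (rule integral_dominated_convergence)
    show "integrable ?M (\<lambda>x. \<bar>w x\<bar>)"
      using w by auto
    show "(\<lambda>x. max 0 (w x) * cos (pi / 2 * x)) \<in> borel_measurable ?M"
      using excess_integrable[of T] T by (auto simp: w_def)
    show "(\<lambda>x. w x * (cos (pi / 2 * x) * q n x)) \<in> borel_measurable ?M" for n
      using integrable_mult_continuous[OF _ _ w cont[of n]] by auto
    have I: "AE x in ?M. x \<in> {0<..<1}"
      by (rule AE_I2) auto
    show "AE x in ?M. (\<lambda>n. w x * (cos (pi / 2 * x) * q n x)) \<longlonglongrightarrow> max 0 (w x) * cos (pi / 2 * x)"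
      using q(3) I
    proof eventually_elim
      case (elim x)
      have "(\<lambda>n. w x * (cos (pi / 2 * x) * q n x)) \<longlonglongrightarrow> w x * (cos (pi / 2 * x) * indicat_real A x)"
        by (intro tendsto_intros elim)
      moreover have "w x * (cos (pi / 2 * x) * indicat_real A x) = max 0 (w x) * cos (pi / 2 * x)"
        using elim by (auto simp: A_def indicator_def)
      ultimately show ?case
        by (simp only:)
    qed
    show "AE x in ?M. norm (w x * (cos (pi / 2 * x) * q n x)) \<le> \<bar>w x\<bar>" for n
      using I
    proof eventually_elim
      case (elim x)
      then have "\<bar>cos (pi / 2 * x) * q n x\<bar> \<le> 1 * 1"
        unfolding abs_mult using q(2)[of x n] by (intro mult_mono) auto
      then show ?case
        by (simp add: abs_mult mult_left_le)
    qed
  qed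
  then have "(\<integral>x. max 0 (w x) * cos (pi / 2 * x) \<partial>?M) \<le> C * (\<integral>t. excess t \<partial>lebesgue_on {0<..<T})"
    using bound by (intro LIMSEQ_le_const2) auto
  then show ?thesis
    by (simp add: excess_def w_def)
qed

text \<open>The positive part is Lipschitz with constant 1 and the weight is at most 1 in modulus,
  so continuity of u in L2 carries over.\<close>

lemma excess_continuous: "continuous_on {0..} excess"
  unfolding continuous_on
proof
  fix s :: real
  let ?M = "lebesgue_on {0<..<1::real}"
  assume "s \<in> {0..}"
  then have s: "0 \<le> s" by simp
  have le: "\<bar>excess t - excess s\<bar> \<le> \<bar>\<sigma>\<bar> * L2_norm01 (\<lambda>x. u t x - u s x)" if t: "0 \<le> t" for t
  proof -
    have L: "in_L2 {0<..<1} (\<lambda>x. u t x - u s x)"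
      by (intro in_L2_diff u_slice s t)
    have i: "integrable ?M (\<lambda>x. u t x - u s x)"
      using L by (rule integrable_in_L2) simp
    have eq: "excess t - excess s = (\<integral>x. max 0 (\<sigma> * (u t x - W x)) * cos (pi / 2 * x)
        - max 0 (\<sigma> * (u s x - W x)) * cos (pi / 2 * x) \<partial>?M)"
      unfolding excess_def using excess_integrable s t by simp
    have "\<bar>excess t - excess s\<bar> \<le> (\<integral>x. \<bar>max 0 (\<sigma> * (u t x - W x)) * cos (pi / 2 * x)
        - max 0 (\<sigma> * (u s x - W x)) * cos (pi / 2 * x)\<bar> \<partial>?M)"
      unfolding eq by (rule integral_abs_bound)
    also have "\<dots> \<le> (\<integral>x. \<bar>\<sigma>\<bar> * \<bar>u t x - u s x\<bar> \<partial>?M)"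
    proof (rule integral_mono)
      show "integrable ?M (\<lambda>x. \<bar>max 0 (\<sigma> * (u t x - W x)) * cos (pi / 2 * x)
        - max 0 (\<sigma> * (u s x - W x)) * cos (pi / 2 * x)\<bar>)"
        by (intro integrable_abs Bochner_Integration.integrable_diff excess_integrable s t)
      show "integrable ?M (\<lambda>x. \<bar>\<sigma>\<bar> * \<bar>u t x - u s x\<bar>)"
        using i by auto
      fix x
      have "\<bar>max 0 (\<sigma> * (u t x - W x)) * cos (pi / 2 * x) - max 0 (\<sigma> * (u s x - W x)) * cos (pi / 2 * x)\<bar> =
          \<bar>max 0 (\<sigma> * (u t x - W x)) - max 0 (\<sigma> * (u s x - W x))\<bar> * \<bar>cos (pi / 2 * x)\<bar>"
        by (simp only: left_diff_distrib[symmetric] abs_mult)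
      also have "\<dots> \<le> \<bar>max 0 (\<sigma> * (u t x - W x)) - max 0 (\<sigma> * (u s x - W x))\<bar>"
        by (intro mult_left_le) auto
      also have "\<dots> \<le> \<bar>\<sigma> * (u t x - W x) - \<sigma> * (u s x - W x)\<bar>"
        by linarith
      also have "\<dots> = \<bar>\<sigma> * (u t x - u s x)\<bar>"
        by (simp add: algebra_simps)
      also have "\<bar>\<sigma> * (u t x - u s x)\<bar> = \<bar>\<sigma>\<bar> * \<bar>u t x - u s x\<bar>"
        by (rule abs_mult)
      finally show "\<bar>max 0 (\<sigma> * (u t x - W x)) * cos (pi / 2 * x) - max 0 (\<sigma> * (u s x - W x)) * cos (pi / 2 * x)\<bar>
          \<le> \<bar>\<sigma>\<bar> * \<bar>u t x - u s x\<bar>" .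
    qed
    also have "\<dots> = \<bar>\<sigma>\<bar> * (\<integral>x. \<bar>u t x - u s x\<bar> \<partial>?M)"
      by simp
    also have "\<dots> \<le> \<bar>\<sigma>\<bar> * L2_norm01 (\<lambda>x. u t x - u s x)"
      by (intro mult_left_mono L1_le_L2_norm01 L) auto
    finally show ?thesis .
  qed
  have "((\<lambda>t. excess t - excess s) \<longlongrightarrow> 0) (at s within {0..})"
  proof (rule Lim_null_comparison)
    show "\<forall>\<^sub>F t in at s within {0..}. norm (excess t - excess s) \<le> \<bar>\<sigma>\<bar> * L2_norm01 (\<lambda>x. u t x - u s x)"
      unfolding eventually_at_filter by (rule always_eventually) (use le in auto)
    show "((\<lambda>t. \<bar>\<sigma>\<bar> * L2_norm01 (\<lambda>x. u t x - u s x)) \<longlongrightarrow> 0) (at s within {0..})"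
      by (rule tendsto_mult_right_zero[OF u_cont[OF s]])
  qed
  then show "(excess \<longlongrightarrow> excess s) (at s within {0..})"
    by (rule LIM_zero_cancel)
qed

lemma comparison:
  assumes "0 \<le> t"
  shows "AE x in lebesgue_on {0<..<1}. \<sigma> * (u t x - W x) \<le> 0"
proof (cases "t = 0")
  \<comment> \<open>Gronwall gives positive times only; at time 0 the initial data are compared
    directly.\<close>
  case True
  show ?thesis
    using u_init init unfolding True by eventually_elim simp
next
  case False
  let ?M = "lebesgue_on {0<..<1::real}"
  have "excess t = 0"
    using assms False
    by (intro Gronwall_zero[OF excess_continuous excess_nonneg C excess_le]) auto
  have I: "AE x in ?M. x \<in> {0<..<1}"
    by (rule AE_I2) auto
  have "AE x in ?M. max 0 (\<sigma> * (u t x - W x)) * cos (pi / 2 * x) = 0"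
  proof (rule integral_nonneg_eq_0_iff_AE[THEN iffD1])
    show "integrable ?M (\<lambda>x. max 0 (\<sigma> * (u t x - W x)) * cos (pi / 2 * x))"
      using assms by (rule excess_integrable)
    show "AE x in ?M. 0 \<le> max 0 (\<sigma> * (u t x - W x)) * cos (pi / 2 * x)"
      using I by eventually_elim (intro mult_nonneg_nonneg cos_quarter_nonneg; auto)
    show "(\<integral>x. max 0 (\<sigma> * (u t x - W x)) * cos (pi / 2 * x) \<partial>?M) = 0"
      using \<open>excess t = 0\<close> by (simp add: excess_def)
  qed
  then show ?thesis
    using I
  proof eventually_elim
    case (elim x)
    have "cos (pi / 2 * x) > 0"
    proof (rule cos_gt_zero_pi)
      show "- (pi / 2) < pi / 2 * x"
        by (rule less_le_trans[of _ 0]) (use elim in auto)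
      show "pi / 2 * x < pi / 2"
        using elim by simp
    qed
    with elim have "max 0 (\<sigma> * (u t x - W x)) = 0"
      by (metis less_irrefl mult_eq_0_iff)
    then show ?case
      by (metis max.cobounded2)
  qed
qed

end

section \<open>Stability\<close>

lemma barrier_mono:
  assumes "0 < \<omega>" "0 \<le> lam" "f0 \<le> 1" "0 \<le> \<xi>1" "\<xi>1 \<le> \<xi>2" "\<xi>2 \<le> 1" "0 \<le> x" "x \<le> 1"
  shows "barrier \<omega> f0 lam \<xi>1 x \<le> barrier \<omega> f0 lam \<xi>2 x"
  unfolding barrier_def using assms by (intro mult_left_mono add_left_mono step_response_mono) auto

lemma two_phase_borel: "two_phase f0 \<xi> \<in> borel_measurable borel"
  unfolding two_phase_def[abs_def] by measurable

lemma two_phase_bound: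
  assumes "0 \<le> f0" "f0 \<le> 1"
  shows "\<bar>two_phase f0 \<xi> x\<bar> \<le> 1"
  using assms by (simp add: two_phase_def)

text \<open>The unshifted barrier gives equality. Since \<sigma> \<sigma> = 1, the shift adds
  \<kappa> times the integral of \<open>\<omega>\<^sup>2 * \<phi> - \<phi>''\<close> for either
  sign, and this is nonnegative because \<phi> \<ge> 0, \<open>\<phi>' 0 = 0\<close> and
  \<open>\<phi>' 1 \<le> 0\<close>.\<close>

lemma barrier_super:
  fixes \<phi> \<phi>' \<phi>'' :: "real \<Rightarrow> real"
  assumes \<xi>: "0 \<le> \<xi>" "\<xi> < 1" and \<omega>: "\<omega> \<noteq> 0" and f0: "0 \<le> f0" "f0 \<le> 1"
    and \<kappa>: "0 \<le> \<kappa>" and \<sigma>: "\<sigma> * \<sigma> = 1"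
    and \<phi>: "\<And>x. (\<phi> has_real_derivative \<phi>' x) (at x)" "\<And>x. (\<phi>' has_real_derivative \<phi>'' x) (at x)"
      "continuous_on UNIV \<phi>''" "\<And>x. x \<in> {0..1} \<Longrightarrow> 0 \<le> \<phi> x"
    and bc: "\<phi> 1 = 0" "\<phi>' 0 = 0" "\<phi>' 1 \<le> 0"
  shows "(\<integral>x. \<sigma> * lam * two_phase f0 \<xi> x * \<phi> x \<partial>lebesgue_on {0<..<1}) \<le>
    (\<integral>x. \<sigma> * ((barrier \<omega> f0 lam \<xi> x + \<sigma> * \<kappa>) * (\<omega>\<^sup>2 * \<phi> x - \<phi>'' x)) \<partial>lebesgue_on {0<..<1})"
proof -
  let ?M = "lebesgue_on {0<..<1::real}"
  let ?V = "barrier \<omega> f0 lam \<xi>"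
  let ?q = "two_phase f0 \<xi>"
  have c: "continuous_on UNIV \<phi>" "continuous_on UNIV (\<lambda>x. \<omega>\<^sup>2 * \<phi> x - \<phi>'' x)"
    using \<phi> by (auto intro!: continuous_intros intro: DERIV_isCont continuous_at_imp_continuous_on)
  have iq: "integrable ?M ?q"
  proof (rule finite_measure.integrable_const_bound[OF finite_measure_lebesgue_on, of _ _ 1])
    show "?q \<in> borel_measurable ?M"
      using two_phase_borel by (intro measurable_restrict_space1 measurable_completion) simp
  qed (use two_phase_bound[OF f0] in auto)
  have i1: "integrable ?M (\<lambda>x. ?V x * (\<omega>\<^sup>2 * \<phi> x - \<phi>'' x))"
    and i2: "integrable ?M (\<lambda>x. ?q x * \<phi> x)"
    and i3: "integrable ?M \<phi>" and i4: "integrable ?M \<phi>''"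
    using \<phi>(3) c
    by (auto intro!: integrable_continuous_lebesgue_on integrable_mult_continuous[OF _ _ iq]
        continuous_on_mult[OF continuous_barrier])
  have "((\<lambda>x. ?V x * (\<omega>\<^sup>2 * \<phi> x - \<phi>'' x) - lam * ?q x * \<phi> x) has_integral 0) {0<..<1}"
    using barrier_weak[OF \<xi> \<omega> \<phi>(1,2) bc(1,2)] by (simp add: has_integral_Icc_iff_Ioo)
  moreover have "((\<lambda>x. ?V x * (\<omega>\<^sup>2 * \<phi> x - \<phi>'' x) - lam * ?q x * \<phi> x) has_integral
      (\<integral>x. ?V x * (\<omega>\<^sup>2 * \<phi> x - \<phi>'' x) - lam * ?q x * \<phi> x \<partial>?M)) {0<..<1}"
    using i1 integrable_mult_right[OF i2, of lam]
    by (intro has_integral_integral_lebesgue_on Bochner_Integration.integrable_diff) (auto simp: mult.assoc)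
  ultimately have "(\<integral>x. ?V x * (\<omega>\<^sup>2 * \<phi> x - \<phi>'' x) - lam * ?q x * \<phi> x \<partial>?M) = 0"
    by (rule has_integral_unique[symmetric])
  then have V: "(\<integral>x. ?V x * (\<omega>\<^sup>2 * \<phi> x - \<phi>'' x) \<partial>?M) = lam * (\<integral>x. ?q x * \<phi> x \<partial>?M)"
    using i1 i2 by (simp add: mult.assoc)
  have "(\<integral>x. \<phi>'' x \<partial>?M) = \<phi>' 1 - \<phi>' 0"
    using \<phi> by (intro integral_FTC_lebesgue_on) auto
  moreover have "0 \<le> \<omega>\<^sup>2 * (\<integral>x. \<phi> x \<partial>?M)"
    using \<phi>(4) by (intro mult_nonneg_nonneg integral_nonneg_AE AE_I2) auto
  ultimately have pos: "0 \<le> \<omega>\<^sup>2 * (\<integral>x. \<phi> x \<partial>?M) - (\<integral>x. \<phi>'' x \<partial>?M)"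
    using bc by linarith
  have "(\<integral>x. \<sigma> * lam * ?q x * \<phi> x \<partial>?M) = \<sigma> * (lam * (\<integral>x. ?q x * \<phi> x \<partial>?M))"
    by (simp add: mult.assoc)
  also have "\<dots> \<le> \<sigma> * (\<integral>x. ?V x * (\<omega>\<^sup>2 * \<phi> x - \<phi>'' x) \<partial>?M) +
      \<kappa> * (\<omega>\<^sup>2 * (\<integral>x. \<phi> x \<partial>?M) - (\<integral>x. \<phi>'' x \<partial>?M))"
    using pos \<kappa> by (simp add: V)
  also have "\<dots> = (\<integral>x. \<sigma> * (?V x * (\<omega>\<^sup>2 * \<phi> x - \<phi>'' x)) + \<kappa> * (\<omega>\<^sup>2 * \<phi> x - \<phi>'' x) \<partial>?M)"
    using i1 i3 i4 by simp
  also have "\<dots> = (\<integral>x. \<sigma> * ((?V x + \<sigma> * \<kappa>) * (\<omega>\<^sup>2 * \<phi> x - \<phi>'' x)) \<partial>?M)"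
  proof (rule Bochner_Integration.integral_cong)
    fix x
    have "\<sigma> * ((?V x + \<sigma> * \<kappa>) * (\<omega>\<^sup>2 * \<phi> x - \<phi>'' x)) =
        \<sigma> * (?V x * (\<omega>\<^sup>2 * \<phi> x - \<phi>'' x)) + (\<sigma> * \<sigma>) * (\<kappa> * (\<omega>\<^sup>2 * \<phi> x - \<phi>'' x))"
      by (simp add: distrib_right distrib_left mult_ac)
    then show "\<sigma> * (?V x * (\<omega>\<^sup>2 * \<phi> x - \<phi>'' x)) + \<kappa> * (\<omega>\<^sup>2 * \<phi> x - \<phi>'' x) =
        \<sigma> * ((?V x + \<sigma> * \<kappa>) * (\<omega>\<^sup>2 * \<phi> x - \<phi>'' x))"
      by (simp add: \<sigma>)
  qed simp
  finally show ?thesis .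
qed

lemma beta_bounds:
  assumes "y \<in> beta \<mu> f0 v" "f0 \<le> 1"
  shows "f0 \<le> y" "y \<le> 1" "v < \<mu> \<Longrightarrow> y = f0" "\<mu> < v \<Longrightarrow> y = 1"
  using assms by (auto simp: beta_def reaction_def heaviside_def split: if_splits)

text \<open>The source can exceed q only in the right phase with v \<ge> \<mu>. There the excess
  over the shifted barrier is at least \<gamma>, and since y - q is at most 1, the slope lam /
  \<gamma> is steep enough.\<close>

lemma react_upper:
  assumes "0 < \<omega>" "0 < lam" "0 < f0" "f0 < 1" "0 \<le> \<xi>" "\<xi> \<le> 1"
    and \<gamma>: "0 < \<gamma>" "barrier \<omega> f0 lam \<xi> \<xi> + \<kappa> + \<gamma> \<le> \<mu>"
    and x: "x \<in> {0<..<1}" and y: "y \<in> beta \<mu> f0 v"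
  shows "lam * (y - two_phase f0 \<xi> x) \<le> lam / \<gamma> * max 0 (v - (barrier \<omega> f0 lam \<xi> x + \<kappa>))"
proof (cases "\<xi> < x \<and> \<mu> \<le> v")
  \<comment> \<open>Equality v = \<mu> belongs to this case, because \<open>beta\<close> then allows
    every value up to 1.\<close>
  case True
  have "barrier \<omega> f0 lam \<xi> x \<le> barrier \<omega> f0 lam \<xi> \<xi>"
    using assms True by (intro barrier_antimono) auto
  then have "\<gamma> \<le> max 0 (v - (barrier \<omega> f0 lam \<xi> x + \<kappa>))"
    using True \<gamma> by auto
  then have "lam / \<gamma> * \<gamma> \<le> lam / \<gamma> * max 0 (v - (barrier \<omega> f0 lam \<xi> x + \<kappa>))"
    using assms by (intro mult_left_mono) auto
  moreover have "lam * (y - two_phase f0 \<xi> x) \<le> lam"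
    using beta_bounds[OF y] assms True by (simp add: two_phase_def)
  ultimately show ?thesis
    using \<gamma> by simp
next
  case False
  then have "y \<le> two_phase f0 \<xi> x"
    using beta_bounds[OF y] assms by (auto simp: two_phase_def)
  then have "lam * (y - two_phase f0 \<xi> x) \<le> 0"
    using assms by (simp add: mult_le_0_iff)
  also have "0 \<le> lam / \<gamma> * max 0 (v - (barrier \<omega> f0 lam \<xi> x + \<kappa>))"
    using assms by (intro mult_nonneg_nonneg) auto
  finally show ?thesis .
qed

text \<open>Mirror image: the source can fall short of q only in the left phase with v \<le> \<mu>,
  where the barrier exceeds v by at least \<gamma>.\<close>

lemma react_lower:
  assumes "0 < \<omega>" "0 < lam" "0 < f0" "f0 < 1" "0 \<le> \<xi>" "\<xi> \<le> 1"
    and \<gamma>: "0 < \<gamma>" "\<mu> \<le> barrier \<omega> f0 lam \<xi> \<xi> - \<kappa> - \<gamma>"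
    and x: "x \<in> {0<..<1}" and y: "y \<in> beta \<mu> f0 v"
  shows "lam * (two_phase f0 \<xi> x - y) \<le> lam / \<gamma> * max 0 ((barrier \<omega> f0 lam \<xi> x - \<kappa>) - v)"
proof (cases "x \<le> \<xi> \<and> v \<le> \<mu>")
  case True
  have "barrier \<omega> f0 lam \<xi> \<xi> \<le> barrier \<omega> f0 lam \<xi> x"
    using assms True by (intro barrier_antimono) auto
  then have "\<gamma> \<le> max 0 ((barrier \<omega> f0 lam \<xi> x - \<kappa>) - v)"
    using True \<gamma> by auto
  then have "lam / \<gamma> * \<gamma> \<le> lam / \<gamma> * max 0 ((barrier \<omega> f0 lam \<xi> x - \<kappa>) - v)"
    using assms by (intro mult_left_mono) auto
  moreover have "lam * (two_phase f0 \<xi> x - y) \<le> lam"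
    using beta_bounds[OF y] assms True by (simp add: two_phase_def)
  ultimately show ?thesis
    using \<gamma> by simp
next
  case False
  then have "two_phase f0 \<xi> x \<le> y"
    using beta_bounds[OF y] assms by (auto simp: two_phase_def)
  then have "lam * (two_phase f0 \<xi> x - y) \<le> 0"
    using assms by (simp add: mult_le_0_iff)
  also have "0 \<le> lam / \<gamma> * max 0 ((barrier \<omega> f0 lam \<xi> x - \<kappa>) - v)"
    using assms by (intro mult_nonneg_nonneg) auto
  finally show ?thesis .
qed

lemma barrier_comparison:
  assumes params: "0 < \<omega>" "0 < lam" "0 < f0" "f0 < 1" and \<xi>: "0 \<le> \<xi>" "\<xi> < 1"
    and \<sigma>: "\<sigma> * \<sigma> = 1" and \<kappa>: "0 \<le> \<kappa>" and C: "0 \<le> C"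
    and react: "\<And>x v y. x \<in> {0<..<1} \<Longrightarrow> y \<in> beta \<mu> f0 v \<Longrightarrow>
      \<sigma> * lam * (y - two_phase f0 \<xi> x) \<le> C * max 0 (\<sigma> * (v - (barrier \<omega> f0 lam \<xi> x + \<sigma> * \<kappa>)))"
    and u0: "integrable (lebesgue_on {0<..<1}) u0"
    and init: "AE x in lebesgue_on {0<..<1}. \<sigma> * (u0 x - (barrier \<omega> f0 lam \<xi> x + \<sigma> * \<kappa>)) \<le> 0"
    and u: "weak_solution \<omega> \<mu> f0 lam u0 u" and t: "0 \<le> t"
  shows "AE x in lebesgue_on {0<..<1}. \<sigma> * (u t x - (barrier \<omega> f0 lam \<xi> x + \<sigma> * \<kappa>)) \<le> 0"
proof -
  obtain ux h K where
    L2: "\<forall>T>0. in_L2 ({0<..<T} \<times> {0<..<1}) (\<lambda>(t, x). u t x) \<and> in_L2 ({0<..<T} \<times> {0<..<1}) (\<lambda>(t, x). ux t x)"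
    and V: "AE t in lebesgue_on {0<..}. in_V_with_deriv (u t) (ux t)"
    and h: "(\<lambda>(t, x). h t x) \<in> borel_measurable (lebesgue_on ({0<..} \<times> {0<..<1}))"
      "AE (t, x) in lebesgue_on ({0<..} \<times> {0<..<1}). \<bar>h t x\<bar> \<le> K"
      "AE (t, x) in lebesgue_on ({0<..} \<times> {0<..<1}). h t x \<in> beta \<mu> f0 (u t x)"
    and weak: "\<forall>T>0. \<forall>\<phi> \<phi>t \<phi>x. test_function T \<phi> \<phi>t \<phi>x \<longrightarrow>
           (\<integral>x. u T x * \<phi> T x \<partial>lebesgue_on {0<..<1}) - (\<integral>x. u0 x * \<phi> 0 x \<partial>lebesgue_on {0<..<1})
           + (\<integral>(t, x). - u t x * \<phi>t t x + ux t x * \<phi>x t x + \<omega>\<^sup>2 * u t x * \<phi> t x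
                \<partial>lebesgue_on ({0<..<T} \<times> {0<..<1}))
           = lam * (\<integral>(t, x). h t x * \<phi> t x \<partial>lebesgue_on ({0<..<T} \<times> {0<..<1}))"
    using u unfolding weak_solution_def by (elim conjE exE) (rule that)
  interpret comparison_setting \<omega> lam \<sigma> C K 1 u0 "\<lambda>x. barrier \<omega> f0 lam \<xi> x + \<sigma> * \<kappa>" "two_phase f0 \<xi>" u ux h
  proof
    show "0 < \<omega>" "0 \<le> C" by fact+
    show "integrable (lebesgue_on {0<..<1}) u0" by fact
    show "in_L2 {0<..<1} (u t)" if "0 \<le> t" for t
      using u that unfolding weak_solution_def by blast
    show "AE x in lebesgue_on {0<..<1}. u 0 x = u0 x"
      using u unfolding weak_solution_def by blast
    show "((\<lambda>t. L2_norm01 (\<lambda>x. u t x - u s x)) \<longlongrightarrow> 0) (at s within {0..})" if "0 \<le> s" for s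
      using u that unfolding weak_solution_def by blast
    show "in_L2 ({0<..<T} \<times> {0<..<1}) (\<lambda>(t, x). u t x)" "in_L2 ({0<..<T} \<times> {0<..<1}) (\<lambda>(t, x). ux t x)"
      if "0 < T" for T
      using L2 that by blast+
    show "continuous_on UNIV (\<lambda>x. barrier \<omega> f0 lam \<xi> x + \<sigma> * \<kappa>)"
      by (intro continuous_intros)
    show "two_phase f0 \<xi> \<in> borel_measurable borel"
      by (rule two_phase_borel)
    show "\<bar>two_phase f0 \<xi> x\<bar> \<le> 1" for x
      using params by (intro two_phase_bound) auto
    show "AE (t, x) in lebesgue_on ({0<..} \<times> {0<..<1}). \<sigma> * lam * (h t x - two_phase f0 \<xi> x)
        \<le> C * max 0 (\<sigma> * (u t x - (barrier \<omega> f0 lam \<xi> x + \<sigma> * \<kappa>)))"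
    proof -
      have "AE z in lebesgue_on ({0<..} \<times> {0<..<1::real}). z \<in> {0<..} \<times> {0<..<1}"
        by (rule AE_I2) simp
      with h(3) show ?thesis
        by eventually_elim (use react in auto)
    qed
    show "(\<integral>x. u T x * \<phi> T x \<partial>lebesgue_on {0<..<1}) - (\<integral>x. u0 x * \<phi> 0 x \<partial>lebesgue_on {0<..<1})
           + (\<integral>(t, x). - u t x * \<phi>t t x + ux t x * \<phi>x t x + \<omega>\<^sup>2 * u t x * \<phi> t x
                \<partial>lebesgue_on ({0<..<T} \<times> {0<..<1}))
           = lam * (\<integral>(t, x). h t x * \<phi> t x \<partial>lebesgue_on ({0<..<T} \<times> {0<..<1}))"
      if "0 < T" "test_function T \<phi> \<phi>t \<phi>x" for T \<phi> \<phi>t \<phi>x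
      using weak that by blast
    show "(\<integral>x. \<sigma> * lam * two_phase f0 \<xi> x * \<phi> x \<partial>lebesgue_on {0<..<1}) \<le>
        (\<integral>x. \<sigma> * ((barrier \<omega> f0 lam \<xi> x + \<sigma> * \<kappa>) * (\<omega>\<^sup>2 * \<phi> x - \<phi>'' x)) \<partial>lebesgue_on {0<..<1})"
      if "\<And>x. (\<phi> has_real_derivative \<phi>' x) (at x)" "\<And>x. (\<phi>' has_real_derivative \<phi>'' x) (at x)"
        "continuous_on UNIV \<phi>''" "\<And>x. x \<in> {0..1} \<Longrightarrow> 0 \<le> \<phi> x" "\<phi> 1 = 0" "\<phi>' 0 = 0" "\<phi>' 1 \<le> 0"
      for \<phi> \<phi>' \<phi>''
      by (rule barrier_super[OF \<xi> _ _ _ \<kappa> \<sigma> that]) (use params in auto)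
  qed (fact V h(1) h(2) init)+
  show ?thesis
    using t by (rule comparison)
qed

theorem theorem1p2:
  fixes \<omega> \<mu> f0 lam xbar :: real and ubar :: "real \<Rightarrow> real"
  assumes "\<omega> > 0" and "\<mu> > 0" and "0 < f0" and "f0 < 1"
    and "lambda1 \<omega> \<mu> f0 < lam"
    and "rstar \<omega> f0 < xbar" and "xbar < 1" and "gfun \<omega> f0 xbar = lam / \<mu>"
    and "monotone_solution \<omega> \<mu> f0 lam xbar ubar"
  shows "\<forall>\<epsilon>>0. \<exists>\<delta>>0. \<forall>u0 u.
           in_Linf u0 \<and> (AE x in lebesgue_on {0<..<1}. 0 \<le> u0 x) \<and>
           Linf_norm (\<lambda>x. u0 x - ubar x) < ereal \<delta> \<and>
           weak_solution \<omega> \<mu> f0 lam u0 u \<and> non_degenerate \<mu> u \<longrightarrow>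
           (\<forall>t\<ge>0. Linf_norm (\<lambda>x. u t x - ubar x) < ereal \<epsilon>)"
proof (intro allI impI)
  fix \<epsilon> :: real
  assume \<epsilon>: "0 < \<epsilon>"
  let ?M = "lebesgue_on {0<..<1::real}"
  let ?V = "barrier \<omega> f0 lam"
  note params = \<open>\<omega> > 0\<close> \<open>0 < f0\<close> \<open>f0 < 1\<close>
  note lev = level_near[OF params \<open>\<mu> > 0\<close> assms(6-8)]
  have r0: "0 < rstar \<omega> f0"
    using rstar_props(1)[OF params] .
  then have xbar: "0 < xbar" "xbar < 1"
    using assms by auto
  have ubar: "ubar x = ?V xbar x" if "x \<in> {0..1}" for x
    using monotone_solution_eq_barrier[OF params xbar(1) lev(1,3) assms(9) that] .
  obtain d where d: "d > 0" "\<And>\<xi> x. \<xi> \<in> {0..1} \<Longrightarrow> \<bar>\<xi> - xbar\<bar> < d \<Longrightarrow> x \<in> {0..1} \<Longrightarrow>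
      \<bar>?V \<xi> x - ?V xbar x\<bar> < \<epsilon> / 2"
    using barrier_close[of \<omega> lam f0 xbar "\<epsilon> / 2"] lev(1) params xbar \<epsilon> by auto
  \<comment> \<open>Both points lie within d of \<open>xbar\<close>. The left one does not pass
    \<open>rstar\<close>, since the value at the free boundary is known to be monotone only beyond
    it; the right one stays away from 1, where the barrier must satisfy its Dirichlet
    condition.\<close>
  define a where "a = xbar - min (d / 2) (xbar - rstar \<omega> f0)"
  define b where "b = xbar + min (d / 2) ((1 - xbar) / 2)"
  have a: "rstar \<omega> f0 \<le> a" "a < xbar" "\<bar>a - xbar\<bar> < d"
    using d(1) assms(6) by (auto simp: a_def)
  have b: "xbar < b" "b < 1" "\<bar>b - xbar\<bar> < d"
    using d(1) xbar by (auto simp: b_def min_def field_simps)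
  \<comment> \<open>Each gap is halved: one half is kept as \<gamma>, the other makes room for the
    shift \<kappa>. The bound \<epsilon> / 4 leaves \<epsilon> / 2 for the distance of the
    barriers.\<close>
  define \<kappa> where "\<kappa> = min (\<epsilon> / 4) (min ((?V a a - \<mu>) / 2) ((\<mu> - ?V b b) / 2))"
  define \<gamma>a where "\<gamma>a = (?V a a - \<mu>) / 2"
  define \<gamma>b where "\<gamma>b = (\<mu> - ?V b b) / 2"
  have pos: "0 < \<kappa>" "0 < \<gamma>a" "0 < \<gamma>b"
    using lev(4)[OF b(1)] lev(5)[OF a(1,2)] \<epsilon> by (auto simp: \<kappa>_def \<gamma>a_def \<gamma>b_def)
  have \<kappa>: "\<kappa> \<le> \<epsilon> / 4" "\<kappa> \<le> \<gamma>a" "\<kappa> \<le> \<gamma>b"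
    unfolding \<kappa>_def \<gamma>a_def \<gamma>b_def by (simp_all only: min_le_iff_disj order_refl simp_thms)
  \<comment> \<open>With this order, initial data within \<kappa> of the stationary solution start
    between the shifted barriers.\<close>
  have ord: "?V a x \<le> ?V xbar x" "?V xbar x \<le> ?V b x" if "x \<in> {0..1}" for x
    using a b r0 xbar params lev(1) that by (intro barrier_mono; simp)+
  show "\<exists>\<delta>>0. \<forall>u0 u.
           in_Linf u0 \<and> (AE x in ?M. 0 \<le> u0 x) \<and>
           Linf_norm (\<lambda>x. u0 x - ubar x) < ereal \<delta> \<and>
           weak_solution \<omega> \<mu> f0 lam u0 u \<and> non_degenerate \<mu> u \<longrightarrow>
           (\<forall>t\<ge>0. Linf_norm (\<lambda>x. u t x - ubar x) < ereal \<epsilon>)"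
  \<comment> \<open>The shift of the barriers is itself the required \<delta>.\<close>
  proof (intro exI[of _ \<kappa>] conjI allI impI pos(1), elim conjE)
    fix u0 u :: _ and t :: real
    assume u0: "in_Linf u0" and close: "Linf_norm (\<lambda>x. u0 x - ubar x) < ereal \<kappa>"
      and u: "weak_solution \<omega> \<mu> f0 lam u0 u" and t: "0 \<le> t"
    have I: "AE x in ?M. x \<in> {0<..<1}"
      by (rule AE_I2) auto
    have u0m: "u0 \<in> borel_measurable ?M"
      using u0 by (simp add: in_Linf_def)
    have u0i: "integrable ?M u0"
    proof -
      obtain c where c: "Linf_norm u0 \<le> ereal c"
        using u0 unfolding in_Linf_def by (cases "Linf_norm u0") auto
      have "AE x in ?M. ereal \<bar>u0 x\<bar> \<le> Linf_norm u0"
        unfolding Linf_norm_def by (rule esssup_AE)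
      then have "AE x in ?M. norm (u0 x) \<le> c"
        by eventually_elim (use c in \<open>auto dest: order_trans\<close>)
      then show ?thesis
        by (intro finite_measure.integrable_const_bound[OF finite_measure_lebesgue_on]) (auto simp: u0m)
    qed
    have "AE x in ?M. ereal \<bar>u0 x - ubar x\<bar> \<le> Linf_norm (\<lambda>x. u0 x - ubar x)"
      unfolding Linf_norm_def by (rule esssup_AE)
    then have u0c: "AE x in ?M. \<bar>u0 x - ubar x\<bar> < \<kappa>"
      by eventually_elim (use close in \<open>auto dest: le_less_trans\<close>)
    have upper: "AE x in ?M. 1 * (u t x - (?V b x + 1 * \<kappa>)) \<le> 0"
    proof (rule barrier_comparison[where C = "lam / \<gamma>b"])
      show "1 * lam * (y - two_phase f0 b x) \<le> lam / \<gamma>b * max 0 (1 * (v - (?V b x + 1 * \<kappa>)))"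
        if "x \<in> {0<..<1}" "y \<in> beta \<mu> f0 v" for x v y
      proof -
        have "?V b b + \<kappa> + \<gamma>b \<le> \<mu>"
          using \<kappa> by (simp add: \<gamma>b_def field_simps)
        then show ?thesis
          using react_upper[of \<omega> lam f0 b \<gamma>b \<kappa> \<mu> x y v] that params lev(1) b xbar pos by simp
      qed
      show "AE x in ?M. 1 * (u0 x - (?V b x + 1 * \<kappa>)) \<le> 0"
        using u0c I
      proof eventually_elim
        case (elim x)
        then show ?case
          using ord(2)[of x] ubar[of x] by auto
      qed
    qed (use u t params lev(1) b xbar pos u0i in auto)
    have lower: "AE x in ?M. (-1) * (u t x - (?V a x + (-1) * \<kappa>)) \<le> 0"
    proof (rule barrier_comparison[where C = "lam / \<gamma>a"])
      show "(-1) * lam * (y - two_phase f0 a x) \<le> lam / \<gamma>a * max 0 ((-1) * (v - (?V a x + (-1) * \<kappa>)))"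
        if "x \<in> {0<..<1}" "y \<in> beta \<mu> f0 v" for x v y
      proof -
        have "\<mu> \<le> ?V a a - \<kappa> - \<gamma>a"
          using \<kappa> by (simp add: \<gamma>a_def field_simps)
        then show ?thesis
          using react_lower[of \<omega> lam f0 a \<gamma>a \<mu> \<kappa> x y v] that params lev(1) a r0 xbar pos
          by (simp add: algebra_simps)
      qed
      show "AE x in ?M. (-1) * (u0 x - (?V a x + (-1) * \<kappa>)) \<le> 0"
        using u0c I
      proof eventually_elim
        case (elim x)
        then show ?case
          using ord(1)[of x] ubar[of x] by auto
      qed
    qed (use u t params lev(1) a r0 xbar pos u0i in auto)
    \<comment> \<open>The strip contributes \<epsilon> / 2 and the shift \<epsilon> / 4. A bound
      strictly below \<epsilon> is kept because the essential supremum only preserves weak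
      inequalities.\<close>
    have "AE x in ?M. ereal \<bar>u t x - ubar x\<bar> \<le> ereal (3 * \<epsilon> / 4)"
      using upper lower I
    proof eventually_elim
      case (elim x)
      have "\<bar>?V a x - ?V xbar x\<bar> < \<epsilon> / 2" "\<bar>?V b x - ?V xbar x\<bar> < \<epsilon> / 2"
        by (rule d(2); use a b r0 xbar elim(3) in simp)+
      moreover have "ubar x = ?V xbar x"
        using elim(3) by (intro ubar) auto
      moreover have "u t x \<le> ?V b x + \<kappa>" "?V a x - \<kappa> \<le> u t x"
        using elim(1,2) by simp_all
      ultimately have "\<bar>u t x - ubar x\<bar> \<le> 3 * \<epsilon> / 4"
        using \<kappa>(1) unfolding abs_le_iff abs_less_iff by simp
      then show ?case
        by simp
    qed
    moreover have "(\<lambda>x. ereal \<bar>u t x - ubar x\<bar>) \<in> borel_measurable ?M"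
    proof -
      have "u t \<in> borel_measurable ?M"
        using u t by (simp add: weak_solution_def in_L2_def)
      moreover have "ubar \<in> borel_measurable ?M"
        using assms(9) unfolding monotone_solution_def free_boundary_solution_def
        by (intro continuous_imp_measurable_on_sets_lebesgue) (auto intro: continuous_on_subset)
      ultimately show ?thesis
        by measurable
    qed
    ultimately have "Linf_norm (\<lambda>x. u t x - ubar x) \<le> ereal (3 * \<epsilon> / 4)"
      unfolding Linf_norm_def by (intro esssup_I)
    also have "\<dots> < ereal \<epsilon>"
      using \<epsilon> by simp
    finally show "Linf_norm (\<lambda>x. u t x - ubar x) < ereal \<epsilon>" .
  qed
qed

end
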